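(* Let $k \ge 7$ be an odd integer, let $\chi$ be a nonprincipal, real, primitive, odd Dirichlet character modulo $k$, and let $a$ be a positive integer. Then \[ \sum_{ j=1 }^{ k-1 } \chi(j) \cot^2 \left( \frac{ \pi j }{ k } \right) \sin \left( \frac{ 2 \pi a j }{ k } \right) = \sqrt k \left( 4 a \, h(-k) - \chi(a) - 4 \sum_{ m=0 }^{ a-1 } \chi(m) (a-m) \right) , \] where $h(-k)$ is the class number of the imaginary quadratic field $\mathbb{Q}(\sqrt{-k})$.
   Context: A Dirichlet character modulo $k$ is a nonzero completely multiplicative $k$-periodic function $\chi:\mathbb{Z}\to\mathbb{C}$ with $\chi(n)=0$ whenever $\gcd(n,k)>1$; it is real if it takes only real values, odd if $\chi(-n)=-\chi(n)$, and primitive if it is not induced by a character modulo a proper divisor of $k$. $h(-k)$ denotes the class number of $\mathbb{Q}(\sqrt{-k})$. *)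

theory Defs
  imports
    Complex_Main
    "HOL-Computational_Algebra.Polynomial"
    "HOL-Algebra.Ideal"
begin

definition dirichlet_char :: "nat \<Rightarrow> (int \<Rightarrow> complex) \<Rightarrow> bool" where
  "dirichlet_char k \<chi> \<longleftrightarrow>
     (\<exists>n. \<chi> n \<noteq> 0) \<and>
     (\<forall>m n. \<chi> (m * n) = \<chi> m * \<chi> n) \<and>
     (\<forall>n. \<chi> (n + int k) = \<chi> n) \<and>
     (\<forall>n. gcd n (int k) > 1 \<longrightarrow> \<chi> n = 0)"

definition principal_char :: "nat \<Rightarrow> int \<Rightarrow> complex" where
  "principal_char k n = (if coprime n (int k) then 1 else 0)"

definition real_char :: "(int \<Rightarrow> complex) \<Rightarrow> bool" where
  "real_char \<chi> \<longleftrightarrow> (\<forall>n. \<chi> n \<in> \<real>)"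

definition odd_char :: "(int \<Rightarrow> complex) \<Rightarrow> bool" where
  "odd_char \<chi> \<longleftrightarrow> (\<forall>n. \<chi> (- n) = - \<chi> n)"

text \<open>The character \<open>\<chi>\<close> modulo \<open>k\<close> is induced by \<open>\<chi>'\<close> if it is the product of
  \<open>\<chi>'\<close> with the principal character modulo \<open>k\<close>.\<close>

definition induced_by :: "nat \<Rightarrow> (int \<Rightarrow> complex) \<Rightarrow> (int \<Rightarrow> complex) \<Rightarrow> bool" where
  "induced_by k \<chi> \<chi>' \<longleftrightarrow> (\<forall>n. \<chi> n = principal_char k n * \<chi>' n)"

definition primitive_char :: "nat \<Rightarrow> (int \<Rightarrow> complex) \<Rightarrow> bool" where
  "primitive_char k \<chi> \<longleftrightarrow>
     dirichlet_char k \<chi> \<and>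
     \<not> (\<exists>d \<chi>'. d dvd k \<and> d < k \<and> dirichlet_char d \<chi>' \<and> induced_by k \<chi> \<chi>')"

definition quadratic_field :: "int \<Rightarrow> complex set" where
  "quadratic_field d = {of_rat p + of_rat q * csqrt (of_int d) | p q. True}"

definition ring_of_integers :: "complex set \<Rightarrow> complex ring" where
  "ring_of_integers K =
     \<lparr>carrier = {x \<in> K. algebraic_int x}, monoid.mult = (*), one = 1, zero = 0, add = (+)\<rparr>"

definition nonzero_ideals :: "('a, 'b) ring_scheme \<Rightarrow> 'a set set" where
  "nonzero_ideals R = {I. ideal I R \<and> I \<noteq> {\<zero>\<^bsub>R\<^esub>}}"

text \<open>Two nonzero ideals of a domain are in the same class if they differ by a nonzero principal
  fractional ideal; clearing denominators, this means \<open>\<alpha> I = \<beta> J\<close> with nonzero ring elements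
  \<open>\<alpha>, \<beta>\<close>. Since every fractional ideal is a nonzero multiple of an integral ideal, the quotient is
  the group of fractional ideals modulo principal ones.\<close>

definition ideal_class_rel :: "('a, 'b) ring_scheme \<Rightarrow> ('a set \<times> 'a set) set" where
  "ideal_class_rel R =
     {(I, J). I \<in> nonzero_ideals R \<and> J \<in> nonzero_ideals R \<and>
        (\<exists>\<alpha> \<in> carrier R - {\<zero>\<^bsub>R\<^esub>}. \<exists>\<beta> \<in> carrier R - {\<zero>\<^bsub>R\<^esub>}.
           (\<lambda>x. \<alpha> \<otimes>\<^bsub>R\<^esub> x) ` I = (\<lambda>x. \<beta> \<otimes>\<^bsub>R\<^esub> x) ` J)}"

text \<open>Meaningful for a number field \<open>K\<close> embedded in the complex numbers.\<close>

definition class_number :: "complex set \<Rightarrow> nat" where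
  "class_number K =
     card (nonzero_ideals (ring_of_integers K) // ideal_class_rel (ring_of_integers K))"

end

theory Submission
  imports
    Defs
    "HOL-Number_Theory.Number_Theory"
    "HOL-Computational_Algebra.Squarefree"
    "HOL-Complex_Analysis.Complex_Analysis"
    "HOL-Real_Asymp.Real_Asymp"
    "Jordan_Normal_Form.Char_Poly"
begin

text \<open>As functions of \<open>a\<close>, both sides vanish at \<open>0\<close> and, since \<open>G = \<i> \<surd>k\<close> for the Gauss sum \<open>G\<close> of \<open>\<chi>\<close>,
  have the same second difference. They therefore agree once they agree at \<open>a = k\<close>, which amounts
  to \<open>h(-k) = - (1/k) \<Sum> j \<chi>(j)\<close>.

  The class number formula and the sign of \<open>G\<close> come out together. The number of ideals of norm \<open>n\<close> is
  \<open>\<Sum> \<chi>(d)\<close> over the divisors \<open>d\<close> of \<open>n\<close>. Hence the sum of \<open>exp (- t N(I))\<close> over all nonzero ideals \<open>I\<close>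
  equals \<open>L(1) / t - L(0) / 2 + o(1)\<close> as \<open>t\<close> tends to \<open>0\<close>, by the trapezoidal rule. On the other hand, each
  ideal class contributes \<open>(\<theta>(t) - 1) / 2\<close> with the theta series \<open>\<theta>\<close> of a binary quadratic form, which is
  \<open>A / t - 1 / 2 + o(1)\<close>. Comparing the constant terms gives \<open>h = L(0)\<close>; comparing the leading terms gives
  \<open>L(1) = h A > 0\<close>, and finite Fourier expansion gives \<open>L(1) = \<plusminus> \<pi> L(0) / \<surd>k\<close> with the sign of \<open>G\<close>.\<close>

text \<open>\<open>class_number\<close> is a \<open>card\<close>, which is 0 on an infinite
  quotient, so finiteness of the class group has to come out of the argument. It does so from the
  leading terms: every class leads to a form of discriminant -k, so every class contributes the same
  positive multiple of 1/t to a total of order 1/t. The constant terms are harder to reach. A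
  two-dimensional theta series is needed up to o(1), which forces an error of relative size smaller
  than t and hence a summation formula one order beyond the trapezoidal rule. Primitivity provides
  the arithmetic of the modulus: k is squarefree and 3 modulo 4, so -k is a fundamental
  discriminant, and k >= 7 leaves only the units 1 and -1, whence the factor 1/2 of each class. The
  bridge from \<open>\<chi>\<close> to ideals is the splitting law for primes. It is obtained from
  the Gauss sum itself, on which Frobenius modulo p acts as multiplication by
  \<open>\<chi> p\<close>. Second differences in \<open>a\<close> are natural because that of sin (a
  \<theta>) carries a factor sin^2 (\<theta>/2), which cancels the denominator of cot^2
  (\<theta>/2).\<close>

unbundle no vec_syntax

section \<open>Algebraic integers\<close>

text \<open>The coefficients form an integer matrix for which the list of elements of
  \<open>S\<close> is an eigenvector with eigenvalue \<open>\<alpha>\<close>; its characteristic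
  polynomial is monic and integral. The element \<open>s0\<close> makes the eigenvector
  nonzero.\<close>

lemma algebraic_int_if_stable_span:
  fixes S :: "complex set"
  assumes fin: "finite S" and s0: "s0 \<in> S" "s0 \<noteq> 0"
    and st: "\<And>s. s \<in> S \<Longrightarrow> \<exists>c :: complex \<Rightarrow> int. \<alpha> * s = (\<Sum>r\<in>S. of_int (c r) * r)"
  shows "algebraic_int \<alpha>"
proof -
  obtain C :: "complex \<Rightarrow> complex \<Rightarrow> int" where C: "\<And>s. s \<in> S \<Longrightarrow> \<alpha> * s = (\<Sum>r\<in>S. of_int (C s r) * r)"
    using st by metis
  obtain xs where xs: "set xs = S" "distinct xs"
    using fin finite_distinct_list by blast
  define n where "n = length xs"
  define M :: "int mat" where "M = mat n n (\<lambda>(i,j). C (xs ! i) (xs ! j))"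
  define M' :: "complex mat" where "M' = map_mat of_int M"
  define v :: "complex vec" where "v = vec n (\<lambda>i. xs ! i)"
  have M: "M \<in> carrier_mat n n" by (simp add: M_def)
  have M': "M' \<in> carrier_mat n n" using M by (simp add: M'_def)
  have v: "v \<in> carrier_vec n" by (simp add: v_def)
  have bij: "bij_betw ((!) xs) {..<n} S"
    by (rule bij_betw_nth[OF xs(2)]) (simp_all add: n_def xs)
  have "eigenvector M' v \<alpha>"
    unfolding eigenvector_def
  proof (intro conjI)
    show "v \<in> carrier_vec (dim_row M')" using M' v by simp
    obtain i where "i < n" "xs ! i = s0" using s0(1) xs by (metis in_set_conv_nth n_def)
    hence "v $ i \<noteq> 0" using s0 by (simp add: v_def)
    moreover have "0\<^sub>v (dim_row M') $ i = (0::complex)" using \<open>i < n\<close> M' by simp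
    ultimately show "v \<noteq> 0\<^sub>v (dim_row M')" by metis
    show "M' *\<^sub>v v = \<alpha> \<cdot>\<^sub>v v"
    proof (rule eq_vecI)
      fix i assume "i < dim_vec (\<alpha> \<cdot>\<^sub>v v)"
      hence i: "i < n" by (simp add: v_def)
      have "(M' *\<^sub>v v) $ i = (\<Sum>j<n. of_int (C (xs ! i) (xs ! j)) * xs ! j)"
        using i by (simp add: M'_def M_def v_def scalar_prod_def lessThan_atLeast0)
      also have "\<dots> = (\<Sum>r\<in>S. of_int (C (xs ! i) r) * r)"
        using sum.reindex_bij_betw[OF bij, of "\<lambda>r. of_int (C (xs ! i) r) * r"] by simp
      also have "\<dots> = \<alpha> * xs ! i" using C[of "xs ! i"] i xs(1) nth_mem[of i xs] by (simp only: n_def)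
      finally show "(M' *\<^sub>v v) $ i = (\<alpha> \<cdot>\<^sub>v v) $ i" using i by (simp add: v_def)
    qed (use M' v in simp)
  qed
  hence "eigenvalue M' \<alpha>" by (auto simp: eigenvalue_def)
  hence "poly (char_poly M') \<alpha> = 0" using eigenvalue_root_char_poly[OF M'] by simp
  moreover have "char_poly M' = map_poly of_int (char_poly M)"
    unfolding M'_def by (rule of_int_hom.char_poly_hom[OF M])
  moreover have "lead_coeff (char_poly M) = 1" using degree_monic_char_poly[OF M] by simp
  ultimately show ?thesis unfolding algebraic_int_altdef_ipoly by metis
qed

definition int_span :: "complex set \<Rightarrow> complex set" where
  "int_span S = {\<Sum>r\<in>S. of_int (c r) * r |c. True}"

lemma int_spanI: "x = (\<Sum>r\<in>S. of_int (c r) * r) \<Longrightarrow> x \<in> int_span S"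
  by (auto simp: int_span_def)

lemma int_span_add: "x \<in> int_span S \<Longrightarrow> y \<in> int_span S \<Longrightarrow> x + y \<in> int_span S"
proof -
  assume "x \<in> int_span S" "y \<in> int_span S"
  then obtain c d where "x = (\<Sum>r\<in>S. of_int (c r) * r)" "y = (\<Sum>r\<in>S. of_int (d r) * r)"
    by (auto simp: int_span_def)
  hence "x + y = (\<Sum>r\<in>S. of_int (c r + d r) * r)"
    by (simp add: sum.distrib ring_distribs)
  thus ?thesis by (rule int_spanI)
qed

lemma int_span_scale: "x \<in> int_span S \<Longrightarrow> of_int m * x \<in> int_span S"
proof -
  assume "x \<in> int_span S"
  then obtain c where "x = (\<Sum>r\<in>S. of_int (c r) * r)"
    by (auto simp: int_span_def)
  hence "of_int m * x = (\<Sum>r\<in>S. of_int (m * c r) * r)"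
    by (simp add: sum_distrib_left mult_ac)
  thus ?thesis by (rule int_spanI)
qed

lemma int_span_sum: 
  assumes "\<And>i. i \<in> I \<Longrightarrow> f i \<in> int_span S"
  shows "(\<Sum>i\<in>I. of_int (c i) * f i) \<in> int_span S"
proof -
  have "0 \<in> int_span S" unfolding int_span_def by (rule CollectI, rule exI[of _ "\<lambda>_. 0"]) simp
  thus ?thesis using assms
    by (induction I rule: infinite_finite_induct) (auto intro!: int_span_add int_span_scale)
qed

lemma int_span_base: "finite S \<Longrightarrow> x \<in> S \<Longrightarrow> x \<in> int_span S"
proof -
  assume "finite S" "x \<in> S"
  hence "x = (\<Sum>r\<in>S. if r = x then r else 0)" by simp
  also have "\<dots> = (\<Sum>r\<in>S. of_int (if r = x then 1 else 0) * r)"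
    by (rule sum.cong) auto
  finally show ?thesis by (rule int_spanI)
qed

lemma algebraic_int_power_reduce:
  fixes x :: complex
  assumes "algebraic_int x"
  obtains n c where "n > 0" "x ^ n = (\<Sum>i<n. of_int (c i :: int) * x ^ i)"
proof -
  obtain p where p: "lead_coeff p = 1" "poly (map_poly of_int p) x = 0"
    using assms unfolding algebraic_int_altdef_ipoly by auto
  have deg: "degree p > 0"
  proof (rule ccontr)
    assume "\<not> ?thesis"
    then have "degree p = 0" by simp
    then obtain c where "p = [:c:]" using degree_eq_zeroE by blast
    thus False using p by simp
  qed
  have "{..degree p} = insert (degree p) {..<degree p}" by auto
  hence "poly (map_poly of_int p) x = x ^ degree p + (\<Sum>i<degree p. of_int (Polynomial.coeff p i) * x ^ i)"
    using p(1) by (simp add: poly_altdef)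
  hence "x ^ degree p = - (\<Sum>i<degree p. of_int (Polynomial.coeff p i) * x ^ i)"
    using p(2) by (simp add: eq_neg_iff_add_eq_0)
  also have "\<dots> = (\<Sum>i<degree p. of_int (- Polynomial.coeff p i) * x ^ i)"
    by (simp add: sum_negf)
  finally have "x ^ degree p = (\<Sum>i<degree p. of_int (- Polynomial.coeff p i) * x ^ i)" .
  thus ?thesis by (rule that[OF deg])
qed

text \<open>Monic relations of degrees m and n for x and y make the integer span of the products x^i
  y^j with i < m, j < n stable under multiplication by x and by y, hence under x + y and x
  y.\<close>

lemma algebraic_int_add_times:
  fixes x y :: complex
  assumes "algebraic_int x" "algebraic_int y"
  shows "algebraic_int (x + y)" "algebraic_int (x * y)"
proof -
  obtain m c where m: "m > 0" "x ^ m = (\<Sum>i<m. of_int (c i :: int) * x ^ i)"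
    using assms(1) by (rule algebraic_int_power_reduce)
  obtain n d where n: "n > 0" "y ^ n = (\<Sum>i<n. of_int (d i :: int) * y ^ i)"
    using assms(2) by (rule algebraic_int_power_reduce)
  define S where "S = (\<lambda>(i,j). x ^ i * y ^ j) ` ({..<m} \<times> {..<n})"
  have fin: "finite S" by (simp add: S_def)
  have base: "x ^ i * y ^ j \<in> int_span S" if "i < m" "j < n" for i j
    by (rule int_span_base[OF fin]) (use that in \<open>force simp: S_def\<close>)
  have X: "x ^ Suc i * y ^ j \<in> int_span S" if "i < m" "j < n" for i j
  proof (cases "Suc i < m")
    case True thus ?thesis using base that by blast
  next
    case False
    hence "Suc i = m" using that by simp
    hence "x ^ Suc i * y ^ j = x ^ m * y ^ j" by simp
    also have "\<dots> = (\<Sum>i<m. of_int (c i) * (x ^ i * y ^ j))"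
      unfolding m(2) sum_distrib_right by (simp only: mult.assoc)
    also have "\<dots> \<in> int_span S" by (rule int_span_sum) (use base that in auto)
    finally show ?thesis .
  qed
  have Y: "x ^ i * y ^ Suc j \<in> int_span S" if "i < m" "j < n" for i j
  proof (cases "Suc j < n")
    case True thus ?thesis using base that by blast
  next
    case False
    hence "Suc j = n" using that by simp
    hence "x ^ i * y ^ Suc j = x ^ i * y ^ n" by simp
    also have "\<dots> = (\<Sum>j<n. of_int (d j) * (x ^ i * y ^ j))"
      unfolding n(2) sum_distrib_left by (simp only: mult.left_commute)
    also have "\<dots> \<in> int_span S" by (rule int_span_sum) (use base that in auto)
    finally show ?thesis .
  qed
  have x: "x * s \<in> int_span S" if s: "s \<in> S" for s
  proof -
    obtain i j where ij: "i < m" "j < n" "s = x ^ i * y ^ j" using s by (auto simp: S_def)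
    have "x * s = x ^ Suc i * y ^ j" by (simp add: ij)
    thus ?thesis using X[OF ij(1,2)] by (simp only:)
  qed
  have y: "y * s \<in> int_span S" if s: "s \<in> S" for s
  proof -
    obtain i j where ij: "i < m" "j < n" "s = x ^ i * y ^ j" using s by (auto simp: S_def)
    have "y * s = x ^ i * y ^ Suc j" by (simp add: ij)
    thus ?thesis using Y[OF ij(1,2)] by (simp only:)
  qed
  have one: "1 \<in> S" unfolding S_def by (rule image_eqI[of _ _ "(0,0)"]) (use m n in auto)
  have D: "algebraic_int a" if "\<And>s. s \<in> S \<Longrightarrow> a * s \<in> int_span S" for a
    by (rule algebraic_int_if_stable_span[OF fin one]) (simp, use that in \<open>auto simp: int_span_def\<close>)
  show "algebraic_int (x + y)"
    by (rule D) (simp add: distrib_right int_span_add x y)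
  have "x * (y * s) \<in> int_span S" if s: "s \<in> S" for s
  proof -
    obtain e where "y * s = (\<Sum>r\<in>S. of_int (e r) * r)"
      using y[OF s] by (auto simp: int_span_def)
    hence "x * (y * s) = (\<Sum>r\<in>S. of_int (e r) * (x * r))"
      by (simp only: sum_distrib_left mult.left_commute)
    also have "\<dots> \<in> int_span S" by (rule int_span_sum) (rule x)
    finally show ?thesis .
  qed
  thus "algebraic_int (x * y)"
    by (intro D) (simp add: mult.assoc)
qed

lemma algebraic_int_diff: "algebraic_int x \<Longrightarrow> algebraic_int y \<Longrightarrow> algebraic_int (x - y :: complex)"
  using algebraic_int_add_times(1)[of x "-y"] by simp

lemma algebraic_int_of_int [simp]: "algebraic_int (of_int n :: complex)"
  by (rule int_imp_algebraic_int) simp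

lemma algebraic_int_of_nat [simp]: "algebraic_int (of_nat n :: complex)"
  using algebraic_int_of_int[of "int n"] by simp

lemma algebraic_int_1 [simp]: "algebraic_int (1 :: complex)"
  using algebraic_int_of_nat[of 1] by simp

lemma algebraic_int_power: "algebraic_int x \<Longrightarrow> algebraic_int (x ^ n :: complex)"
  by (induction n) (simp_all add: algebraic_int_add_times(2))

lemma algebraic_int_sum:
  "(\<And>i. i \<in> I \<Longrightarrow> algebraic_int (f i :: complex)) \<Longrightarrow> algebraic_int (sum f I)"
  by (induction I rule: infinite_finite_induct) (simp_all add: algebraic_int_add_times(1))

section \<open>Residue sums, parity of divisor counts, Fermat's congruence\<close>

lemma sum_residues_mult:
  fixes f :: "int \<Rightarrow> 'a::comm_monoid_add"
  assumes k: "k > 0" and per: "\<And>n. f (n mod int k) = f n" and n: "coprime n (int k)"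
  shows "(\<Sum>j\<in>{0..<int k}. f (n * j)) = (\<Sum>j\<in>{0..<int k}. f j)"
proof -
  have inj: "inj_on (\<lambda>j. n * j mod int k) {0..<int k}"
  proof (rule inj_onI)
    fix i j assume ij: "i \<in> {0..<int k}" "j \<in> {0..<int k}" "n * i mod int k = n * j mod int k"
    hence "[i = j] (mod int k)" using cong_mult_lcancel[OF n, of i j] by (simp add: unique_euclidean_semiring_class.cong_def)
    thus "i = j" using ij by (intro cong_less_imp_eq_int[of i "int k" j]) auto
  qed
  moreover have "(\<lambda>j. n * j mod int k) ` {0..<int k} \<subseteq> {0..<int k}" using k by auto
  ultimately have "(\<lambda>j. n * j mod int k) ` {0..<int k} = {0..<int k}"
    by (intro endo_inj_surj) auto
  hence bij: "bij_betw (\<lambda>j. n * j mod int k) {0..<int k} {0..<int k}"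
    using inj by (simp add: bij_betw_def)
  have "(\<Sum>j\<in>{0..<int k}. f (n * j)) = (\<Sum>j\<in>{0..<int k}. f (n * j mod int k))"
    by (simp add: per)
  also have "\<dots> = (\<Sum>j\<in>{0..<int k}. f j)"
    by (rule sum.reindex_bij_betw[OF bij])
  finally show ?thesis .
qed

text \<open>For a prime p dividing m, multiplication by p pairs the divisors prime to p with those
  divisible by p.\<close>

lemma even_card_divisors_squarefree:
  fixes m :: nat
  assumes "squarefree m" "m > 1"
  shows "even (card {d. d dvd m})"
proof -
  obtain p where p: "prime p" "p dvd m" using assms(2) by (metis prime_factor_nat less_numeral_extra(4))
  have np: "\<not> p * p dvd m"
    using assms(1) p(1) by (metis not_prime_unit power2_eq_square squarefree_def)
  define A where "A = {d. d dvd m \<and> \<not> p dvd d}"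
  have m0: "m > 0" using assms by simp
  have fin: "finite {d. d dvd m}" using m0 by simp
  have inj: "inj_on (\<lambda>d. p * d) A" using p by (auto intro!: inj_onI dest: prime_gt_0_nat)
  have B: "{d. d dvd m \<and> p dvd d} = (\<lambda>d. p * d) ` A"
  proof (intro equalityI subsetI)
    fix d assume "d \<in> {d. d dvd m \<and> p dvd d}"
    then obtain e where e: "d = p * e" "p * e dvd m" by blast
    have "\<not> p dvd e" using e np by (meson dvd_trans mult_dvd_mono dvd_refl)
    moreover have "e dvd m" using e(2) by (rule dvd_mult_right)
    ultimately show "d \<in> (\<lambda>d. p * d) ` A" using e by (auto simp: A_def)
  next
    fix d assume "d \<in> (\<lambda>d. p * d) ` A"
    then obtain e where e: "d = p * e" "e dvd m" "\<not> p dvd e" by (auto simp: A_def)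
    have "coprime p e" using p(1) e(3) by (simp add: prime_imp_coprime)
    hence "p * e dvd m" using p(2) e(2) by (rule divides_mult[rotated 2])
    thus "d \<in> {d. d dvd m \<and> p dvd d}" using e by auto
  qed
  have "{d. d dvd m} = A \<union> {d. d dvd m \<and> p dvd d}" by (auto simp: A_def)
  also have "card \<dots> = card A + card {d. d dvd m \<and> p dvd d}"
    by (rule card_Un_disjoint) (use fin in \<open>auto simp: A_def intro: finite_subset[OF _ fin]\<close>)
  also have "\<dots> = 2 * card A" unfolding B by (simp add: card_image[OF inj])
  finally show ?thesis by simp
qed

lemma fermat_int:
  fixes c :: int
  assumes "prime p"
  shows "[c ^ p = c] (mod int p)"
proof -
  define a where "a = nat (c mod int p)"
  have p0: "p > 0" using assms prime_gt_0_nat by blast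
  have ca: "[c = int a] (mod int p)" using p0 by (simp add: a_def cong_def)
  have "[a ^ p = a] (mod p)"
  proof (cases "p dvd a")
    case True
    hence "p dvd a ^ p" using p0 by (meson dvd_power dvd_trans)
    thus ?thesis using True by (metis cong_0_iff cong_sym cong_trans)
  next
    case False
    hence "[a ^ (p - 1) = 1] (mod p)" using assms by (intro fermat_theorem) auto
    hence "[a * a ^ (p - 1) = a * 1] (mod p)" by (rule cong_scalar_left)
    thus ?thesis using p0 by (simp add: power_eq_if)
  qed
  hence "[int a ^ p = int a] (mod int p)" by (metis cong_int_iff of_nat_power)
  moreover have "[c ^ p = int a ^ p] (mod int p)" by (rule cong_pow[OF ca])
  ultimately show ?thesis using ca by (metis cong_sym cong_trans)
qed

section \<open>Congruences between algebraic integers and the Frobenius map\<close>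

text \<open>Congruence modulo \<open>p\<close> in the ring of all algebraic integers; junk for \<open>p = 0\<close>.\<close>

definition acong :: "nat \<Rightarrow> complex \<Rightarrow> complex \<Rightarrow> bool" where
  "acong p x y \<longleftrightarrow> algebraic_int ((x - y) / of_nat p)"

lemma acong_refl: "acong p x x"
  by (simp add: acong_def)

lemma acong_sym: "acong p x y \<Longrightarrow> acong p y x"
  using algebraic_int_minus[of "(x - y) / of_nat p"] unfolding acong_def
  by (simp only: minus_divide_left minus_diff_eq)

lemma acong_add: "acong p x y \<Longrightarrow> acong p u v \<Longrightarrow> acong p (x + u) (y + v)"
proof -
  assume "acong p x y" "acong p u v"
  hence "algebraic_int ((x - y) / of_nat p + (u - v) / of_nat p)"
    unfolding acong_def by (rule algebraic_int_add_times(1))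
  also have "(x - y) / of_nat p + (u - v) / of_nat p = (x + u - (y + v)) / of_nat p"
    by (simp add: add_divide_distrib diff_divide_distrib)
  finally show ?thesis unfolding acong_def .
qed

lemma acong_trans: "acong p x y \<Longrightarrow> acong p y z \<Longrightarrow> acong p x z"
  using acong_add[of p x y y z] unfolding acong_def by (simp add: algebra_simps)

lemma acong_mult_left: "acong p x y \<Longrightarrow> algebraic_int u \<Longrightarrow> acong p (u * x) (u * y)"
  unfolding acong_def using algebraic_int_add_times(2)[of u "(x - y) / of_nat p"]
  by (simp add: right_diff_distrib)

lemma acong_sum: "(\<And>i. i \<in> I \<Longrightarrow> acong p (f i) (g i)) \<Longrightarrow> acong p (sum f I) (sum g I)"
  by (induction I rule: infinite_finite_induct) (auto intro: acong_add acong_refl)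

text \<open>The way back from algebraic integers to ordinary congruences: a rational algebraic
  integer is an integer.\<close>

lemma acong_of_int: 
  assumes "p > 0"
  shows "acong p (of_int m) (of_int n) \<longleftrightarrow> [m = n] (mod int p)"
proof
  assume "[m = n] (mod int p)"
  then obtain q where "m - n = int p * q" by (auto simp: cong_iff_dvd_diff dvd_def)
  hence "(of_int m - of_int n :: complex) = of_nat p * of_int q"
    by (metis of_int_diff of_int_mult of_int_of_nat_eq)
  hence "(of_int m - of_int n :: complex) / of_nat p = of_int q" using assms by simp
  thus "acong p (of_int m) (of_int n)" by (simp add: acong_def)
next
  assume "acong p (of_int m) (of_int n)"
  hence "algebraic_int (of_int (m - n) / of_nat p :: complex)" by (simp add: acong_def)
  moreover have "(of_int (m - n) / of_nat p :: complex) \<in> \<rat>" by (intro Rats_divide) auto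
  ultimately have "(of_int (m - n) / of_nat p :: complex) \<in> \<int>" by (rule rational_algebraic_int_is_int)
  then obtain q where "(of_int (m - n) / of_nat p :: complex) = of_int q" by (auto elim: Ints_cases)
  hence "(of_int (m - n) :: complex) = of_int (int p * q)" using assms by (simp add: divide_eq_eq mult.commute)
  hence "m - n = int p * q" by (simp only: of_int_eq_iff)
  thus "[m = n] (mod int p)" by (simp add: cong_iff_dvd_diff)
qed

lemma acong_frobenius_add:
  assumes p: "prime p" and x: "algebraic_int x" and y: "algebraic_int y"
  shows "acong p ((x + y) ^ p) (x ^ p + y ^ p)"
proof -
  have p0: "p > 0" using p prime_gt_0_nat by blast
  define T where "T = (\<lambda>i. of_nat (p choose i) * x ^ i * y ^ (p - i))"
  have "{..p} = insert 0 (insert p {0<..<p})" using p0 by auto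
  hence "(\<Sum>i\<le>p. T i) = T 0 + (T p + (\<Sum>i\<in>{0<..<p}. T i))"
    using p0 by simp
  moreover have "T 0 = y ^ p" "T p = x ^ p" by (simp_all add: T_def)
  moreover have "(x + y) ^ p = (\<Sum>i\<le>p. T i)" unfolding T_def by (rule binomial_ring)
  ultimately have eq: "(x + y) ^ p - (x ^ p + y ^ p) = (\<Sum>i\<in>{0<..<p}. T i)"
    by simp
  have "algebraic_int (T i / of_nat p)" if "i \<in> {0<..<p}" for i
  proof -
    have "p dvd (p choose i)" using that p by (intro dvd_choose_prime) auto
    then obtain q where "(p choose i) = p * q" by blast
    hence "T i / of_nat p = of_nat q * (x ^ i * y ^ (p - i))" using p0 by (simp add: T_def)
    thus ?thesis using x y by (simp add: algebraic_int_add_times(2) algebraic_int_power)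
  qed
  thus ?thesis unfolding acong_def eq sum_divide_distrib by (intro algebraic_int_sum)
qed

lemma acong_frobenius_sum:
  assumes p: "prime p" and "\<And>i. i \<in> I \<Longrightarrow> algebraic_int (f i)"
  shows "acong p ((\<Sum>i\<in>I. f i) ^ p) (\<Sum>i\<in>I. f i ^ p)"
  using assms(2)
proof (induction I rule: infinite_finite_induct)
  case (insert i I)
  have fi: "algebraic_int (f i)" and fI: "\<And>j. j \<in> I \<Longrightarrow> algebraic_int (f j)"
    using insert.prems by blast+
  have "acong p ((f i + sum f I) ^ p) (f i ^ p + sum f I ^ p)"
    by (rule acong_frobenius_add[OF p fi algebraic_int_sum[OF fI]])
  moreover have "acong p (f i ^ p + sum f I ^ p) (f i ^ p + (\<Sum>i\<in>I. f i ^ p))"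
    by (rule acong_add[OF acong_refl insert.IH[OF fI]])
  ultimately have "acong p ((f i + sum f I) ^ p) (f i ^ p + (\<Sum>i\<in>I. f i ^ p))"
    by (rule acong_trans)
  thus ?case using insert.hyps by simp
qed (use p prime_gt_0_nat in \<open>simp_all add: acong_refl power_0_left\<close>)

text \<open>Additivity of the p-th power modulo p, with Fermat's congruence removing the exponent
  from the integer coefficients. Applied to combinations of roots of unity, it leaves a Gauss sum
  with all arguments multiplied by p.\<close>

lemma acong_frobenius_int_sum:
  assumes p: "prime p" and z: "\<And>i. i \<in> I \<Longrightarrow> algebraic_int (z i)"
  shows "acong p ((\<Sum>i\<in>I. of_int (c i) * z i) ^ p) (\<Sum>i\<in>I. of_int (c i) * z i ^ p)"
proof -
  have "acong p ((\<Sum>i\<in>I. of_int (c i) * z i) ^ p) (\<Sum>i\<in>I. (of_int (c i) * z i) ^ p)"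
    using z by (intro acong_frobenius_sum p algebraic_int_add_times(2)) auto
  moreover have "acong p (\<Sum>i\<in>I. (of_int (c i) * z i) ^ p) (\<Sum>i\<in>I. of_int (c i) * z i ^ p)"
  proof (rule acong_sum)
    fix i assume i: "i \<in> I"
    have "acong p (of_int (c i ^ p)) (of_int (c i))"
      using fermat_int[OF p] prime_gt_0_nat[OF p] by (simp only: acong_of_int)
    hence "acong p (z i ^ p * of_int (c i ^ p)) (z i ^ p * of_int (c i))"
      using z[OF i] by (intro acong_mult_left algebraic_int_power)
    thus "acong p ((of_int (c i) * z i) ^ p) (of_int (c i) * z i ^ p)"
      by (simp add: power_mult_distrib mult.commute)
  qed
  ultimately show ?thesis by (rule acong_trans)
qed

section \<open>Real primitive characters\<close>

locale odd_real_primitive_char =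
  fixes k :: nat and \<chi> :: "int \<Rightarrow> complex"
  assumes k7: "k \<ge> 7" and odd_k: "odd k" and dir: "dirichlet_char k \<chi>"
    and real: "real_char \<chi>" and prim: "primitive_char k \<chi>" and odd: "odd_char \<chi>"
begin

lemma k_pos [simp]: "k > 0" using k7 by simp

lemma k_nonzero [simp]: "k \<noteq> 0" using k7 by simp

lemma chi_mult: "\<chi> (m * n) = \<chi> m * \<chi> n"
  using dir unfolding dirichlet_char_def by blast

lemma chi_minus: "\<chi> (- n) = - \<chi> n"
  using odd unfolding odd_char_def by blast

lemma chi_add_mult: "\<chi> (n + int k * m) = \<chi> n"
proof -
  have per: "\<chi> (n + int k) = \<chi> n" for n
    using dir unfolding dirichlet_char_def by blast
  have nat: "\<chi> (n + int k * int i) = \<chi> n" for n i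
  proof (induction i)
    case (Suc i)
    have "n + int k * int (Suc i) = (n + int k * int i) + int k" by (simp add: algebra_simps)
    thus ?case using per Suc.IH by metis
  qed simp
  show ?thesis
  proof (cases "m \<ge> 0")
    case True
    thus ?thesis using nat[of n "nat m"] by simp
  next
    case False
    thus ?thesis using nat[of "n + int k * m" "nat (- m)"] by simp
  qed
qed

lemma chi_mod: "\<chi> (n mod int k) = \<chi> n"
  using chi_add_mult[of "n mod int k" "n div int k"] by (simp add: mult.commute)

lemma chi_cong: "[m = n] (mod int k) \<Longrightarrow> \<chi> m = \<chi> n"
  by (metis chi_mod unique_euclidean_semiring_class.cong_def)

lemma chi_1 [simp]: "\<chi> 1 = 1"
proof -
  obtain n where "\<chi> n \<noteq> 0" using dir unfolding dirichlet_char_def by blast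
  thus ?thesis using chi_mult[of n 1] by simp
qed

lemma chi_0 [simp]: "\<chi> 0 = 0"
  using chi_minus[of 0] by simp

lemma chi_eq_0: "\<not> coprime n (int k) \<Longrightarrow> \<chi> n = 0"
proof -
  assume "\<not> coprime n (int k)"
  hence "gcd n (int k) \<noteq> 1" by (simp add: coprime_iff_gcd_eq_1)
  moreover have "gcd n (int k) > 0" by simp
  ultimately have "gcd n (int k) > 1" by linarith
  thus ?thesis using dir unfolding dirichlet_char_def by blast
qed

lemma chi_power: "\<chi> (n ^ i) = \<chi> n ^ i"
  by (induction i) (simp_all add: chi_mult)

lemma chi_inverse:
  assumes "coprime n (int k)"
  obtains m where "[n * m = 1] (mod int k)" "\<chi> n * \<chi> m = 1"
proof -
  obtain m where m: "[n * m = 1] (mod int k)" using assms cong_solve_coprime_int by blast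
  have "\<chi> n * \<chi> m = 1" using chi_cong[OF m] by (simp add: chi_mult)
  with m show ?thesis using that by blast
qed

text \<open>Euler's theorem makes the value a root of unity, and a real one is a sign.\<close>

lemma chi_pm: "coprime n (int k) \<Longrightarrow> \<chi> n = 1 \<or> \<chi> n = -1"
proof -
  assume n: "coprime n (int k)"
  define a where "a = nat (n mod int k)"
  have a: "int a = n mod int k" by (simp add: a_def)
  have "coprime (n mod int k) (int k)" using n by (simp add: coprime_mod_left_iff)
  hence "coprime a k" using a by (metis coprime_int_iff)
  hence "[a ^ totient k = 1] (mod k)" by (rule euler_theorem)
  hence "[int a ^ totient k = 1] (mod int k)" by (metis cong_int_iff of_nat_1 of_nat_power)
  hence "\<chi> (int a) ^ totient k = 1" using chi_cong chi_power chi_1 by metis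
  hence 1: "\<chi> n ^ totient k = 1" unfolding a chi_mod .
  obtain r where r: "\<chi> n = of_real r"
    using real unfolding real_char_def by (metis Reals_cases)
  have "totient k > 0" by simp
  hence "norm (\<chi> n) = 1" using 1 by (metis norm_ge_zero norm_one norm_power power_eq_imp_eq_base power_one)
  hence "\<bar>r\<bar> = 1" by (simp add: r)
  thus ?thesis using r by (auto simp: abs_if split: if_splits)
qed

lemma chi_eq_0_iff: "\<chi> n = 0 \<longleftrightarrow> \<not> coprime n (int k)"
  using chi_eq_0 chi_pm by force

lemma chi_cases: "\<chi> n = 0 \<or> \<chi> n = 1 \<or> \<chi> n = -1"
  using chi_eq_0 chi_pm by blast

text \<open>For a prime with \<open>p\<^sup>2 dvd k\<close>, the map \<open>m \<mapsto> \<chi> (1 + m k / p)\<close> is a homomorphism from \<open>\<int> / p\<close>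
  to the signs, hence trivial because \<open>p\<close> is odd.\<close>

lemma chi_shift:
  assumes p: "prime p" "p * p dvd k" and n: "coprime n (int k)"
  shows "\<chi> (n + m * int (k div p)) = \<chi> n"
proof -
  define d where "d = int (k div p)"
  have pk: "p dvd k" using p by (meson dvd_mult_left)
  have kd: "int k = int p * d" using pk by (simp add: d_def flip: of_nat_mult)
  have "p dvd k div p" using p pk by (metis dvd_div_iff_mult prime_gt_0_nat less_numeral_extra(3))
  hence "int p dvd d" by (simp add: d_def)
  hence kd2: "int k dvd d * d" unfolding kd by (intro mult_dvd_mono) auto
  \<comment> \<open>Since k divides d^2, powers of 1 + l d are linear in the exponent modulo k; the
    exponent p then gives 1 because p d = k.\<close>
  have pow: "[(1 + l * d) ^ i = 1 + int i * l * d] (mod int k)" for l i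
  proof (induction i)
    case (Suc i)
    have "[(1 + l * d) * (1 + l * d) ^ i = (1 + l * d) * (1 + int i * l * d)] (mod int k)"
      using Suc.IH by (rule cong_scalar_left)
    moreover have "(1 + l * d) * (1 + int i * l * d) = 1 + int (Suc i) * l * d + int i * l * l * (d * d)"
      by (simp add: algebra_simps)
    moreover have "[1 + int (Suc i) * l * d + int i * l * l * (d * d) = 1 + int (Suc i) * l * d] (mod int k)"
      using kd2 by (simp add: cong_iff_dvd_diff)
    ultimately show ?case by (simp add: cong_trans)
  qed simp
  have one: "\<chi> (1 + l * d) = 1" for l
  proof -
    have "[1 + int p * l * d = 1] (mod int k)" by (simp add: cong_iff_dvd_diff kd mult.commute)
    hence "\<chi> (1 + l * d) ^ p = 1" using chi_cong[OF cong_trans[OF pow[of l p]]] by (simp add: chi_power)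
    moreover have "Parity.odd p" using pk odd_k by (meson dvd_trans)
    ultimately show ?thesis using chi_cases[of "1 + l * d"] prime_gt_0_nat[OF p(1)]
      by (elim disjE) (simp_all add: power_0_left)
  qed
  obtain n' where n': "[n * n' = 1] (mod int k)" using n chi_inverse by blast
  \<comment> \<open>A shift of a unit n is n times a shift of 1.\<close>
  have "[n * (1 + n' * m * d) = n + m * d] (mod int k)"
  proof -
    have "[n * n' * (m * d) = 1 * (m * d)] (mod int k)" by (rule cong_scalar_right[OF n'])
    hence "[n + n * n' * (m * d) = n + 1 * (m * d)] (mod int k)" by (rule cong_add[OF cong_refl])
    thus ?thesis by (simp add: algebra_simps)
  qed
  from chi_cong[OF this] show ?thesis using one[of "n' * m"] by (simp add: chi_mult d_def)
qed

text \<open>By \<open>chi_shift\<close>, \<open>\<chi>\<close> has period k/p on units. Shifting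
  back by -k/p shows that non-units also go to non-units, so \<open>\<chi>\<close> is itself a
  character modulo k/p, against primitivity.\<close>

lemma not_prime_square_dvd: "prime p \<Longrightarrow> \<not> p * p dvd k"
proof
  assume p: "prime p" "p * p dvd k"
  define d where "d = k div p"
  have per: "\<chi> (n + int d) = \<chi> n" for n
  proof (cases "coprime n (int k)")
    case True
    thus ?thesis using chi_shift[OF p True, of 1] by (simp add: d_def)
  next
    case False
    have "\<not> coprime (n + int d) (int k)"
    proof
      assume c: "coprime (n + int d) (int k)"
      hence "\<chi> n = \<chi> (n + int d)" using chi_shift[OF p c, of "-1"] by (simp add: d_def)
      thus False using False c chi_eq_0_iff by metis
    qed
    thus ?thesis using False chi_eq_0 by metis
  qed
  have pk: "p dvd k" using p by (meson dvd_mult_left)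
  have d: "d dvd k" "d < k" using pk prime_gt_1_nat[OF p(1)] by (auto simp: d_def)
  have "dirichlet_char d \<chi>" unfolding dirichlet_char_def
  proof (intro conjI allI impI)
    show "\<exists>n. \<chi> n \<noteq> 0" by (rule exI[of _ 1]) simp
    fix n assume "1 < gcd n (int d)"
    moreover have "gcd n (int d) dvd gcd n (int k)" using d by (intro gcd_mono) auto
    ultimately have "\<not> coprime n (int k)" by (metis coprime_iff_gcd_eq_1 is_unit_gcd_iff not_less_iff_gr_or_eq zdvd1_eq zero_less_one_class.zero_less_one abs_of_pos less_trans)
    thus "\<chi> n = 0" by (rule chi_eq_0)
  qed (simp_all add: chi_mult per)
  moreover have "induced_by k \<chi> \<chi>"
    unfolding induced_by_def principal_char_def using chi_eq_0 by simp
  ultimately show False using prim d unfolding primitive_char_def by blast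
qed

lemma squarefree_k: "squarefree k"
proof (rule squarefreeI)
  fix x :: nat assume x: "x\<^sup>2 dvd k"
  show "x dvd 1"
  proof (rule ccontr)
    assume "\<not> x dvd 1"
    then obtain p where "prime p" "p dvd x" by (metis nat_dvd_1_iff_1 prime_factor_nat)
    hence "p * p dvd k" using x by (metis dvd_trans mult_dvd_mono power2_eq_square)
    thus False using not_prime_square_dvd \<open>prime p\<close> by blast
  qed
qed

text \<open>Otherwise \<open>\<chi>\<close> is 1 on all units that are 1 modulo d. As k is
  squarefree, d and q = k/d are coprime, and the Chinese remainder theorem turns
  \<open>\<chi>\<close> into a character modulo d that induces it.\<close>

lemma primitive_witness:
  assumes d: "d dvd k" "d < k"
  obtains n where "[n = 1] (mod int d)" "\<chi> n = -1"
proof (rule ccontr)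
  assume "\<not> thesis"
  hence triv: "\<chi> n = 1" if "[n = 1] (mod int d)" "coprime n (int k)" for n
    using chi_pm that \<open>\<And>n. [n = 1] (mod int d) \<Longrightarrow> \<chi> n = -1 \<Longrightarrow> thesis\<close> by blast
  obtain q where q: "k = d * q" using d by blast
  have "coprime d q"
  proof (rule ccontr)
    assume "\<not> coprime d q"
    then obtain p where "prime p" "p dvd d" "p dvd q"
      by (metis coprime_iff_gcd_eq_1 gcd_dvd1 gcd_dvd2 dvd_trans prime_factor_nat)
    hence "p * p dvd k" unfolding q by (intro mult_dvd_mono)
    thus False using not_prime_square_dvd \<open>prime p\<close> by blast
  qed
  hence "coprime (int d) (int q)" by simp
  then obtain x y where xy: "x * int d + y * int q = 1" by (metis bezout_int coprime_iff_gcd_eq_1)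
  \<comment> \<open>Complementary idempotents modulo k: u is 1 modulo d and 0 modulo q, and v the
    reverse. Thus u n + v is n modulo d and 1 modulo q, and \<open>\<psi>\<close> evaluates
    \<open>\<chi>\<close> at this lift; it is multiplicative because u v vanishes modulo k.\<close>
  define u v where "u = y * int q" and "v = x * int d"
  have uv: "u + v = 1" using xy by (simp add: u_def v_def)
  have uvk: "int k dvd u * v" by (simp add: u_def v_def q)
  define \<psi> where "\<psi> = (\<lambda>n. \<chi> (u * n + v))"
  have idem: "u * u = u - u * v" "v * v = v - u * v"
    using uv by (simp_all add: algebra_simps flip: distrib_left distrib_right)
  have "dirichlet_char d \<psi>" unfolding dirichlet_char_def
  proof (intro conjI allI impI)
    show "\<exists>n. \<psi> n \<noteq> 0" by (rule exI[of _ 1]) (simp add: \<psi>_def uv)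
    fix n m :: int
    have "(u * m + v) * (u * n + v) - (u * (m * n) + v) = (u * v) * (m + n - m * n - 1)"
    proof -
      have "(u * m + v) * (u * n + v) = (u * u) * (m * n) + u * v * (m + n) + v * v"
        by (simp add: algebra_simps)
      thus ?thesis unfolding idem by (simp add: algebra_simps)
    qed
    hence "[(u * m + v) * (u * n + v) = u * (m * n) + v] (mod int k)"
      using uvk by (simp add: cong_iff_dvd_diff)
    thus "\<psi> (m * n) = \<psi> m * \<psi> n"
      unfolding \<psi>_def using chi_cong chi_mult by metis
    have "u * (n + int d) + v = u * n + v + int k * y" by (simp add: u_def q algebra_simps)
    thus "\<psi> (n + int d) = \<psi> n" unfolding \<psi>_def using chi_add_mult by metis
  next
    fix n assume "1 < gcd n (int d)"
    hence "\<not> coprime n (int d)" by (simp add: coprime_iff_gcd_eq_1)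
    moreover have "[u * n + v = n] (mod int d)"
    proof -
      have "u * n + v - n = v * (1 - n)" using uv by (simp add: algebra_simps flip: distrib_left distrib_right)
      thus ?thesis by (simp add: cong_iff_dvd_diff v_def)
    qed
    ultimately have "\<not> coprime (u * n + v) (int d)" using cong_imp_coprime cong_sym by blast
    hence "\<not> coprime (u * n + v) (int k)" using q by simp
    thus "\<psi> n = 0" unfolding \<psi>_def by (rule chi_eq_0)
  qed
  moreover have "induced_by k \<chi> \<psi>" unfolding induced_by_def principal_char_def
  proof (intro allI)
    fix n show "\<chi> n = (if coprime n (int k) then 1 else 0) * \<psi> n"
    proof (cases "coprime n (int k)")
      case True
      \<comment> \<open>Multiplied by the inverse m of n, the lift of n becomes a unit that is 1
        modulo d, where \<open>\<chi>\<close> is trivial by assumption.\<close>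
      obtain m where m: "[n * m = 1] (mod int k)" "\<chi> n * \<chi> m = 1" using chi_inverse[OF True] by blast
      have "u * n + v - n = v * (1 - n)" using uv by (simp add: algebra_simps flip: distrib_left distrib_right)
      hence "[u * n + v = n] (mod int d)" by (simp add: cong_iff_dvd_diff v_def)
      hence "[(u * n + v) * m = n * m] (mod int d)" by (rule cong_scalar_right)
      moreover have "[n * m = 1] (mod int d)" using m(1) d(1) by (meson cong_dvd_modulus int_dvd_int_iff)
      ultimately have 1: "[(u * n + v) * m = 1] (mod int d)" by (rule cong_trans)
      have "u * n + v - 1 = u * (n - 1)" using uv by (simp add: algebra_simps flip: distrib_left distrib_right)
      hence "[u * n + v = 1] (mod int q)" by (simp add: cong_iff_dvd_diff u_def)
      hence cq: "coprime (u * n + v) (int q)" using cong_imp_coprime[OF cong_sym] by (metis coprime_1_left)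
      have "coprime n (int d)" using True q by simp
      hence "coprime (u * n + v) (int d)" using \<open>[u * n + v = n] (mod int d)\<close> cong_imp_coprime cong_sym by blast
      hence "coprime (u * n + v) (int k)" using cq q by simp
      moreover have "coprime m (int k)" using m(2) chi_eq_0 by force
      ultimately have "coprime ((u * n + v) * m) (int k)" by simp
      from triv[OF 1 this] have "\<psi> n * \<chi> m = 1" by (simp add: \<psi>_def chi_mult)
      moreover have "\<chi> m \<noteq> 0" using m(2) by auto
      ultimately have "\<psi> n = \<chi> n" using m(2) by (metis mult_cancel_right)
      thus ?thesis using True by simp
    qed (simp add: chi_eq_0)
  qed
  ultimately show False using prim d unfolding primitive_char_def by blast
qed

end

section \<open>Gauss sums\<close>

lemma sum_residues_shift:
  fixes f :: "int \<Rightarrow> 'a::comm_monoid_add"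
  assumes k: "k > 0" and per: "\<And>n. f (n mod int k) = f n"
  shows "(\<Sum>j\<in>{0..<int k}. f (j + c)) = (\<Sum>j\<in>{0..<int k}. f j)"
proof -
  have inj: "inj_on (\<lambda>j. (j + c) mod int k) {0..<int k}"
  proof (rule inj_onI)
    fix i j assume ij: "i \<in> {0..<int k}" "j \<in> {0..<int k}" "(i + c) mod int k = (j + c) mod int k"
    hence "[i = j] (mod int k)"
      using cong_add_rcancel[of i c j "int k"] by (simp add: unique_euclidean_semiring_class.cong_def)
    thus "i = j" using ij by (intro cong_less_imp_eq_int[of i "int k" j]) auto
  qed
  moreover have "(\<lambda>j. (j + c) mod int k) ` {0..<int k} \<subseteq> {0..<int k}" using k by auto
  ultimately have "(\<lambda>j. (j + c) mod int k) ` {0..<int k} = {0..<int k}"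
    by (intro endo_inj_surj) auto
  hence bij: "bij_betw (\<lambda>j. (j + c) mod int k) {0..<int k} {0..<int k}"
    using inj by (simp add: bij_betw_def)
  have "(\<Sum>j\<in>{0..<int k}. f (j + c)) = (\<Sum>j\<in>{0..<int k}. f ((j + c) mod int k))"
    by (simp add: per)
  also have "\<dots> = (\<Sum>j\<in>{0..<int k}. f j)"
    by (rule sum.reindex_bij_betw[OF bij])
  finally show ?thesis .
qed

context odd_real_primitive_char
begin

definition e :: "int \<Rightarrow> complex" where
  "e j = cis (2 * pi * of_int j / real k)"

lemma e_add: "e (i + j) = e i * e j"
  by (simp add: e_def cis_mult ring_distribs add_divide_distrib)

lemma e_0 [simp]: "e 0 = 1" by (simp add: e_def)

lemma e_power: "e j ^ n = e (int n * j)"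
  by (induction n) (simp_all add: e_add ring_distribs)

lemma e_eq_1_iff: "e j = 1 \<longleftrightarrow> int k dvd j"
proof
  assume "e j = 1"
  hence "cos (2 * pi * of_int j / real k) = 1" by (simp add: e_def complex_eq_iff)
  then obtain n :: int where "2 * pi * of_int j / real k = of_int n * 2 * pi"
    by (auto simp: cos_one_2pi_int)
  hence "(of_int j :: real) = of_int (int k * n)" by (simp add: field_simps)
  hence "j = int k * n" by (simp only: of_int_eq_iff)
  thus "int k dvd j" by simp
next
  assume "int k dvd j"
  then obtain n where "j = int k * n" by blast
  hence "2 * pi * of_int j / real k = 2 * pi * of_int n" by simp
  hence "e j = cis (2 * pi * of_int n)" unfolding e_def by (simp only:)
  also have "\<dots> = 1" by (rule cis_multiple_2pi) simp
  finally show "e j = 1" .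
qed

lemma e_mod: "e (j mod int k) = e j"
proof -
  have "e j = e (j mod int k + int k * (j div int k))" by simp
  also have "\<dots> = e (j mod int k)" unfolding e_add using e_eq_1_iff[of "int k * (j div int k)"] by simp
  finally show ?thesis by simp
qed

lemma e_mult_mod: "e (a * (j mod int k)) = e (a * j)"
  by (metis e_mod mod_mult_right_eq)

lemma algebraic_int_e: "algebraic_int (e j)"
proof (rule algebraic_int_root)
  show "poly (Polynomial.monom 1 k) (e j) = 1"
    using e_eq_1_iff[of "int k * j"] by (simp add: poly_monom e_power)
  show "algebraic_int (1 :: complex)" by (rule algebraic_int_1)
qed (auto simp: degree_monom_eq k_pos lead_coeff_monom)

lemma sum_e: "(\<Sum>j\<in>{0..<int k}. e (m * j)) = (if int k dvd m then of_nat k else 0)"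
proof (cases "int k dvd m")
  case True
  hence "e (m * j) = 1" for j by (simp add: e_eq_1_iff)
  thus ?thesis using True by simp
next
  case False
  have "(\<Sum>j\<in>{0..<int k}. e (m * j)) = (\<Sum>j\<in>{0..<int k}. e (m * (j + 1)))"
    by (rule sum_residues_shift[symmetric]) (simp_all add: e_mult_mod)
  also have "\<dots> = e m * (\<Sum>j\<in>{0..<int k}. e (m * j))"
    by (simp add: distrib_left e_add sum_distrib_left mult.commute)
  finally have "(1 - e m) * (\<Sum>j\<in>{0..<int k}. e (m * j)) = 0" by (simp add: algebra_simps)
  thus ?thesis using False by (simp add: e_eq_1_iff)
qed

definition G :: complex where "G = (\<Sum>j\<in>{0..<int k}. \<chi> j * e j)"

text \<open>For a unit a, substitute a j for j. Otherwise let g = gcd a k and take n from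
  \<open>primitive_witness\<close> for k/g: replacing j by n j leaves e (a j) unchanged and flips
  the sign of \<open>\<chi>\<close>, so the sum is its own negative.\<close>

lemma gauss_sum_separable: "(\<Sum>j\<in>{0..<int k}. \<chi> j * e (a * j)) = \<chi> a * G"
proof (cases "coprime a (int k)")
  case True
  have "\<chi> a * (\<Sum>j\<in>{0..<int k}. \<chi> j * e (a * j)) = (\<Sum>j\<in>{0..<int k}. \<chi> (a * j) * e (a * j))"
    by (simp add: chi_mult sum_distrib_left mult.assoc)
  also have "\<dots> = G" unfolding G_def
    by (rule sum_residues_mult[OF k_pos _ True]) (simp add: chi_mod e_mod)
  finally have "\<chi> a * \<chi> a * (\<Sum>j\<in>{0..<int k}. \<chi> j * e (a * j)) = \<chi> a * G" by (simp add: mult.assoc)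
  moreover have "\<chi> a * \<chi> a = 1" using chi_pm[OF True] by auto
  ultimately show ?thesis by simp
next
  case False
  define g where "g = nat (gcd a (int k))"
  have g: "int g = gcd a (int k)" by (simp add: g_def)
  have gk: "g dvd k" by (metis g gcd_dvd2 int_dvd_int_iff)
  have "g \<noteq> 1" using False g by (metis coprime_iff_gcd_eq_1 of_nat_1)
  moreover have "g \<noteq> 0" using gk k_pos by (metis dvd_0_left_iff less_numeral_extra(3))
  ultimately have "k div g < k" by (intro div_less_dividend) auto
  moreover have "k div g dvd k" using gk by (metis dvd_div_mult_self dvd_triv_left)
  ultimately obtain n where n: "[n = 1] (mod int (k div g))" "\<chi> n = -1"
    using primitive_witness by blast
  have cop: "coprime n (int k)" using n(2) chi_eq_0 by force
  have "int g * int (k div g) dvd a * (n - 1)"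
    using n(1) g by (intro mult_dvd_mono) (simp_all add: cong_iff_dvd_diff)
  hence "int k dvd a * (n - 1)" using gk by (simp flip: of_nat_mult)
  hence dv: "int k dvd a * (n - 1) * j" for j by simp
  have en: "e (a * (n * j)) = e (a * j)" for j
  proof -
    have "a * (n * j) = a * j + a * (n - 1) * j" by (simp add: algebra_simps)
    thus ?thesis using dv[of j] e_eq_1_iff by (simp add: e_add)
  qed
  have "(\<Sum>j\<in>{0..<int k}. \<chi> j * e (a * j)) = (\<Sum>j\<in>{0..<int k}. \<chi> (n * j) * e (a * (n * j)))"
    by (rule sum_residues_mult[OF k_pos _ cop, symmetric]) (simp add: chi_mod e_mult_mod)
  also have "\<dots> = - (\<Sum>j\<in>{0..<int k}. \<chi> j * e (a * j))"
    by (simp add: en chi_mult n(2) sum_negf)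
  finally have "(\<Sum>j\<in>{0..<int k}. \<chi> j * e (a * j)) = 0" by simp
  thus ?thesis using chi_eq_0[OF False] by simp
qed

text \<open>Separability absorbs \<open>\<chi> j\<close> into the other factor. Orthogonality in j
  then keeps only i = k - 1, where oddness gives the value -1.\<close>

lemma G_squared: "G\<^sup>2 = - of_nat k"
proof -
  have "G\<^sup>2 = (\<Sum>j\<in>{0..<int k}. \<chi> j * G * e j)"
    by (subst (2) G_def) (simp add: power2_eq_square sum_distrib_left mult_ac G_def)
  also have "\<dots> = (\<Sum>j\<in>{0..<int k}. \<Sum>i\<in>{0..<int k}. \<chi> i * e ((i + 1) * j))"
    unfolding gauss_sum_separable[symmetric]
    by (simp add: sum_distrib_right e_add ring_distribs mult.assoc mult.commute[of _ "_::int"])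
  also have "\<dots> = (\<Sum>i\<in>{0..<int k}. \<chi> i * (\<Sum>j\<in>{0..<int k}. e ((i + 1) * j)))"
    by (subst sum.swap) (simp add: sum_distrib_left)
  also have "\<dots> = (\<Sum>i\<in>{0..<int k}. if i = int k - 1 then - of_nat k else 0)"
  proof (rule sum.cong)
    fix i assume i: "i \<in> {0..<int k}"
    have "int k dvd i + 1 \<longleftrightarrow> i = int k - 1"
      using i zdvd_imp_le[of "int k" "i + 1"] by auto
    moreover have "\<chi> (int k - 1) = -1"
      using chi_add_mult[of "-1" 1] chi_minus[of 1] by simp
    ultimately show "\<chi> i * (\<Sum>j\<in>{0..<int k}. e ((i + 1) * j)) = (if i = int k - 1 then - of_nat k else 0)"
      by (auto simp: sum_e)
  qed simp
  also have "\<dots> = - of_nat k" using k_pos by (simp add: sum.delta)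
  finally show ?thesis .
qed

definition \<epsilon> :: real where "\<epsilon> = Im G / sqrt (real k)"

lemma G_eq: "G = of_real (\<epsilon> * sqrt (real k)) * \<i>" and epsilon_cases: "\<epsilon> = 1 \<or> \<epsilon> = -1"
proof -
  have "(G / (\<i> * of_real (sqrt (real k))))\<^sup>2 = 1"
    using G_squared by (simp add: power_divide power_mult_distrib flip: of_real_power)
  hence "G / (\<i> * of_real (sqrt (real k))) = 1 \<or> G / (\<i> * of_real (sqrt (real k))) = -1"
    by (simp add: power2_eq_1_iff)
  hence "G = \<i> * of_real (sqrt (real k)) \<or> G = - \<i> * of_real (sqrt (real k))"
    by (auto simp: field_simps)
  thus "G = of_real (\<epsilon> * sqrt (real k)) * \<i>" "\<epsilon> = 1 \<or> \<epsilon> = -1"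
    by (auto simp: \<epsilon>_def)
qed

lemma G_nonzero: "G \<noteq> 0" using G_squared by auto

definition chi_int :: "int \<Rightarrow> int" where
  "chi_int n = (if \<chi> n = 1 then 1 else if \<chi> n = -1 then -1 else 0)"

lemma chi_int: "\<chi> n = of_int (chi_int n)"
  using chi_cases[of n] by (auto simp: chi_int_def)

definition common_divisors :: "int \<Rightarrow> nat" where
  "common_divisors j = card {d. d dvd k \<and> int d dvd j}"

text \<open>Since \<open>k\<close> is squarefree, the number of divisors of \<open>gcd j k\<close> has the parity of \<open>\<chi> j\<close>, while its
  Fourier transform is trivial at units. This writes \<open>(1 + G) / 2\<close> as an integral combination of
  roots of unity, which makes the Frobenius argument work at \<open>p = 2\<close> as well.\<close>

lemma even_chi_int_plus_common_divisors: "even (chi_int j + int (common_divisors j))"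
proof -
  define m where "m = nat (gcd j (int k))"
  have m: "int m = gcd j (int k)" by (simp add: m_def)
  have mk: "m dvd k" by (metis m gcd_dvd2 int_dvd_int_iff)
  have sqf: "squarefree m" using squarefree_k mk by (rule squarefree_mono[rotated])
  have "{d. d dvd k \<and> int d dvd j} = {d. d dvd m}"
  proof (intro Collect_cong)
    fix d show "(d dvd k \<and> int d dvd j) = (d dvd m)"
      by (metis gcd_greatest_iff int_dvd_int_iff m)
  qed
  hence c: "common_divisors j = card {d. d dvd m}" by (simp add: common_divisors_def)
  show ?thesis
  proof (cases "m = 1")
    case True
    hence "coprime j (int k)" using m by (simp add: coprime_iff_gcd_eq_1)
    hence "odd (chi_int j)" using chi_pm by (auto simp: chi_int_def)
    thus ?thesis using c True by simp
  next
    case False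
    have "m \<noteq> 0" using mk k_pos by (metis dvd_0_left_iff less_numeral_extra(3))
    hence "even (card {d. d dvd m})" using even_card_divisors_squarefree[OF sqf] False by simp
    moreover have "\<not> coprime j (int k)" using False m by (metis coprime_iff_gcd_eq_1 of_nat_1_eq_iff)
    ultimately show ?thesis using c chi_eq_0 by (simp add: chi_int_def)
  qed
qed

text \<open>After exchanging the sums, d contributes the sum of e (a j) over the multiples j of d. A
  shift by d multiplies it by e (a d), which differs from 1 unless d = k, and for d = k only j = 0
  is left.\<close>

lemma sum_common_divisors:
  assumes a: "coprime a (int k)"
  shows "(\<Sum>j\<in>{0..<int k}. of_nat (common_divisors j) * e (a * j)) = 1"
proof -
  have fin: "finite {d. d dvd k}" by simp
  have "(\<Sum>j\<in>{0..<int k}. of_nat (common_divisors j) * e (a * j)) =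
     (\<Sum>j\<in>{0..<int k}. \<Sum>d\<in>{d. d dvd k}. (if int d dvd j then e (a * j) else 0))"
  proof (rule sum.cong)
    fix j
    have "{d \<in> {d. d dvd k}. int d dvd j} = {d. d dvd k \<and> int d dvd j}" by auto
    thus "of_nat (common_divisors j) * e (a * j) = (\<Sum>d\<in>{d. d dvd k}. (if int d dvd j then e (a * j) else 0))"
      using fin by (simp add: sum.If_cases common_divisors_def Int_def)
  qed simp
  also have "\<dots> = (\<Sum>d\<in>{d. d dvd k}. \<Sum>j\<in>{0..<int k}. (if int d dvd j then e (a * j) else 0))"
    by (rule sum.swap)
  also have "\<dots> = (\<Sum>d\<in>{d. d dvd k}. if d = k then 1 else 0)"
  proof (rule sum.cong)
    fix d assume "d \<in> {d. d dvd k}"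
    hence d: "d dvd k" by simp
    define f where "f = (\<lambda>j. if int d dvd j then e (a * j) else 0)"
    show "(\<Sum>j\<in>{0..<int k}. (if int d dvd j then e (a * j) else 0)) = (if d = k then 1 else 0)"
    proof (cases "d = k")
      case True
      have "(\<Sum>j\<in>{0..<int k}. f j) = (\<Sum>j\<in>{0..<int k}. if j = 0 then 1 else 0)"
        by (rule sum.cong) (use zdvd_imp_le[of "int k"] in \<open>force simp: f_def True\<close>)+
      also have "\<dots> = 1" by simp
      finally show ?thesis using True by (simp add: f_def)
    next
      case False
      have per: "f (n mod int k) = f n" for n
      proof -
        have "int d dvd n mod int k \<longleftrightarrow> int d dvd n" using d by (simp add: dvd_mod_iff)
        thus ?thesis by (simp add: f_def e_mult_mod)
      qed
      have "(\<Sum>j\<in>{0..<int k}. f j) = (\<Sum>j\<in>{0..<int k}. f (j + int d))"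
        by (rule sum_residues_shift[symmetric]) (simp_all add: per)
      also have "\<dots> = e (a * int d) * (\<Sum>j\<in>{0..<int k}. f j)"
        unfolding sum_distrib_left by (rule sum.cong) (simp_all add: f_def distrib_left e_add)
      finally have "(1 - e (a * int d)) * (\<Sum>j\<in>{0..<int k}. f j) = 0" by (simp add: algebra_simps)
      moreover have "\<not> int k dvd a * int d"
      proof
        assume "int k dvd a * int d"
        hence "int k dvd int d" using a by (simp add: coprime_dvd_mult_right_iff coprime_commute)
        thus False using d False by (simp add: dvd_antisym)
      qed
      ultimately have "(\<Sum>j\<in>{0..<int k}. f j) = 0" by (simp add: e_eq_1_iff)
      thus ?thesis using False by (simp add: f_def)
    qed
  qed simp
  also have "\<dots> = 1" using fin by (simp add: sum.delta)
  finally show ?thesis .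
qed

text \<open>The two roots of X^2 - X + (k + 1)/4. Until the sign \<open>\<epsilon>\<close> is known
  it is open which of them lies in the upper half plane; the generator \<open>w\<close> of the ring
  of integers is introduced separately for this reason.\<close>

definition \<omega> :: complex where "\<omega> = (1 + G) / 2"
definition \<omega>' :: complex where "\<omega>' = (1 - G) / 2"

lemma omega_expansion:
  defines "c \<equiv> \<lambda>j. (chi_int j + int (common_divisors j)) div 2"
  assumes a: "coprime a (int k)"
  shows "(\<Sum>j\<in>{0..<int k}. of_int (c j) * e (a * j)) = (1 + \<chi> a * G) / 2"
proof -
  have c: "2 * of_int (c j) = \<chi> j + of_nat (common_divisors j)" for j
  proof -
    have "2 * c j = chi_int j + int (common_divisors j)"
      using even_chi_int_plus_common_divisors[of j] by (simp add: c_def)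
    hence "of_int (2 * c j) = (of_int (chi_int j + int (common_divisors j)) :: complex)" by simp
    thus ?thesis by (simp add: chi_int)
  qed
  have "2 * (\<Sum>j\<in>{0..<int k}. of_int (c j) * e (a * j)) =
     (\<Sum>j\<in>{0..<int k}. (2 * of_int (c j)) * e (a * j))"
    by (simp add: sum_distrib_left mult.assoc)
  also have "\<dots> = (\<Sum>j\<in>{0..<int k}. \<chi> j * e (a * j)) + (\<Sum>j\<in>{0..<int k}. of_nat (common_divisors j) * e (a * j))"
    by (simp only: c distrib_right sum.distrib)
  also have "\<dots> = \<chi> a * G + 1" by (simp only: gauss_sum_separable sum_common_divisors[OF a])
  finally have "2 * (\<Sum>j\<in>{0..<int k}. of_int (c j) * e (a * j)) / 2 = (\<chi> a * G + 1) / 2"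
    by (rule arg_cong)
  moreover have "2 * x / 2 = x" for x :: complex by simp
  ultimately show ?thesis by (simp only: add.commute)
qed

lemma algebraic_int_omega: "algebraic_int \<omega>"
proof -
  have "\<omega> = (\<Sum>j\<in>{0..<int k}. of_int ((chi_int j + int (common_divisors j)) div 2) * e (1 * j))"
    by (subst omega_expansion) (simp_all add: \<omega>_def)
  thus ?thesis by (simp only:) (intro algebraic_int_sum algebraic_int_add_times(2) algebraic_int_of_int algebraic_int_e)
qed

lemma omega'_eq: "\<omega>' = 1 - \<omega>" by (simp add: \<omega>_def \<omega>'_def field_simps)

lemma algebraic_int_omega': "algebraic_int \<omega>'"
  unfolding omega'_eq by (intro algebraic_int_diff algebraic_int_omega algebraic_int_1)

lemma omega_mult: "\<omega> * \<omega>' = of_nat (k + 1) / 4"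
  using G_squared by (simp add: \<omega>_def \<omega>'_def power2_eq_square algebra_simps)

text \<open>The product of \<open>\<omega>\<close> and \<open>\<omega>'\<close> is (k + 1)/4, a
  rational algebraic integer. With squarefreeness this makes -k a fundamental discriminant.\<close>

lemma four_dvd: "4 dvd k + 1"
proof -
  have "algebraic_int (of_nat (k + 1) / 4 :: complex)"
    using algebraic_int_add_times(2)[OF algebraic_int_omega algebraic_int_omega'] omega_mult by simp
  moreover have "of_nat (k + 1) / 4 \<in> (\<rat> :: complex set)" by (intro Rats_divide) auto
  ultimately have "of_nat (k + 1) / 4 \<in> (\<int> :: complex set)" by (intro rational_algebraic_int_is_int)
  then obtain z where "of_nat (k + 1) / 4 = (of_int z :: complex)" by (auto elim: Ints_cases)
  hence "(of_int (int (k + 1)) :: complex) = of_int (4 * z)" by (simp add: field_simps)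
  hence "int (k + 1) = 4 * z" by (simp only: of_int_eq_iff)
  thus ?thesis by presburger
qed

definition K :: int where "K = (int k + 1) div 4"

lemma K: "4 * K = int k + 1" using four_dvd unfolding K_def by presburger

lemma omega_mult_K: "\<omega> * \<omega>' = of_int K"
proof -
  have "(of_int (4 * K) :: complex) = of_nat (k + 1)" unfolding K by simp
  hence "(of_int K :: complex) = of_nat (k + 1) / 4" by (simp only: of_int_mult of_int_numeral) (metis nonzero_mult_div_cancel_left zero_neq_numeral)
  thus ?thesis unfolding omega_mult by simp
qed

text \<open>Raising to the p-th power moves e j to e (p j) and therefore G to
  \<open>\<chi> p\<close> times G: Frobenius fixes \<open>\<omega>\<close> or exchanges it with
  \<open>\<omega>'\<close> according to the sign.\<close>

lemma omega_frobenius: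
  assumes p: "prime p" "\<not> p dvd k"
  shows "acong p (\<omega> ^ p) (if \<chi> (int p) = 1 then \<omega> else \<omega>')"
proof -
  have cop: "coprime (int p) (int k)" using p by (simp add: prime_imp_coprime)
  define c where "c = (\<lambda>j. (chi_int j + int (common_divisors j)) div 2)"
  have 1: "\<omega> = (\<Sum>j\<in>{0..<int k}. of_int (c j) * e j)"
    using omega_expansion[of 1] by (simp add: \<omega>_def c_def)
  have 2: "(\<Sum>j\<in>{0..<int k}. of_int (c j) * e j ^ p) = (1 + \<chi> (int p) * G) / 2"
    using omega_expansion[OF cop] by (simp add: e_power c_def)
  have "acong p (\<omega> ^ p) (\<Sum>j\<in>{0..<int k}. of_int (c j) * e j ^ p)"
    unfolding 1 by (rule acong_frobenius_int_sum[OF p(1) algebraic_int_e])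
  also have "(\<Sum>j\<in>{0..<int k}. of_int (c j) * e j ^ p) = (if \<chi> (int p) = 1 then \<omega> else \<omega>')"
    unfolding 2 using chi_pm[OF cop] by (auto simp: \<omega>_def \<omega>'_def)
  finally show ?thesis .
qed

end

section \<open>Splitting of primes\<close>

context odd_real_primitive_char
begin

lemma cnj_G: "cnj G = - G"
  by (subst (1 2) G_eq) simp

lemma cnj_omega': "cnj \<omega>' = \<omega>"
  by (simp add: \<omega>_def \<omega>'_def cnj_G)

lemma omega_factor: "(\<omega> - of_int i) * (\<omega>' - of_int i) = of_int (i * i - i + K)"
proof -
  have "(\<omega> - of_int i) * (\<omega>' - of_int i) = \<omega> * \<omega>' - of_int i * (\<omega> + \<omega>') + of_int (i * i)"
    by (simp add: algebra_simps)
  also have "\<omega> + \<omega>' = 1" by (simp add: omega'_eq)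
  finally show ?thesis unfolding omega_mult_K by simp
qed

lemma algebraic_int_omega_diff:
  "algebraic_int (\<omega> - of_int i)" "algebraic_int (\<omega>' - of_int i)"
  by (intro algebraic_int_diff algebraic_int_omega algebraic_int_omega' algebraic_int_of_int)+

text \<open>If \<open>\<chi> p = -1\<close>, Frobenius swaps \<open>\<omega>\<close> and its conjugate modulo \<open>p\<close>. At a root \<open>r\<close> the product of
  \<open>\<omega> - r\<close> and \<open>\<omega>' - r\<close> vanishes modulo \<open>p\<close>, hence so do both squares and \<open>(\<omega> - \<omega>')\<^sup>2 = -k\<close>.\<close>

lemma root_imp_chi_1:
  assumes p: "prime p" "\<not> p dvd k" and r: "int p dvd r * r - r + K"
  shows "\<chi> (int p) = 1"
proof (rule ccontr)
  assume "\<chi> (int p) \<noteq> 1"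
  hence frob: "acong p (\<omega> ^ p) \<omega>'" using omega_frobenius[OF p] by simp
  have p0: "p > 0" using p(1) prime_gt_0_nat by blast
  define x where "x = \<omega> - of_int r"
  define y where "y = \<omega>' - of_int r"
  have ax: "algebraic_int x" and ay: "algebraic_int y"
    unfolding x_def y_def by (rule algebraic_int_omega_diff)+
  have xy0: "acong p (x * y) 0"
  proof -
    have "[r * r - r + K = 0] (mod int p)" using r by (simp add: cong_0_iff)
    hence "acong p (of_int (r * r - r + K)) (of_int 0)" using acong_of_int[OF p0] by blast
    thus ?thesis unfolding x_def y_def omega_factor by simp
  qed
  have xp: "acong p (x ^ p) y"
  proof -
    have "acong p ((\<omega> + of_int (- r)) ^ p) (\<omega> ^ p + of_int (- r) ^ p)"
      by (rule acong_frobenius_add[OF p(1) algebraic_int_omega algebraic_int_of_int])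
    moreover have "acong p (of_int ((- r) ^ p)) (of_int (- r))"
      using fermat_int[OF p(1)] acong_of_int[OF p0] by blast
    hence "acong p (\<omega> ^ p + of_int ((- r) ^ p)) (\<omega>' + of_int (- r))"
      by (rule acong_add[OF frob])
    ultimately have "acong p ((\<omega> + of_int (- r)) ^ p) (\<omega>' + of_int (- r))"
      unfolding of_int_power by (rule acong_trans)
    thus ?thesis by (simp add: x_def y_def)
  qed
  have y2: "acong p (y * y) 0"
  proof -
    have "acong p (y * y) (y * x ^ p)" by (rule acong_mult_left[OF acong_sym[OF xp] ay])
    moreover have "y * x ^ p = x ^ (p - 1) * (x * y)" using p0 by (simp add: power_eq_if)
    moreover have "acong p (x ^ (p - 1) * (x * y)) (x ^ (p - 1) * 0)"
      by (rule acong_mult_left[OF xy0 algebraic_int_power[OF ax]])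
    ultimately show ?thesis using acong_trans by simp
  qed
  \<comment> \<open>Complex conjugation preserves algebraic integers and takes y to x.\<close>
  have "acong p (x * x) 0"
  proof -
    have "algebraic_int (cnj ((y * y - 0) / of_nat p))"
      using y2 unfolding acong_def algebraic_int_cnj_iff .
    also have "cnj ((y * y - 0) / of_nat p) = (x * x - 0) / of_nat p" by (simp add: x_def y_def cnj_omega' del: algebraic_int_cnj_iff)
    finally show ?thesis by (simp add: acong_def)
  qed
  hence "acong p (x * x + y * y) (0 + 0)" using y2 by (rule acong_add)
  moreover have "acong p (of_int (-2) * (x * y)) (of_int (-2) * 0)"
    by (rule acong_mult_left[OF xy0 algebraic_int_of_int])
  ultimately have "acong p (x * x + y * y + of_int (-2) * (x * y)) (0 + 0 + of_int (-2) * 0)"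
    by (rule acong_add)
  also have "x * x + y * y + of_int (-2) * (x * y) = (x - y)\<^sup>2"
    by (simp add: power2_eq_square algebra_simps)
  also have "x - y = G" by (simp add: x_def y_def \<omega>_def \<omega>'_def field_simps)
  finally have "acong p (of_int (- int k)) (of_int 0)" by (simp add: G_squared)
  hence "int p dvd int k" unfolding acong_of_int[OF p0] by (simp add: cong_0_iff)
  thus False using p(2) by simp
qed

text \<open>For p = 2 the congruence of \<open>\<omega>\<close> with its square says that
  \<open>K\<close> is even, so 0 is a root. For odd p, G^p is congruent to G, which after
  multiplication by G reads (-k)^((p+1)/2) = -k modulo p; Euler's criterion makes -k a square, and
  completing the square gives the root.\<close>

lemma chi_1_imp_root:
  assumes p: "prime p" "\<not> p dvd k" and chi: "\<chi> (int p) = 1"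
  obtains r where "int p dvd r * r - r + K"
proof (cases "p = 2")
  case True
  have "acong p (\<omega> ^ p) \<omega>" using omega_frobenius[OF p] chi by simp
  hence "acong p \<omega> (\<omega> ^ p)" by (rule acong_sym)
  hence "acong p (\<omega> - \<omega>\<^sup>2) 0" using True by (simp add: acong_def)
  moreover have "\<omega> - \<omega>\<^sup>2 = of_int K"
    unfolding omega_mult_K[symmetric] omega'_eq by (simp add: power2_eq_square algebra_simps)
  ultimately have "acong p (of_int K) (of_int 0)" by simp
  hence "[K = 0] (mod int p)" using acong_of_int True by (metis zero_less_numeral)
  thus ?thesis using that[of 0] by (simp add: cong_0_iff)
next
  case False
  have p0: "p > 0" using p(1) prime_gt_0_nat by blast
  have p2: "p > 2" using False prime_ge_2_nat[OF p(1)] by simp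
  have oddp: "Parity.odd p" using p2 p(1) by (simp add: prime_odd_nat)
  define h where "h = (p - 1) div 2"
  have h: "p = 2 * h + 1" using oddp by (simp add: h_def)
  have G_sum: "G = (\<Sum>j\<in>{0..<int k}. of_int (chi_int j) * e j)"
    by (simp add: G_def chi_int)
  have "acong p (G ^ p) (\<Sum>j\<in>{0..<int k}. of_int (chi_int j) * e j ^ p)"
    unfolding G_sum by (rule acong_frobenius_int_sum[OF p(1) algebraic_int_e])
  also have "(\<Sum>j\<in>{0..<int k}. of_int (chi_int j) * e j ^ p) = G"
    using gauss_sum_separable[of "int p"] chi by (simp add: e_power chi_int)
  finally have "acong p (G ^ p) G" .
  moreover have "algebraic_int G" unfolding G_sum
    by (intro algebraic_int_sum algebraic_int_add_times(2) algebraic_int_of_int algebraic_int_e)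
  ultimately have "acong p (G * G ^ p) (G * G)" by (rule acong_mult_left)
  also have "G * G = of_int (- int k)" using G_squared by (simp add: power2_eq_square)
  also have "G * G ^ p = of_int ((- int k) ^ Suc h)"
  proof -
    have "(G\<^sup>2) ^ Suc h = G ^ (2 * Suc h)" by (simp only: power_mult)
    also have "2 * Suc h = Suc p" by (simp add: h)
    finally have "G * G ^ p = (G\<^sup>2) ^ Suc h" by simp
    thus ?thesis unfolding G_squared by simp
  qed
  finally have "[(- int k) ^ Suc h = - int k] (mod int p)" unfolding acong_of_int[OF p0] .
  hence "[(- int k) * (- int k) ^ h = (- int k) * 1] (mod int p)" by simp
  moreover have "coprime (- int k) (int p)" using prime_imp_coprime[OF p] by (simp add: coprime_commute)
  ultimately have "[(- int k) ^ h = 1] (mod int p)" using cong_mult_lcancel by blast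
  hence "[Legendre (- int k) (int p) = 1] (mod int p)"
    using euler_criterion[OF p(1) p2, of "- int k"] cong_trans unfolding h_def by blast
  moreover have "\<not> [-1 = 1 :: int] (mod int p)"
    using p2 by (simp add: cong_iff_dvd_diff zdvd_not_zless)
  moreover have "\<not> [0 = 1 :: int] (mod int p)"
    using p2 by (simp add: cong_iff_dvd_diff zdvd_not_zless)
  ultimately have "QuadRes (int p) (- int k)"
    by (auto simp: Legendre_def split: if_splits)
  then obtain y where y: "[y\<^sup>2 = - int k] (mod int p)" by (auto simp: QuadRes_def)
  \<comment> \<open>h + 1 = (p + 1)/2 inverts 2 modulo p, so r is (y + 1)/2.\<close>
  define r where "r = (y + 1) * (int h + 1)"
  have "2 * r - 1 = y + int p * (y + 1)" by (simp add: r_def h algebra_simps)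
  hence "[2 * r - 1 = y] (mod int p)" by (simp add: cong_iff_dvd_diff)
  hence "[(2 * r - 1)\<^sup>2 = - int k] (mod int p)" using y cong_pow cong_trans by blast
  hence "int p dvd (2 * r - 1)\<^sup>2 + int k" by (simp add: cong_iff_dvd_diff)
  also have "(2 * r - 1)\<^sup>2 + int k = 4 * (r * r - r + K)"
    using K by (simp add: power2_eq_square algebra_simps)
  finally have "int p dvd 4 * (r * r - r + K)" .
  moreover have "coprime (int p) 4"
  proof -
    have "coprime p (2 ^ 2)" using oddp by (intro coprime_power_right_iff[THEN iffD2]) (simp add: coprime_right_2_iff_odd)
    hence "coprime p 4" by simp
    thus ?thesis by (metis coprime_int_iff of_nat_numeral)
  qed
  ultimately have "int p dvd r * r - r + K" using coprime_dvd_mult_right_iff by blast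
  thus ?thesis by (rule that)
qed

end

section \<open>Counting ideals of given norm\<close>

text \<open>The residues b modulo a for which a Z + (b + w) Z is an ideal, that is, for which a
  divides the norm of b + w. The roots r of X^2 - X + K met so far correspond to b = -r.\<close>

definition root_count :: "int \<Rightarrow> nat \<Rightarrow> nat" where
  "root_count K a = card {b \<in> {0..<int a}. int a dvd b * b + b + K}"

lemma root_condition_cong: 
  fixes b c K :: int
  assumes "[b = c] (mod a)"
  shows "a dvd b * b + b + K \<longleftrightarrow> a dvd c * c + c + K"
proof -
  have "[b * b + b + K = c * c + c + K] (mod a)" by (intro cong_add cong_mult cong_refl assms)
  thus ?thesis by (rule cong_dvd_iff)
qed

lemma root_condition_mod:
  fixes b K :: int
  shows "a dvd b mod a * (b mod a) + b mod a + K \<longleftrightarrow> a dvd b * b + b + K"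
  by (rule root_condition_cong) (simp add: unique_euclidean_semiring_class.cong_def)

lemma root_count_1 [simp]: "root_count K 1 = 1"
proof -
  have "{b \<in> {0..<int 1}. int 1 dvd b * b + b + K} = {0}" by auto
  thus ?thesis by (simp add: root_count_def)
qed

lemma root_count_mult:
  assumes "coprime m n" "m > 0" "n > 0"
  shows "root_count K (m * n) = root_count K m * root_count K n"
proof -
  define R where "R = (\<lambda>a. {b \<in> {0..<int a}. int a dvd b * b + b + K})"
  have cop: "coprime (int m) (int n)" using assms by simp
  have "bij_betw (\<lambda>b. (b mod int m, b mod int n)) (R (m * n)) (R m \<times> R n)"
  proof (rule bij_betw_imageI)
    show "inj_on (\<lambda>b. (b mod int m, b mod int n)) (R (m * n))"
    proof (rule inj_onI)
      fix b c assume bc: "b \<in> R (m * n)" "c \<in> R (m * n)"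
        "(b mod int m, b mod int n) = (c mod int m, c mod int n)"
      hence "[b = c] (mod int m)" "[b = c] (mod int n)"
        by (simp_all add: unique_euclidean_semiring_class.cong_def)
      hence "[b = c] (mod int m * int n)" using cop by (intro coprime_cong_mult)
      thus "b = c" using bc by (intro cong_less_imp_eq_int[of b "int (m * n)" c]) (auto simp: R_def)
    qed
    show "(\<lambda>b. (b mod int m, b mod int n)) ` R (m * n) = R m \<times> R n"
    proof (intro equalityI subsetI)
      fix z assume "z \<in> (\<lambda>b. (b mod int m, b mod int n)) ` R (m * n)"
      then obtain b where b: "b \<in> R (m * n)" "z = (b mod int m, b mod int n)" by auto
      have "int m dvd b * b + b + K" "int n dvd b * b + b + K"
        using b(1) by (auto simp: R_def intro: dvd_mult_left dvd_mult_right)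
      thus "z \<in> R m \<times> R n"
        using assms b(2) by (simp add: R_def root_condition_mod)
    next
      fix z assume "z \<in> R m \<times> R n"
      then obtain b c where bc: "z = (b, c)" "b \<in> R m" "c \<in> R n" by auto
      obtain x where x: "[x = b] (mod int m)" "[x = c] (mod int n)"
        using binary_chinese_remainder_int[OF cop] by blast
      define y where "y = x mod int (m * n)"
      have "[y = x] (mod int (m * n))"
        by (simp add: y_def unique_euclidean_semiring_class.cong_def)
      hence "[y = x] (mod int m)" "[y = x] (mod int n)"
        by (auto intro: cong_dvd_modulus)
      hence y: "[y = b] (mod int m)" "[y = c] (mod int n)" using x cong_trans by blast+
      have "int m dvd y * y + y + K" "int n dvd y * y + y + K"
        using bc root_condition_cong[OF y(1)] root_condition_cong[OF y(2)] by (auto simp: R_def)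
      hence "int m * int n dvd y * y + y + K" using cop by (intro divides_mult)
      hence "y \<in> R (m * n)" using assms by (simp add: R_def y_def)
      moreover have "(y mod int m, y mod int n) = z"
        using y bc by (auto simp: R_def unique_euclidean_semiring_class.cong_def)
      ultimately show "z \<in> (\<lambda>b. (b mod int m, b mod int n)) ` R (m * n)" by blast
    qed
  qed
  hence "card (R (m * n)) = card (R m \<times> R n)" by (rule bij_betw_same_card)
  thus ?thesis by (simp add: root_count_def R_def card_cartesian_product)
qed

text \<open>Hensel lifting: at every root the derivative 2 b + 1 is a unit modulo p, so each root
  modulo p^e has exactly one lift modulo p^(e+1).\<close>

lemma root_count_Suc_power:
  assumes p: "prime p" and unit: "\<And>b. int p dvd b * b + b + K \<Longrightarrow> \<not> int p dvd 2 * b + 1"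
    and e: "e > 0"
  shows "root_count K (p ^ Suc e) = root_count K (p ^ e)"
proof -
  define R where "R = (\<lambda>a. {b \<in> {0..<int a}. int a dvd b * b + b + K})"
  define q where "q = int p ^ e"
  have p0: "p > 0" using p prime_gt_0_nat by blast
  have q0: "q > 0" using p0 by (simp add: q_def)
  have pq: "int p dvd q" using e by (simp add: q_def dvd_power)
  have Q: "int (p ^ e) = q" "int (p ^ Suc e) = int p * q" by (simp_all add: q_def)
  \<comment> \<open>Taylor expansion at b. The quadratic term disappears modulo p q because p
    divides q, which leaves a linear condition on t modulo p.\<close>
  have lift: "(b + t * q) * (b + t * q) + (b + t * q) + K = (b * b + b + K) + q * (t * (2 * b + 1)) + q * q * (t * t)"
    for b t by (simp add: algebra_simps)
  have qq: "int p * q dvd q * q" using pq by (intro mult_dvd_mono) auto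
  have lift_iff: "int p * q dvd (b + t * q) * (b + t * q) + (b + t * q) + K \<longleftrightarrow> int p dvd s + t * (2 * b + 1)"
    if "b * b + b + K = q * s" for b t s
  proof -
    have "int p * q dvd (b + t * q) * (b + t * q) + (b + t * q) + K \<longleftrightarrow> int p * q dvd q * (s + t * (2 * b + 1))"
      unfolding lift that using qq by (subst dvd_add_left_iff) (simp_all add: distrib_left)
    also have "\<dots> \<longleftrightarrow> int p dvd s + t * (2 * b + 1)" using q0 by (simp add: mult.commute[of "int p"])
    finally show ?thesis .
  qed
  have unit': "coprime (2 * b + 1) (int p)" if "q dvd b * b + b + K" for b
  proof -
    have "\<not> int p dvd 2 * b + 1" using unit pq that dvd_trans by blast
    thus ?thesis using p by (simp add: prime_imp_coprime coprime_commute)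
  qed
  have "bij_betw (\<lambda>b. b mod q) (R (p ^ Suc e)) (R (p ^ e))"
  proof (rule bij_betw_imageI)
    show "inj_on (\<lambda>b. b mod q) (R (p ^ Suc e))"
    proof (rule inj_onI)
      fix b c assume bc: "b \<in> R (p ^ Suc e)" "c \<in> R (p ^ Suc e)" "b mod q = c mod q"
      then obtain t where t: "c = b + t * q"
        by (metis add_diff_cancel_left' diff_add_cancel mod_eq_dvd_iff dvd_def mult.commute add.commute)
      have bd: "int p * q dvd b * b + b + K" and cd: "int p * q dvd c * c + c + K"
        using bc by (simp_all add: R_def q_def)
      obtain s where s: "b * b + b + K = int p * q * s" using bd by blast
      have "b * b + b + K = q * (int p * s)" using s by simp
      from lift_iff[OF this, of t] have "int p dvd int p * s + t * (2 * b + 1)" using cd t by simp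
      hence "int p dvd t * (2 * b + 1)" by (simp add: dvd_add_right_iff)
      moreover have "q dvd b * b + b + K" using s by simp
      ultimately have "int p dvd t" using unit' by (simp add: coprime_dvd_mult_left_iff coprime_commute)
      hence "[b = c] (mod int p * q)" by (auto simp: t cong_iff_dvd_diff)
      thus "b = c" using bc by (intro cong_less_imp_eq_int[of b "int p * q" c]) (auto simp: R_def q_def)
    qed
    show "(\<lambda>b. b mod q) ` R (p ^ Suc e) = R (p ^ e)"
    proof (intro equalityI subsetI)
      fix z assume "z \<in> (\<lambda>b. b mod q) ` R (p ^ Suc e)"
      then obtain b where b: "b \<in> R (p ^ Suc e)" "z = b mod q" by auto
      have "q dvd b * b + b + K" using b(1) unfolding R_def Q by (auto intro: dvd_mult_right)
      thus "z \<in> R (p ^ e)" using q0 b(2) by (simp add: R_def Q root_condition_mod del: of_nat_power)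
    next
      fix b assume b: "b \<in> R (p ^ e)"
      hence bq: "q dvd b * b + b + K" by (simp add: R_def q_def)
      then obtain s where s: "b * b + b + K = q * s" by blast
      obtain u where u: "[(2 * b + 1) * u = 1] (mod int p)"
        using unit'[OF bq] cong_solve_coprime_int by blast
      \<comment> \<open>The solution of that linear condition, reduced so that b + t q lies in the
        standard range.\<close>
      define t where "t = (- s * u) mod int p"
      have t: "0 \<le> t" "t < int p" using p0 by (simp_all add: t_def)
      have "[t * (2 * b + 1) = (- s * u) * (2 * b + 1)] (mod int p)"
        by (intro cong_mult cong_refl) (simp add: t_def unique_euclidean_semiring_class.cong_def)
      also have "(- s * u) * (2 * b + 1) = - s * ((2 * b + 1) * u)" by simp
      also have "[- s * ((2 * b + 1) * u) = - s * 1] (mod int p)" by (rule cong_scalar_left[OF u])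
      finally have "int p dvd s + t * (2 * b + 1)" by (simp add: cong_iff_dvd_diff add.commute)
      hence "int p * q dvd (b + t * q) * (b + t * q) + (b + t * q) + K" using lift_iff[OF s] by blast
      moreover have "0 \<le> b + t * q" using b t q0 by (simp add: R_def)
      moreover have "b + t * q < int p * q"
      proof -
        have "b < q" using b by (simp add: R_def q_def)
        hence "b + t * q < (t + 1) * q" by (simp add: algebra_simps)
        also have "\<dots> \<le> int p * q" using t q0 by (intro mult_right_mono) auto
        finally show ?thesis .
      qed
      ultimately have "b + t * q \<in> R (p ^ Suc e)" unfolding R_def Q by simp
      moreover have "(b + t * q) mod q = b" using b by (simp add: R_def q_def)
      ultimately show "b \<in> (\<lambda>b. b mod q) ` R (p ^ Suc e)" by (metis imageI)
    qed
  qed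
  hence "card (R (p ^ Suc e)) = card (R (p ^ e))" by (rule bij_betw_same_card)
  thus ?thesis by (simp only: root_count_def R_def)
qed

lemma sum_divisors_coprime_mult:
  fixes m n :: nat and F :: "nat \<Rightarrow> 'a::comm_monoid_add"
  assumes cop: "coprime m n"
  shows "(\<Sum>d | d dvd m * n. F d) = (\<Sum>a | a dvd m. \<Sum>b | b dvd n. F (a * b))"
proof -
  have dec: "gcd (a * b) m = a" if "a dvd m" "b dvd n" for a b
  proof -
    have "coprime b m" using cop that by (meson coprime_commute coprime_divisors dvd_refl)
    hence "gcd (a * b) m = gcd a m" by (intro gcd_mult_left_right_cancel) (simp add: coprime_commute)
    thus ?thesis using that by (simp add: gcd_nat.absorb1)
  qed
  have dec': "gcd (a * b) n = b" if "a dvd m" "b dvd n" for a b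
  proof -
    have "coprime a n" using cop that by (meson coprime_divisors dvd_refl)
    hence "gcd (a * b) n = gcd b n" by (intro gcd_mult_left_left_cancel) (simp add: coprime_commute)
    thus ?thesis using that by (simp add: gcd_nat.absorb1)
  qed
  have "bij_betw (\<lambda>(a, b). a * b) ({a. a dvd m} \<times> {b. b dvd n}) {d. d dvd m * n}"
  proof (rule bij_betw_imageI)
    show "inj_on (\<lambda>(a, b). a * b) ({a. a dvd m} \<times> {b. b dvd n})"
    proof (rule inj_onI, clarify)
      fix a b a' b' assume "a dvd m" "b dvd n" "a' dvd m" "b' dvd n" "a * b = a' * b'"
      thus "a = a' \<and> b = b'" using dec[of a b] dec[of a' b'] dec'[of a b] dec'[of a' b'] by metis
    qed
    show "(\<lambda>(a, b). a * b) ` ({a. a dvd m} \<times> {b. b dvd n}) = {d. d dvd m * n}"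
    proof (intro equalityI subsetI)
      fix d assume "d \<in> {d. d dvd m * n}"
      hence "d dvd m * n" by simp
      then obtain a b where "d = a * b" "a dvd m" "b dvd n" by (rule dvd_productE)
      thus "d \<in> (\<lambda>(a, b). a * b) ` ({a. a dvd m} \<times> {b. b dvd n})" by force
    qed (auto intro: mult_dvd_mono)
  qed
  from sum.reindex_bij_betw[OF this, of F] show ?thesis
    by (simp add: sum.cartesian_product case_prod_unfold)
qed

lemma coprime_multiplicative_induct:
  fixes n :: nat
  assumes n: "n > 0" and one: "P 1"
    and pp: "\<And>p e. prime p \<Longrightarrow> e > 0 \<Longrightarrow> P (p ^ e)"
    and mult: "\<And>m n. coprime m n \<Longrightarrow> m > 0 \<Longrightarrow> n > 0 \<Longrightarrow> P m \<Longrightarrow> P n \<Longrightarrow> P (m * n)"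
  shows "P n"
  using n
proof (induction n rule: less_induct)
  case (less n)
  show ?case
  proof (cases "n = 1")
    case True thus ?thesis using one by simp
  next
    case False
    then obtain p where p: "prime p" "p dvd n" by (metis prime_factor_nat)
    define e where "e = multiplicity p n"
    have e: "e > 0" using p less.prems by (simp add: e_def prime_multiplicity_gt_zero_iff)
    obtain m where m: "n = p ^ e * m" "\<not> p dvd m"
      using multiplicity_decompose'[of n p] p less.prems not_prime_unit unfolding e_def by (metis less_numeral_extra(3))
    have m0: "m > 0" using m less.prems by (cases m) auto
    have "1 < p ^ e" using prime_gt_1_nat[OF p(1)] e by (metis one_less_power)
    hence "m < n" using m(1) m0 by simp
    have "coprime (p ^ e) m" using p m(2) by (simp add: prime_imp_coprime)
    thus ?thesis unfolding m(1)
      using mult pp[OF p(1) e] less.IH[OF \<open>m < n\<close> m0] m0 prime_gt_0_nat[OF p(1)] by simp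
  qed
qed

text \<open>Ideals of norm n sorted by content: c times a primitive ideal of norm n/c^2. Summing
  over all divisors c, with a test inside, lets \<open>sum_divisors_coprime_mult\<close>
  apply.\<close>

definition ideal_count :: "int \<Rightarrow> nat \<Rightarrow> nat" where
  "ideal_count K n = (\<Sum>c | c dvd n. if c\<^sup>2 dvd n then root_count K (n div c\<^sup>2) else 0)"

lemma ideal_count_mult:
  assumes cop: "coprime m n" and m: "m > 0" and n: "n > 0"
  shows "ideal_count K (m * n) = ideal_count K m * ideal_count K n"
proof -
  have "ideal_count K (m * n) = (\<Sum>a | a dvd m. \<Sum>b | b dvd n.
      if (a * b)\<^sup>2 dvd m * n then root_count K (m * n div (a * b)\<^sup>2) else 0)"
    unfolding ideal_count_def by (rule sum_divisors_coprime_mult[OF cop])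
  also have "\<dots> = (\<Sum>a | a dvd m. \<Sum>b | b dvd n.
      (if a\<^sup>2 dvd m then root_count K (m div a\<^sup>2) else 0) * (if b\<^sup>2 dvd n then root_count K (n div b\<^sup>2) else 0))"
  proof (intro sum.cong refl)
    fix a b assume "a \<in> {a. a dvd m}" "b \<in> {b. b dvd n}"
    hence ab: "a dvd m" "b dvd n" by auto
    have "coprime a n" "coprime b m"
      using coprime_divisors[OF ab(1) dvd_refl cop] coprime_divisors[OF dvd_refl ab(2) cop]
      by (simp_all add: coprime_commute)
    hence c: "coprime (a\<^sup>2) n" "coprime (b\<^sup>2) m" by simp_all
    have iff: "(a * b)\<^sup>2 dvd m * n \<longleftrightarrow> a\<^sup>2 dvd m \<and> b\<^sup>2 dvd n"
    proof
      assume "(a * b)\<^sup>2 dvd m * n"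
      hence "a\<^sup>2 dvd m * n" "b\<^sup>2 dvd m * n"
        unfolding power_mult_distrib by (rule dvd_mult_left, rule dvd_mult_right)
      thus "a\<^sup>2 dvd m \<and> b\<^sup>2 dvd n" using c by (simp add: coprime_dvd_mult_left_iff coprime_dvd_mult_right_iff)
    qed (auto simp: power_mult_distrib intro: mult_dvd_mono)
    show "(if (a * b)\<^sup>2 dvd m * n then root_count K (m * n div (a * b)\<^sup>2) else 0) =
      (if a\<^sup>2 dvd m then root_count K (m div a\<^sup>2) else 0) * (if b\<^sup>2 dvd n then root_count K (n div b\<^sup>2) else 0)"
    proof (cases "a\<^sup>2 dvd m \<and> b\<^sup>2 dvd n")
      case True
      then obtain u v where uv: "m = a\<^sup>2 * u" "n = b\<^sup>2 * v" unfolding dvd_def by blast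
      have pos: "a\<^sup>2 > 0" "b\<^sup>2 > 0" "u > 0" "v > 0" using uv m n by auto
      have "coprime u v" using cop uv by simp
      moreover have "m * n div (a * b)\<^sup>2 = u * v"
      proof -
        have "m * n = (a * b)\<^sup>2 * (u * v)" using uv by (simp add: power_mult_distrib)
        thus ?thesis using pos by simp
      qed
      ultimately show ?thesis using True iff root_count_mult[of u v K] pos uv by simp
    next
      case False
      thus ?thesis using iff by auto
    qed
  qed
  also have "\<dots> = ideal_count K m * ideal_count K n"
    by (simp add: ideal_count_def sum_product)
  finally show ?thesis .
qed

lemma ideal_count_prime_power:
  assumes p: "prime p"
  shows "ideal_count K (p ^ e) = (\<Sum>i\<le>e div 2. root_count K (p ^ (e - 2 * i)))"
proof -
  have p0: "p > 0" and p1: "p > 1" using p prime_gt_0_nat prime_gt_1_nat by blast+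
  have D: "{d. d dvd p ^ e} = (\<lambda>i. p ^ i) ` {..e}"
    using p by (auto simp: divides_primepow_nat)
  have inj: "inj_on (\<lambda>i. p ^ i) {..e}" using p1 by (auto intro!: inj_onI)
  have "ideal_count K (p ^ e) = (\<Sum>i\<le>e. if (p ^ i)\<^sup>2 dvd p ^ e then root_count K (p ^ e div (p ^ i)\<^sup>2) else 0)"
    unfolding ideal_count_def D by (subst sum.reindex[OF inj]) simp
  also have "\<dots> = (\<Sum>i\<le>e. if i \<le> e div 2 then root_count K (p ^ (e - 2 * i)) else 0)"
  proof (intro sum.cong refl)
    fix i
    have 1: "(p ^ i)\<^sup>2 = p ^ (2 * i)" by (simp add: power_mult power2_eq_square mult_2 power_add)
    have 2: "p ^ (2 * i) dvd p ^ e \<longleftrightarrow> i \<le> e div 2" using p1 by (subst dvd_power_iff_le) auto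
    have 3: "p ^ e div p ^ (2 * i) = p ^ (e - 2 * i)" if "i \<le> e div 2"
      using that p0 by (intro power_diff[symmetric]) auto
    show "(if (p ^ i)\<^sup>2 dvd p ^ e then root_count K (p ^ e div (p ^ i)\<^sup>2) else 0) =
      (if i \<le> e div 2 then root_count K (p ^ (e - 2 * i)) else 0)"
      unfolding 1 using 2 3 by simp
  qed
  also have "\<dots> = (\<Sum>i\<le>e div 2. root_count K (p ^ (e - 2 * i)))"
    by (rule sum.mono_neutral_cong_right) auto
  finally show ?thesis .
qed

context odd_real_primitive_char
begin

lemma four_times: "4 * (b * b + b + K) = (2 * b + 1)\<^sup>2 + int k"
  using K by (simp add: power2_eq_square algebra_simps)

text \<open>One formula for the three types of primes, with 0^0 = 1: two roots if p splits, none if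
  it is inert, and in the ramified case one root modulo p and none modulo higher powers. Since 4
  (b^2 + b + K) = (2 b + 1)^2 + k, Hensel lifting applies away from k, while a root modulo p^2 with
  p dividing k would make p^2 divide k.\<close>

lemma root_count_prime_power:
  assumes p: "prime p" and j: "j > 0"
  shows "int (root_count K (p ^ j)) = chi_int (int p) ^ (j - 1) + chi_int (int p) ^ j"
proof (cases "p dvd k")
  case False
  have p0: "p > 0" using p prime_gt_0_nat by blast
  have unit: "\<not> int p dvd 2 * b + 1" if "int p dvd b * b + b + K" for b
  proof
    assume "int p dvd 2 * b + 1"
    hence "int p dvd (2 * b + 1)\<^sup>2" by (simp add: power2_eq_square)
    moreover have "int p dvd (2 * b + 1)\<^sup>2 + int k"
      unfolding four_times[symmetric] using that by (rule dvd_mult)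
    ultimately have "int p dvd int k" using dvd_add_right_iff by blast
    thus False using False by simp
  qed
  have pj: "root_count K (p ^ j) = root_count K p"
    using j
  proof (induction j rule: nat_induct_non_zero)
    case (Suc n)
    thus ?case using root_count_Suc_power[where K = K, OF p unit, of n] by simp
  qed simp
  have cop: "coprime (int p) (int k)" using False p by (simp add: prime_imp_coprime)
  show ?thesis
  proof (cases "\<chi> (int p) = 1")
    case True
    obtain r where r: "int p dvd r * r - r + K" using chi_1_imp_root[OF p False True] .
    define b0 where "b0 = - r"
    have b0: "int p dvd b0 * b0 + b0 + K" using r by (simp add: b0_def)
    have "{b \<in> {0..<int p}. int p dvd b * b + b + K} = {b0 mod int p, (- 1 - b0) mod int p}"
    proof (intro equalityI subsetI)
      fix b assume b: "b \<in> {b \<in> {0..<int p}. int p dvd b * b + b + K}"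
      have "(b * b + b + K) - (b0 * b0 + b0 + K) = (b - b0) * (b - (- 1 - b0))" by (simp add: algebra_simps)
      hence "int p dvd (b - b0) * (b - (- 1 - b0))" using b b0 by (metis (no_types, lifting) dvd_diff mem_Collect_eq)
      hence "int p dvd b - b0 \<or> int p dvd b - (- 1 - b0)" using p by (simp add: prime_dvd_mult_iff)
      hence "b mod int p = b0 mod int p \<or> b mod int p = (- 1 - b0) mod int p"
        by (simp add: mod_eq_dvd_iff)
      thus "b \<in> {b0 mod int p, (- 1 - b0) mod int p}" using b by auto
    next
      fix b assume b: "b \<in> {b0 mod int p, (- 1 - b0) mod int p}"
      have "(- 1 - b0) * (- 1 - b0) + (- 1 - b0) + K = b0 * b0 + b0 + K" by (simp add: algebra_simps)
      with b0 have "int p dvd (- 1 - b0) * (- 1 - b0) + (- 1 - b0) + K" by (simp only:)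
      hence "int p dvd b * b + b + K" using b b0 root_condition_mod by auto
      thus "b \<in> {b \<in> {0..<int p}. int p dvd b * b + b + K}" using b p0 by auto
    qed
    moreover have "b0 mod int p \<noteq> (- 1 - b0) mod int p"
      using unit[OF b0] by (simp add: mod_eq_dvd_iff algebra_simps)
    ultimately have "root_count K p = 2" by (simp add: root_count_def)
    thus ?thesis using pj True by (simp add: chi_int_def)
  next
    case neg: False
    hence chi: "\<chi> (int p) = -1" using chi_pm[OF cop] by blast
    have "{b \<in> {0..<int p}. int p dvd b * b + b + K} = {}"
    proof (rule ccontr)
      assume "\<not> ?thesis"
      then obtain b where "int p dvd b * b + b + K" by blast
      hence "int p dvd (- b) * (- b) - (- b) + K" by simp
      thus False using root_imp_chi_1[OF p False] neg by blast
    qed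
    hence "root_count K p = 0" unfolding root_count_def by (simp only: card.empty)
    moreover have "chi_int (int p) = -1" using chi by (simp add: chi_int_def)
    ultimately show ?thesis using pj j by (cases j) auto
  qed
next
  case True
  have p0: "p > 0" using p prime_gt_0_nat by blast
  have "\<not> coprime (int p) (int k)" using True p by (metis coprime_absorb_left int_dvd_int_iff not_prime_unit prime_nat_int_transfer)
  hence chi0: "chi_int (int p) = 0" using chi_eq_0 by (simp add: chi_int_def)
  have oddp: "Parity.odd p" using True odd_k by (meson dvd_trans)
  have cop4: "coprime (int p) 4"
  proof -
    have "coprime p (2 ^ 2)" using oddp by (intro coprime_power_right_iff[THEN iffD2]) (simp add: coprime_right_2_iff_odd)
    hence "coprime p 4" by simp
    thus ?thesis by (metis coprime_int_iff of_nat_numeral)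
  qed
  have div1: "int p dvd 2 * b + 1" if "int p dvd b * b + b + K" for b
  proof -
    have "int p dvd (2 * b + 1)\<^sup>2 + int k"
      unfolding four_times[symmetric] using that by (rule dvd_mult)
    moreover have "int p dvd int k" using True by simp
    ultimately have "int p dvd (2 * b + 1)\<^sup>2" using dvd_add_left_iff by blast
    thus ?thesis using p by (metis prime_dvd_power prime_nat_int_transfer)
  qed
  have div2: "int p dvd b * b + b + K" if "int p dvd 2 * b + 1" for b
  proof -
    have "int p dvd (2 * b + 1)\<^sup>2 + int k" using that True by (simp add: power2_eq_square)
    hence "int p dvd 4 * (b * b + b + K)" unfolding four_times .
    thus ?thesis using cop4 coprime_dvd_mult_right_iff by blast
  qed
  show ?thesis
  proof (cases "j = 1")
    case j1: True
    \<comment> \<open>The zero of 2 b + 1 modulo p.\<close>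
    define b0 where "b0 = int ((p - 1) div 2)"
    have b0: "2 * b0 + 1 = int p" using oddp p0 unfolding b0_def by presburger
    have "{b \<in> {0..<int p}. int p dvd b * b + b + K} = {b0}"
    proof (intro equalityI subsetI)
      fix b assume b: "b \<in> {b \<in> {0..<int p}. int p dvd b * b + b + K}"
      hence "int p dvd 2 * b + 1" using div1 by simp
      then obtain t where t: "2 * b + 1 = int p * t" by blast
      have "0 < int p * t" "int p * t < int p * 2" unfolding t[symmetric] using b by auto
      hence "0 < t" using p0 by (simp add: zero_less_mult_iff)
      moreover have "t < 2" using \<open>int p * t < int p * 2\<close> p0 by (subst (asm) mult_less_cancel_left_pos) simp_all
      ultimately have "t = 1" by simp
      thus "b \<in> {b0}" using t b0 by simp
    next
      fix b assume "b \<in> {b0}"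
      thus "b \<in> {b \<in> {0..<int p}. int p dvd b * b + b + K}"
        using div2[of b0] b0 by auto
    qed
    hence "root_count K p = 1" by (simp add: root_count_def)
    thus ?thesis using j1 chi0 by simp
  next
    case False
    hence j2: "j \<ge> 2" using j by simp
    have "{b \<in> {0..<int (p ^ j)}. int (p ^ j) dvd b * b + b + K} = {}"
    proof (rule ccontr)
      assume "\<not> ?thesis"
      then obtain b where b: "int (p ^ j) dvd b * b + b + K" by blast
      have "p ^ 2 dvd p ^ j" using j2 by (rule le_imp_power_dvd)
      hence "int p * int p dvd int (p ^ j)" by (metis int_dvd_int_iff of_nat_mult power2_eq_square)
      hence pp: "int p * int p dvd b * b + b + K" using b dvd_trans by blast
      hence "int p dvd 2 * b + 1" using div1 dvd_mult_left by blast
      hence "int p * int p dvd (2 * b + 1)\<^sup>2" by (simp add: power2_eq_square mult_dvd_mono)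
      moreover have "int p * int p dvd (2 * b + 1)\<^sup>2 + int k"
        unfolding four_times[symmetric] using pp by (rule dvd_mult)
      ultimately have "int p * int p dvd int k" using dvd_add_right_iff by blast
      hence "p * p dvd k" by (metis int_dvd_int_iff of_nat_mult)
      thus False using not_prime_square_dvd[OF p] by blast
    qed
    hence "root_count K (p ^ j) = 0" unfolding root_count_def by (simp only: card.empty)
    thus ?thesis using chi0 j2 by (simp add: power_0_left)
  qed
qed

lemma chi_int_mult: "chi_int (m * n) = chi_int m * chi_int n"
proof -
  have "(of_int (chi_int (m * n)) :: complex) = of_int (chi_int m * chi_int n)"
    using chi_mult[of m n] by (simp add: chi_int)
  thus ?thesis by (simp only: of_int_eq_iff)
qed

lemma chi_int_1 [simp]: "chi_int 1 = 1"
  by (simp add: chi_int_def)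

lemma chi_int_power: "chi_int (n ^ i) = chi_int n ^ i"
  by (induction i) (simp_all add: chi_int_mult)

lemma root_count_Suc_0 [simp]: "root_count K (Suc 0) = Suc 0"
  using root_count_1[of K] by simp

text \<open>Both sides are multiplicative. At p^e, with c the value of \<open>\<chi>\<close> at p,
  the terms c^(j-1) + c^j for j = e, e - 2, ... fill up the geometric sum 1 + c + ... + c^e; for
  even e the last one is the single 1 of j = 0.\<close>

lemma ideal_count_eq_divisor_sum:
  assumes n: "n > 0"
  shows "int (ideal_count K n) = (\<Sum>d | d dvd n. chi_int (int d))"
  using n
proof (rule coprime_multiplicative_induct)
  have "{d::nat. d dvd 1} = {1}" by auto
  thus "int (ideal_count K 1) = (\<Sum>d | d dvd 1. chi_int (int d))"
    by (simp add: ideal_count_def)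
next
  fix m n :: nat assume cop: "coprime m n" and pos: "m > 0" "n > 0"
    and IH: "int (ideal_count K m) = (\<Sum>d | d dvd m. chi_int (int d))"
     "int (ideal_count K n) = (\<Sum>d | d dvd n. chi_int (int d))"
  show "int (ideal_count K (m * n)) = (\<Sum>d | d dvd m * n. chi_int (int d))"
    unfolding ideal_count_mult[OF cop pos] sum_divisors_coprime_mult[OF cop] of_nat_mult IH
    by (simp add: chi_int_mult sum_product)
next
  fix p e :: nat assume p: "prime p"
  have p1: "p > 1" using p prime_gt_1_nat by blast
  have D: "{d. d dvd p ^ e} = (\<lambda>i. p ^ i) ` {..e}"
    using p by (auto simp: divides_primepow_nat)
  have inj: "inj_on (\<lambda>i. p ^ i) {..e}" using p1 by (auto intro!: inj_onI)
  define c where "c = chi_int (int p)"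
  have 1: "(\<Sum>d | d dvd p ^ e. chi_int (int d)) = (\<Sum>i\<le>e. c ^ i)"
    unfolding D by (subst sum.reindex[OF inj]) (simp add: chi_int_power c_def)
  have rc: "int (root_count K (p ^ Suc j)) = c ^ j + c ^ Suc j" for j
    using root_count_prime_power[OF p, of "Suc j"] by (simp add: c_def)
  have "int (\<Sum>i\<le>e div 2. root_count K (p ^ (e - 2 * i))) = (\<Sum>i\<le>e. c ^ i)"
  proof (induction e rule: less_induct)
    case (less e)
    consider "e = 0" | "e = 1" | f where "e = Suc (Suc f)" by (metis One_nat_def old.nat.exhaust)
    thus ?case
    proof cases
      case 1 thus ?thesis by simp
    next
      case 2 thus ?thesis using rc[of 0] by simp
    next
      case (3 f)
      have "e div 2 = Suc (f div 2)" using 3 by simp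
      hence "(\<Sum>i\<le>e div 2. root_count K (p ^ (e - 2 * i))) =
        root_count K (p ^ e) + (\<Sum>i\<le>f div 2. root_count K (p ^ (f - 2 * i)))"
        using 3 by (simp add: sum.atMost_Suc_shift del: sum.atMost_Suc power_Suc)
      hence "int (\<Sum>i\<le>e div 2. root_count K (p ^ (e - 2 * i))) =
         int (root_count K (p ^ e)) + (\<Sum>i\<le>f. c ^ i)"
        using less.IH[of f] 3 by simp
      thus ?thesis using rc[of "Suc f"] 3 by (simp del: power_Suc)
    qed
  qed
  thus "int (ideal_count K (p ^ e)) = (\<Sum>d | d dvd p ^ e. chi_int (int d))"
    unfolding 1 ideal_count_prime_power[OF p] .
qed

end

section \<open>The ring of integers\<close>

text \<open>The field side, kept free of characters. Under the two arithmetic conditions the field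
  has discriminant -k, and the bound on k excludes k = 3, whose field has six units.\<close>

locale imaginary_quadratic =
  fixes k :: nat
  assumes k_ge_7: "k \<ge> 7" and sqf: "squarefree k" and four_dvd_Suc: "4 dvd k + 1"
begin

definition N0 :: int where "N0 = (int k + 1) div 4"

lemma N0: "4 * N0 = int k + 1" using four_dvd_Suc unfolding N0_def by presburger

definition w :: complex where "w = Complex (1/2) (sqrt (real k) / 2)"

lemma Re_w [simp]: "Re w = 1/2" and Im_w [simp]: "Im w = sqrt (real k) / 2"
  by (simp_all add: w_def)

lemma sqrt_k_pos: "sqrt (real k) > 0" using k_ge_7 by simp

lemma cnj_w: "cnj w = 1 - w"
  by (simp add: complex_eq_iff)

lemma w_cnj_w: "w * (1 - w) = of_int N0"
proof -
  have "w * (1 - w) = w * cnj w" by (simp add: cnj_w)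
  also have "\<dots> = of_real ((Re w)\<^sup>2 + (Im w)\<^sup>2)" by (simp add: complex_mult_cnj)
  also have "(Re w)\<^sup>2 + (Im w)\<^sup>2 = (real k + 1) / 4" by (simp add: power_divide field_simps)
  also have "(real k + 1) / 4 = of_int N0"
  proof -
    have "of_int (4 * N0) = (of_int (int k + 1) :: real)" unfolding N0 ..
    thus ?thesis by simp
  qed
  finally show ?thesis by simp
qed

lemma w_squared: "w * w = w - of_int N0"
  using w_cnj_w by (simp add: algebra_simps)

definition elt :: "int \<Rightarrow> int \<Rightarrow> complex" where "elt x y = of_int x + of_int y * w"

lemma Im_elt: "Im (elt x y) = of_int y * sqrt (real k) / 2"
  and Re_elt: "Re (elt x y) = of_int x + of_int y / 2"
  by (simp_all add: elt_def)

lemma elt_eq_iff [simp]: "elt x y = elt x' y' \<longleftrightarrow> x = x' \<and> y = y'"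
proof
  assume eq: "elt x y = elt x' y'"
  have "y = y'" using arg_cong[OF eq, of Im] sqrt_k_pos by (simp add: Im_elt)
  moreover have "x = x'" using arg_cong[OF eq, of Re] \<open>y = y'\<close> by (simp add: Re_elt)
  ultimately show "x = x' \<and> y = y'" by simp
qed simp

lemma elt_0_0: "elt 0 0 = 0" by (simp add: elt_def)

lemma elt_eq_0_iff [simp]: "elt x y = 0 \<longleftrightarrow> x = 0 \<and> y = 0"
  using elt_eq_iff[of x y 0 0] by (simp only: elt_0_0)

lemma elt_add: "elt x y + elt x' y' = elt (x + x') (y + y')"
  by (simp add: elt_def algebra_simps)

lemma elt_diff: "elt x y - elt x' y' = elt (x - x') (y - y')"
  by (simp add: elt_def algebra_simps)

lemma elt_mult: "elt x y * elt x' y' = elt (x * x' - N0 * y * y') (x * y' + y * x' + y * y')"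
proof -
  have "elt x y * elt x' y' = of_int (x * x') + of_int (x * y' + y * x') * w + of_int (y * y') * (w * w)"
    by (simp add: elt_def algebra_simps)
  thus ?thesis unfolding w_squared by (simp add: elt_def algebra_simps)
qed

lemma elt_scale: "of_int c * elt x y = elt (c * x) (c * y)"
  by (simp add: elt_def algebra_simps)

definition Ok :: "complex set" where "Ok = {elt x y | x y. True}"

lemma OkI [intro]: "elt x y \<in> Ok" by (auto simp: Ok_def)

lemma Ok_add: "u \<in> Ok \<Longrightarrow> v \<in> Ok \<Longrightarrow> u + v \<in> Ok"
  by (auto simp: Ok_def elt_add)

lemma Ok_diff: "u \<in> Ok \<Longrightarrow> v \<in> Ok \<Longrightarrow> u - v \<in> Ok"
  by (auto simp: Ok_def elt_diff)

lemma Ok_mult: "u \<in> Ok \<Longrightarrow> v \<in> Ok \<Longrightarrow> u * v \<in> Ok"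
  by (auto simp: Ok_def elt_mult)

lemma Ok_of_int: "of_int n \<in> Ok"
  using OkI[of n 0] by (simp add: elt_def)

lemma algebraic_int_elt: "algebraic_int (elt x y)"
proof -
  have "algebraic_int w"
  proof (rule algebraic_int_if_stable_span[of "{1, w}"])
    have "w \<noteq> 1" by (simp add: complex_eq_iff)
    fix s assume "s \<in> {1, w}"
    then consider "s = 1" | "s = w" by blast
    thus "\<exists>c :: complex \<Rightarrow> int. w * s = (\<Sum>r\<in>{1, w}. of_int (c r) * r)"
    proof cases
      case 1
      show ?thesis by (rule exI[of _ "\<lambda>r. if r = w then 1 else 0"]) (use 1 \<open>w \<noteq> 1\<close> in auto)
    next
      case 2
      show ?thesis
        by (rule exI[of _ "\<lambda>r. if r = w then 1 else - N0"]) (use 2 \<open>w \<noteq> 1\<close> w_squared in auto)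
    qed
  qed auto
  thus ?thesis unfolding elt_def
    by (intro algebraic_int_add_times algebraic_int_of_int)
qed

lemma csqrt_k: "csqrt (of_int (- int k)) = \<i> * of_real (sqrt (real k))"
proof -
  have "Im (of_int (- int k)) = 0" "Re (of_int (- int k)) \<le> 0" by simp_all
  from csqrt_of_real_nonpos[OF this] show ?thesis by simp
qed

lemma complex_of_rat: "(of_rat r :: complex) = of_real (of_rat r)"
proof -
  obtain m n where "r = of_int m / of_int n" by (metis quotient_of_div surj_pair)
  thus ?thesis by (simp add: of_rat_divide)
qed

text \<open>Trace 2 p and norm p^2 + k q^2 are integers. The square of the denominator of 2 q
  divides k, so 2 q is an integer by squarefreeness; then k = 3 modulo 4 forces 2 p and 2 q to have
  equal parity.\<close>

lemma algebraic_int_imp_Ok: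
  fixes p q :: rat
  assumes x: "algebraic_int (of_rat p + of_rat q * (\<i> * of_real (sqrt (real k))) :: complex)"
  shows "of_rat p + of_rat q * (\<i> * of_real (sqrt (real k))) \<in> Ok"
proof -
  define z :: complex where "z = of_rat p + of_rat q * (\<i> * of_real (sqrt (real k)))"
  have z: "z = Complex (of_rat p) (of_rat q * sqrt (real k))"
    unfolding z_def by (simp add: complex_eq_iff complex_of_rat)
  have az: "algebraic_int z" using x by (simp add: z_def)
  hence az': "algebraic_int (cnj z)" by simp
  have int_if: "\<exists>P :: int. r = of_int P" if "algebraic_int (of_rat r :: complex)" for r
  proof -
    have "(of_rat r :: complex) \<in> \<int>" using that by (intro rational_algebraic_int_is_int) auto
    then obtain P :: int where "(of_rat r :: complex) = of_int P" by (auto elim: Ints_cases)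
    hence "(of_rat r :: complex) = of_rat (of_int P)" by simp
    thus ?thesis by (auto simp only: of_rat_eq_iff)
  qed
  have "z + cnj z = of_rat (2 * p)" by (simp add: z complex_eq_iff of_rat_mult complex_of_rat)
  then obtain P :: int where P: "2 * p = of_int P"
    using algebraic_int_add_times(1)[OF az az'] int_if[of "2 * p"] by auto
  have "z * cnj z = of_rat (p\<^sup>2 + of_nat k * q\<^sup>2)"
    by (simp add: z complex_eq_iff of_rat_mult of_rat_add of_rat_power power2_eq_square complex_of_rat)
  then obtain M :: int where M: "p\<^sup>2 + of_nat k * q\<^sup>2 = of_int M"
    using algebraic_int_add_times(2)[OF az az'] int_if[of "p\<^sup>2 + of_nat k * q\<^sup>2"] by auto
  have kq: "of_nat k * (2 * q)\<^sup>2 = (of_int (4 * M - P\<^sup>2) :: rat)"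
  proof -
    have "of_nat k * (2 * q)\<^sup>2 = 4 * (p\<^sup>2 + of_nat k * q\<^sup>2) - (2 * p)\<^sup>2"
      by (simp add: power2_eq_square algebra_simps)
    thus ?thesis unfolding M P by simp
  qed
  obtain Q :: int where Q: "2 * q = of_int Q"
  proof -
    obtain m n where mn: "2 * q = of_int m / of_int n" "n > 0" "coprime m n"
      by (cases "quotient_of (2 * q)") (metis quotient_of_coprime quotient_of_denom_pos quotient_of_div)
    have "of_nat k * (of_int m)\<^sup>2 = (of_int (4 * M - P\<^sup>2) :: rat) * (of_int n)\<^sup>2"
      using kq mn(2) unfolding mn(1) by (simp add: power_divide field_simps)
    hence "(of_int (int k * m\<^sup>2) :: rat) = of_int ((4 * M - P\<^sup>2) * n\<^sup>2)" by simp
    hence "int k * m\<^sup>2 = (4 * M - P\<^sup>2) * n\<^sup>2" by (simp only: of_int_eq_iff)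
    hence "n\<^sup>2 dvd int k * m\<^sup>2" by simp
    moreover have "coprime (n\<^sup>2) (m\<^sup>2)" using mn(3) by (simp add: coprime_commute)
    ultimately have "n\<^sup>2 dvd int k" by (simp add: coprime_dvd_mult_left_iff)
    hence "(nat n)\<^sup>2 dvd k" using mn(2) by (metis int_dvd_int_iff nat_0_le of_nat_power order_less_imp_le)
    hence "nat n = 1" using squarefreeD[OF sqf] by auto
    hence "n = 1" using mn(2) by linarith
    thus ?thesis using that mn(1) by simp
  qed
  have "of_int (int k * Q\<^sup>2) = (of_int (4 * M - P\<^sup>2) :: rat)" using kq unfolding Q by simp
  hence "int k * Q\<^sup>2 = 4 * M - P\<^sup>2" by (simp only: of_int_eq_iff)
  moreover have "4 * (N0 * Q\<^sup>2) = (int k + 1) * Q\<^sup>2" by (simp only: mult.assoc[symmetric] N0)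
  hence "int k * Q\<^sup>2 = 4 * (N0 * Q\<^sup>2) - Q\<^sup>2" by (simp add: algebra_simps)
  ultimately have "P\<^sup>2 - Q\<^sup>2 = 4 * (M - N0 * Q\<^sup>2)" by simp
  hence "even (P\<^sup>2 - Q\<^sup>2)" by simp
  hence "even (P - Q)" by simp
  then obtain t where t: "P = Q + 2 * t" by (metis add.commute diff_add_cancel evenE)
  have "2 * (of_rat p :: real) = of_rat (2 * p)" by (simp add: of_rat_mult)
  hence p': "(of_rat p :: real) = of_int P / 2" unfolding P by simp
  have "2 * (of_rat q :: real) = of_rat (2 * q)" by (simp add: of_rat_mult)
  hence q': "(of_rat q :: real) = of_int Q / 2" unfolding Q by simp
  have "z = elt t Q" by (simp add: z complex_eq_iff Re_elt Im_elt p' q' t)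
  thus ?thesis by (auto simp: z_def)
qed

definition R :: "complex ring" where "R = ring_of_integers (quadratic_field (- int k))"

lemma carrier_R: "carrier R = Ok"
proof (intro equalityI subsetI)
  fix x assume "x \<in> carrier R"
  then obtain p q where "x = of_rat p + of_rat q * csqrt (of_int (- int k))" "algebraic_int x"
    by (auto simp: R_def ring_of_integers_def quadratic_field_def)
  thus "x \<in> Ok" using algebraic_int_imp_Ok unfolding csqrt_k by blast
next
  fix x assume "x \<in> Ok"
  then obtain a b where x: "x = elt a b" by (auto simp: Ok_def)
  have "x = of_rat (of_int a + of_int b / 2) + of_rat (of_int b / 2) * csqrt (of_int (- int k))"
    unfolding x csqrt_k by (simp add: complex_eq_iff elt_def of_rat_add of_rat_divide complex_of_rat)
  hence "x \<in> quadratic_field (- int k)" unfolding quadratic_field_def by blast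
  thus "x \<in> carrier R" using algebraic_int_elt x by (simp add: R_def ring_of_integers_def)
qed

lemma R_simps [simp]:
  "x \<otimes>\<^bsub>R\<^esub> y = x * y" "x \<oplus>\<^bsub>R\<^esub> y = x + y" "\<one>\<^bsub>R\<^esub> = 1" "\<zero>\<^bsub>R\<^esub> = 0"
  by (simp_all add: R_def ring_of_integers_def)

lemma Ok_0: "0 \<in> Ok" and Ok_1: "1 \<in> Ok"
  using Ok_of_int[of 0] Ok_of_int[of 1] by simp_all

lemma ring_R: "ring R"
proof (rule ringI)
  show "abelian_group R"
  proof (rule abelian_groupI)
    fix x assume "x \<in> carrier R"
    hence "0 - x \<in> Ok" unfolding carrier_R by (intro Ok_diff Ok_0)
    thus "\<exists>y\<in>carrier R. y \<oplus>\<^bsub>R\<^esub> x = \<zero>\<^bsub>R\<^esub>" unfolding carrier_R by (intro bexI[of _ "0 - x"]) auto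
  qed (auto simp: carrier_R Ok_add Ok_0)
  show "Group.monoid R"
    by (rule Group.monoidI) (auto simp: carrier_R Ok_mult Ok_1)
qed (auto simp: carrier_R algebra_simps)

lemma ideal_R_iff:
  "ideal I R \<longleftrightarrow> I \<subseteq> Ok \<and> 0 \<in> I \<and> (\<forall>x\<in>I. \<forall>y\<in>I. x + y \<in> I) \<and> (\<forall>x\<in>I. \<forall>r\<in>Ok. r * x \<in> I)"
  (is "_ \<longleftrightarrow> ?rhs")
proof
  assume I: "ideal I R"
  interpret ideal I R by (rule I)
  show ?rhs
    using a_subset additive_subgroup.zero_closed[OF is_additive_subgroup]
      additive_subgroup.a_closed[OF is_additive_subgroup] I_l_closed
    unfolding carrier_R R_simps by auto
next
  assume h: ?rhs
  show "ideal I R"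
  proof (rule idealI[OF ring_R])
    have neg: "- x \<in> I" if "x \<in> I" for x
    proof -
      have "of_int (-1) * x \<in> I" using h that Ok_of_int by blast
      thus ?thesis by simp
    qed
    show "subgroup I (add_monoid R)"
    proof (rule group.subgroupI)
      show "Group.group (add_monoid R)" using ring_R abelian_group.a_group ring.is_abelian_group by blast
      fix a assume a: "a \<in> I"
      have "inv\<^bsub>add_monoid R\<^esub> a = - a"
      proof (rule group.inv_equality)
        show "Group.group (add_monoid R)" using ring_R abelian_group.a_group ring.is_abelian_group by blast
        show "- a \<otimes>\<^bsub>add_monoid R\<^esub> a = \<one>\<^bsub>add_monoid R\<^esub>" by simp
        show "a \<in> carrier (add_monoid R)" "- a \<in> carrier (add_monoid R)"
          using h a neg[OF a] by (auto simp: carrier_R)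
      qed
      thus "inv\<^bsub>add_monoid R\<^esub> a \<in> I" using neg[OF a] by simp
    qed (use h in \<open>auto simp: carrier_R\<close>)
  qed (use h in \<open>auto simp: carrier_R mult.commute\<close>)
qed

end

section \<open>Ideals and ideal classes\<close>

context imaginary_quadratic
begin

definition ideals :: "complex set set" where "ideals = nonzero_ideals R"

lemma ideals_iff:
  "I \<in> ideals \<longleftrightarrow> I \<subseteq> Ok \<and> 0 \<in> I \<and> (\<forall>x\<in>I. \<forall>y\<in>I. x + y \<in> I) \<and> (\<forall>x\<in>I. \<forall>r\<in>Ok. r * x \<in> I) \<and> I \<noteq> {0}"
  unfolding ideals_def nonzero_ideals_def by (simp add: ideal_R_iff)

text \<open>The parameters \<open>(a, b, c)\<close> describe the ideal \<open>c (a \<int> + (b + w) \<int>)\<close> of norm \<open>c\<^sup>2 a\<close>.\<close>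

definition params :: "(nat \<times> int \<times> nat) set" where
  "params = {(a, b, c). a > 0 \<and> c > 0 \<and> b \<in> {0..<int a} \<and> int a dvd b * b + b + N0}"

definition ideal_of :: "nat \<times> int \<times> nat \<Rightarrow> complex set" where
  "ideal_of = (\<lambda>(a, b, c). {of_int (int c) * elt (int a * x + b * y) y | x y. True})"

lemma mem_ideal_of:
  assumes "c > 0"
  shows "elt u v \<in> ideal_of (a, b, c) \<longleftrightarrow> int c dvd v \<and> int c * int a dvd u - v * b"
proof
  assume "elt u v \<in> ideal_of (a, b, c)"
  then obtain x y where "elt u v = elt (int c * (int a * x + b * y)) (int c * y)"
    by (auto simp: ideal_of_def elt_scale simp del: of_int_of_nat_eq)
  hence "u = int c * (int a * x + b * y)" "v = int c * y" by simp_all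
  thus "int c dvd v \<and> int c * int a dvd u - v * b" by (simp add: algebra_simps)
next
  assume "int c dvd v \<and> int c * int a dvd u - v * b"
  then obtain x y where "v = int c * y" "u - v * b = int c * int a * x" unfolding dvd_def by blast
  hence "elt u v = of_int (int c) * elt (int a * x + b * y) y"
    by (simp add: elt_scale algebra_simps del: of_int_of_nat_eq)
  thus "elt u v \<in> ideal_of (a, b, c)" unfolding ideal_of_def by blast
qed

lemma ideal_of_in_ideals:
  assumes "t \<in> params"
  shows "ideal_of t \<in> ideals"
proof -
  obtain a b c where t: "t = (a, b, c)" by (cases t)
  have pos: "a > 0" "c > 0" and dv: "int a dvd b * b + b + N0"
    using assms by (auto simp: params_def t)
  note mem = mem_ideal_of[OF pos(2), of _ _ a b]
  show ?thesis unfolding ideals_iff t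
  proof (intro conjI ballI)
    show "ideal_of (a, b, c) \<subseteq> Ok" by (auto simp: ideal_of_def elt_scale simp del: of_int_of_nat_eq)
    show "0 \<in> ideal_of (a, b, c)" using mem[of 0 0] by (simp add: elt_0_0)
    have "elt (int c * int a) 0 \<in> ideal_of (a, b, c)" using mem by simp
    moreover have "elt (int c * int a) 0 \<noteq> 0" using pos by simp
    ultimately show "ideal_of (a, b, c) \<noteq> {0}" by blast
    fix x assume x: "x \<in> ideal_of (a, b, c)"
    then obtain u v where x': "x = elt u v" using \<open>ideal_of (a, b, c) \<subseteq> Ok\<close> by (auto simp: Ok_def)
    have uv: "int c dvd v" "int c * int a dvd u - v * b" using x mem x' by auto
    {
      fix y assume y: "y \<in> ideal_of (a, b, c)"
      then obtain u' v' where y': "y = elt u' v'" using \<open>ideal_of (a, b, c) \<subseteq> Ok\<close> by (auto simp: Ok_def)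
      have uv': "int c dvd v'" "int c * int a dvd u' - v' * b" using y mem y' by auto
      have "int c * int a dvd (u - v * b) + (u' - v' * b)" using uv uv' by (intro dvd_add)
      hence "int c * int a dvd (u + u') - (v + v') * b" by (simp add: algebra_simps)
      thus "x + y \<in> ideal_of (a, b, c)" using uv uv' mem by (simp add: x' y' elt_add)
    }
    fix r assume "r \<in> Ok"
    then obtain p q where r: "r = elt p q" by (auto simp: Ok_def)
    obtain y where y: "v = int c * y" using uv(1) by blast
    obtain z where z: "u - v * b = int c * int a * z" using uv(2) by blast
    obtain s where s: "b * b + b + N0 = int a * s" using dv by blast
    have u: "u = int c * (int a * z + y * b)" using z y by (simp add: algebra_simps)
    \<comment> \<open>The test of \<open>mem_ideal_of\<close> for the product, arranged so that the
      last term carries the norm of b + w, which a divides.\<close>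
    have "p * u - N0 * q * v - (p * v + q * u + q * v) * b
        = p * (u - v * b) - q * b * (u - v * b) - q * v * (b * b + b + N0)"
      by (simp add: algebra_simps)
    also have "\<dots> = int c * int a * (p * z - q * b * z - q * y * s)"
      unfolding z s unfolding y by (simp add: algebra_simps)
    finally have 1: "int c * int a dvd p * u - N0 * q * v - (p * v + q * u + q * v) * b" by simp
    have 2: "int c dvd p * v + q * u + q * v" using u y by simp
    show "r * x \<in> ideal_of (a, b, c)" unfolding r x' elt_mult using mem 1 2 by blast
  qed
qed

lemma int_subgroup_generator:
  fixes S :: "int set"
  assumes zero: "0 \<in> S" and add: "\<And>x y. x \<in> S \<Longrightarrow> y \<in> S \<Longrightarrow> x + y \<in> S"
    and neg: "\<And>x. x \<in> S \<Longrightarrow> - x \<in> S" and ne: "\<exists>x\<in>S. x \<noteq> 0"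
  obtains g :: nat where "g > 0" "int g \<in> S" "\<And>x. x \<in> S \<Longrightarrow> int g dvd x"
proof -
  have mult: "x * n \<in> S" if "x \<in> S" for x n
  proof -
    have "x * int m \<in> S" for m by (induction m) (use that zero add in \<open>auto simp: distrib_left\<close>)
    from this[of "nat n"] neg[OF this[of "nat (- n)"]] show ?thesis by (cases "n \<ge> 0") auto
  qed
  obtain x where x: "x \<in> S" "x \<noteq> 0" using ne by blast
  have ex: "int (nat \<bar>x\<bar>) \<in> S \<and> nat \<bar>x\<bar> > 0" using x neg[OF x(1)] by (auto simp: abs_if)
  define g where "g = (LEAST g. int g \<in> S \<and> g > 0)"
  have g: "int g \<in> S" "g > 0" using LeastI[of "\<lambda>g. int g \<in> S \<and> g > 0", OF ex] by (simp_all add: g_def)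
  have "int g dvd y" if y: "y \<in> S" for y
  proof -
    have "y mod int g = y + - (int g * (y div int g))" by (simp add: minus_mult_div_eq_mod [symmetric])
    hence m: "y mod int g \<in> S" using add[OF y neg[OF mult[OF g(1)]]] by simp
    have "0 \<le> y mod int g" "y mod int g < int g" using g by simp_all
    hence "nat (y mod int g) < g" by linarith
    hence "\<not> (int (nat (y mod int g)) \<in> S \<and> nat (y mod int g) > 0)" unfolding g_def by (rule not_less_Least)
    hence "y mod int g = 0" using m \<open>0 \<le> y mod int g\<close> by auto
    thus ?thesis by (simp add: dvd_eq_mod_eq_0)
  qed
  thus ?thesis using that g by blast
qed

text \<open>Hermite normal form: n generates the integers in I, and c generates the w-coordinates of
  its elements. Stability under w moves coordinates into w-coordinates and thus makes c divide n and
  the whole second basis vector.\<close>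

lemma ideals_eq_image: "ideals = ideal_of ` params"
proof (intro equalityI subsetI)
  fix I assume "I \<in> ideals"
  hence sub: "I \<subseteq> Ok" and zero: "0 \<in> I" and add: "\<And>x y. x \<in> I \<Longrightarrow> y \<in> I \<Longrightarrow> x + y \<in> I"
    and mult: "\<And>x r. x \<in> I \<Longrightarrow> r \<in> Ok \<Longrightarrow> r * x \<in> I" and ne: "I \<noteq> {0}"
    unfolding ideals_iff by auto
  have neg: "- x \<in> I" if "x \<in> I" for x using mult[OF that Ok_of_int[of "-1"]] by simp
  have elt_neg: "elt (- x) (- y) = - elt x y" for x y by (simp add: elt_def)
  define S where "S = {x. elt x 0 \<in> I}"
  define V where "V = {y. \<exists>x. elt x y \<in> I}"
  obtain x0 y0 where xy0: "elt x0 y0 \<in> I" "(x0, y0) \<noteq> (0, 0)"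
  proof -
    obtain z where "z \<in> I" "z \<noteq> 0" using ne zero by blast
    moreover from this obtain x y where "z = elt x y" using sub by (auto simp: Ok_def)
    ultimately show ?thesis using that[of x y] by auto
  qed
  have timesw: "elt (- N0 * y) (x + y) \<in> I" if "elt x y \<in> I" for x y
  proof -
    have "elt 0 1 * elt x y \<in> I" using mult that by blast
    thus ?thesis by (simp add: elt_mult)
  qed
  obtain n where n: "n > 0" "int n \<in> S" "\<And>x. x \<in> S \<Longrightarrow> int n dvd x"
  proof (rule int_subgroup_generator[of S])
    show "0 \<in> S" using zero by (simp add: S_def elt_0_0)
    show "x + y \<in> S" if "x \<in> S" "y \<in> S" for x y using add[of "elt x 0" "elt y 0"] that by (simp add: S_def elt_add)
    show "- x \<in> S" if "x \<in> S" for x using neg[of "elt x 0"] that elt_neg[of x 0] by (simp add: S_def)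
    \<comment> \<open>Multiplication by the conjugate yields the norm, a nonzero integer in
      I.\<close>
    have "elt (x0 + y0) (- y0) * elt x0 y0 \<in> I" using mult xy0 by blast
    hence "elt (x0 * x0 + x0 * y0 + N0 * (y0 * y0)) 0 \<in> I" by (simp add: elt_mult algebra_simps)
    moreover have "x0 * x0 + x0 * y0 + N0 * (y0 * y0) \<noteq> 0"
    proof
      assume "x0 * x0 + x0 * y0 + N0 * (y0 * y0) = 0"
      hence "4 * (x0 * x0 + x0 * y0) + (4 * N0) * (y0 * y0) = 0" by simp
      hence eq: "(2 * x0 + y0)\<^sup>2 + int k * y0\<^sup>2 = 0" unfolding N0 by (simp add: power2_eq_square algebra_simps)
      have "int k * y0\<^sup>2 \<ge> 0" "(2 * x0 + y0)\<^sup>2 \<ge> 0" by simp_all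
      hence "int k * y0\<^sup>2 = 0" "(2 * x0 + y0)\<^sup>2 = 0" using eq by linarith+
      thus False using xy0(2) k_ge_7 by simp
    qed
    ultimately show "\<exists>x\<in>S. x \<noteq> 0" unfolding S_def by blast
  qed blast
  obtain c where c: "c > 0" "int c \<in> V" "\<And>y. y \<in> V \<Longrightarrow> int c dvd y"
  proof (rule int_subgroup_generator[of V])
    show "0 \<in> V" using zero unfolding V_def by (metis elt_0_0 mem_Collect_eq)
    show "x + y \<in> V" if xy: "x \<in> V" "y \<in> V" for x y
    proof -
      obtain x' y' where "elt x' x \<in> I" "elt y' y \<in> I" using xy by (auto simp: V_def)
      from add[OF this] show ?thesis by (auto simp: V_def elt_add)
    qed
    show "- x \<in> V" if x: "x \<in> V" for x
    proof -
      obtain x' where "elt x' x \<in> I" using x by (auto simp: V_def)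
      from neg[OF this] show ?thesis by (auto simp: V_def elt_neg[symmetric])
    qed
    have "int n \<in> V" using timesw[of "int n" 0] n(2) by (auto simp: S_def V_def)
    thus "\<exists>x\<in>V. x \<noteq> 0" using n(1) by (intro bexI[of _ "int n"]) auto
  qed blast
  have "int n \<in> V" using timesw[of "int n" 0] n(2) by (auto simp: S_def V_def)
  hence "int c dvd int n" by (rule c(3))
  then obtain a where a: "n = c * a" by auto
  have a0: "a > 0" using a n(1) by (cases a) auto
  obtain x1 where x1: "elt x1 (int c) \<in> I" using c(2) by (auto simp: V_def)
  have "x1 + int c \<in> V" using timesw[OF x1] by (auto simp: V_def)
  hence "int c dvd x1 + int c" by (rule c(3))
  hence "int c dvd x1" by simp
  then obtain b1 where b1: "x1 = int c * b1" by blast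
  \<comment> \<open>Reduction modulo a is allowed because c a = n lies in I.\<close>
  define b where "b = b1 mod int a"
  have eb: "elt (int c * b) (int c) \<in> I"
  proof -
    have "of_int (- (b1 div int a)) * elt (int n) 0 \<in> I" using n(2) by (intro mult Ok_of_int) (simp add: S_def)
    hence "elt x1 (int c) + elt (- (b1 div int a) * int n) 0 \<in> I"
      using add[OF x1] by (simp only: elt_scale mult_zero_right)
    also have "elt x1 (int c) + elt (- (b1 div int a) * int n) 0 = elt (x1 - int c * int a * (b1 div int a)) (int c)"
      unfolding elt_add by (simp add: a)
    also have "x1 - int c * int a * (b1 div int a) = int c * b"
      unfolding b1 b_def by (simp add: minus_mult_div_eq_mod[symmetric] right_diff_distrib mult.assoc)
    finally show ?thesis .
  qed
  have dv: "int a dvd b * b + b + N0"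
  proof -
    \<comment> \<open>The conjugate of b + w is b + 1 - w, so this puts c times the norm of b + w
      among the integers of I, where n = c a divides everything.\<close>
    have "elt (b + 1) (-1) * elt (int c * b) (int c) \<in> I" using mult eb by blast
    also have "elt (b + 1) (-1) * elt (int c * b) (int c) = elt (int c * (b * b + b + N0)) 0"
      by (simp add: elt_mult algebra_simps)
    finally have "int n dvd int c * (b * b + b + N0)" using n(3) by (simp add: S_def)
    thus ?thesis using c(1) by (simp add: a)
  qed
  have t: "(a, b, c) \<in> params" using a0 c(1) dv by (simp add: params_def b_def)
  have mem: "elt u v \<in> ideal_of (a, b, c) \<longleftrightarrow> int c dvd v \<and> int c * int a dvd u - v * b" for u v
    by (rule mem_ideal_of[OF c(1)])
  have key: "elt u v \<in> I \<longleftrightarrow> elt u v \<in> ideal_of (a, b, c)" for u v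
  proof -
    have shift: "elt u v \<in> I \<longleftrightarrow> elt (u - v * b) 0 \<in> I" if v: "int c dvd v" for u v
    proof -
      obtain y where y: "v = int c * y" using v by blast
      have "of_int y * elt (int c * b) (int c) \<in> I" by (rule mult[OF eb Ok_of_int])
      hence m: "elt (v * b) v \<in> I" unfolding elt_scale by (simp add: y mult_ac)
      have 1: "elt u v = elt (u - v * b) 0 + elt (v * b) v" by (simp add: elt_add)
      have 2: "elt (u - v * b) 0 = elt u v + - elt (v * b) v" by (simp add: elt_def algebra_simps)
      show ?thesis using add[OF _ m] add[OF _ neg[OF m]] 1 2 by metis
    qed
    show ?thesis
    proof (cases "int c dvd v")
      case True
      have "elt (u - v * b) 0 \<in> I \<longleftrightarrow> int n dvd u - v * b"
      proof
        assume "int n dvd u - v * b"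
        then obtain z where z: "u - v * b = int n * z" by blast
        have "of_int z * elt (int n) 0 \<in> I" using n(2) by (intro mult Ok_of_int) (simp add: S_def)
        thus "elt (u - v * b) 0 \<in> I" unfolding elt_scale z by (simp add: mult.commute)
      qed (use n(3) in \<open>simp add: S_def\<close>)
      thus ?thesis using shift[OF True] mem True by (simp add: a)
    next
      case False
      thus ?thesis using mem c(3) by (auto simp: V_def)
    qed
  qed
  have "I = ideal_of (a, b, c)"
  proof (intro equalityI subsetI)
    fix x assume "x \<in> I" thus "x \<in> ideal_of (a, b, c)" using sub key by (auto simp: Ok_def)
  next
    fix x assume x: "x \<in> ideal_of (a, b, c)"
    have "ideal_of (a, b, c) \<subseteq> Ok" using ideal_of_in_ideals[OF t] by (simp add: ideals_iff)
    thus "x \<in> I" using key x by (auto simp: Ok_def)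
  qed
  thus "I \<in> ideal_of ` params" using t by blast
qed (auto intro: ideal_of_in_ideals)

text \<open>Membership determines c as the generator of the w-coordinates, then c a as that of the
  rational integers, then b modulo a.\<close>

lemma inj_ideal_of: "inj_on ideal_of params"
proof (rule inj_onI)
  fix t t' assume tt: "t \<in> params" "t' \<in> params" "ideal_of t = ideal_of t'"
  obtain a b c a' b' c' where t: "t = (a, b, c)" "t' = (a', b', c')" by (cases t, cases t')
  have pos: "a > 0" "c > 0" "a' > 0" "c' > 0" "0 \<le> b" "b < int a" "0 \<le> b'" "b' < int a'"
    using tt by (auto simp: params_def t)
  have eq: "int c dvd v \<and> int c * int a dvd u - v * b \<longleftrightarrow> int c' dvd v \<and> int c' * int a' dvd u - v * b'" for u v
    using tt(3) mem_ideal_of[OF pos(2)] mem_ideal_of[OF pos(4)] unfolding t by metis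
  have "int c dvd int c'" using eq[of "int c'" "int c' * b'"] by simp
  moreover have "int c' dvd int c" using eq[of "int c" "int c * b"] by simp
  ultimately have cc: "c = c'" by (simp add: dvd_antisym)
  have "int c * int a dvd int c' * int a'" using eq[of 0 "int c' * int a'"] by simp
  moreover have "int c' * int a' dvd int c * int a" using eq[of 0 "int c * int a"] by simp
  ultimately have aa: "a = a'" using cc pos by (simp add: dvd_antisym flip: of_nat_mult)
  have "int c * int a dvd int c * b' - int c * b" using eq[of "int c" "int c * b'"] cc aa by simp
  hence "int c * int a dvd int c * (b' - b)" by (simp add: right_diff_distrib)
  hence "int a dvd b' - b" using pos by simp
  hence "b' mod int a = b mod int a" by (simp add: mod_eq_dvd_iff)
  hence "b = b'" using pos aa by simp
  thus "t = t'" using t aa cc by simp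
qed

end

section \<open>Norms, covolumes and the ideals of one class\<close>

context imaginary_quadratic
begin

text \<open>The index of the ideal in \<open>Ok\<close>, read off the normal form. Its geometric
  meaning is \<open>covolume_basis\<close>: the norm is the covolume in units of sqrt k / 2.\<close>

definition ideal_norm :: "complex set \<Rightarrow> nat" where
  "ideal_norm I = (case the_inv_into params ideal_of I of (a, b, c) \<Rightarrow> c\<^sup>2 * a)"

lemma ideal_norm_ideal_of: "(a, b, c) \<in> params \<Longrightarrow> ideal_norm (ideal_of (a, b, c)) = c\<^sup>2 * a"
  by (simp add: ideal_norm_def the_inv_into_f_f[OF inj_ideal_of])

definition lattice :: "complex \<Rightarrow> complex \<Rightarrow> complex set" where
  "lattice \<alpha> \<beta> = {of_int x * \<alpha> + of_int y * \<beta> | x y. True}"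

text \<open>Area of the parallelogram spanned by \<open>\<alpha>\<close> and
  \<open>\<beta>\<close>.\<close>

definition covolume :: "complex \<Rightarrow> complex \<Rightarrow> real" where
  "covolume \<alpha> \<beta> = \<bar>Im (cnj \<alpha> * \<beta>)\<bar>"

lemma lattice_mem: "\<alpha> \<in> lattice \<alpha> \<beta>" "\<beta> \<in> lattice \<alpha> \<beta>"
proof -
  show "\<alpha> \<in> lattice \<alpha> \<beta>"
    unfolding lattice_def by (rule CollectI, rule exI[of _ 1], rule exI[of _ 0]) simp
  show "\<beta> \<in> lattice \<alpha> \<beta>"
    unfolding lattice_def by (rule CollectI, rule exI[of _ 0], rule exI[of _ 1]) simp
qed

lemma covolume_sublattice:
  assumes "lattice \<alpha>' \<beta>' \<subseteq> lattice \<alpha> \<beta>"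
  obtains m :: nat where "covolume \<alpha>' \<beta>' = real m * covolume \<alpha> \<beta>"
proof -
  obtain p q :: int where \<alpha>': "\<alpha>' = of_int p * \<alpha> + of_int q * \<beta>"
    using subsetD[OF assms lattice_mem(1)] by (auto simp: lattice_def)
  obtain r s :: int where \<beta>': "\<beta>' = of_int r * \<alpha> + of_int s * \<beta>"
    using subsetD[OF assms lattice_mem(2)] by (auto simp: lattice_def)
  have "Im (cnj \<alpha>' * \<beta>') = of_int (p * s - q * r) * Im (cnj \<alpha> * \<beta>)"
    unfolding \<alpha>' \<beta>' by (simp add: algebra_simps)
  hence "covolume \<alpha>' \<beta>' = real (nat \<bar>p * s - q * r\<bar>) * covolume \<alpha> \<beta>"
    by (simp add: covolume_def abs_mult)
  thus ?thesis by (rule that)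
qed

text \<open>Each lattice contains the other, so each area is a natural multiple of the other and
  both factors are 1.\<close>

lemma covolume_unique:
  assumes "lattice \<alpha>' \<beta>' = lattice \<alpha> \<beta>" "covolume \<alpha> \<beta> > 0"
  shows "covolume \<alpha>' \<beta>' = covolume \<alpha> \<beta>"
proof -
  obtain m where m: "covolume \<alpha>' \<beta>' = real m * covolume \<alpha> \<beta>" using covolume_sublattice[of \<alpha>' \<beta>' \<alpha> \<beta>] assms by blast
  obtain n where n: "covolume \<alpha> \<beta> = real n * covolume \<alpha>' \<beta>'" using covolume_sublattice[of \<alpha> \<beta> \<alpha>' \<beta>'] assms by blast
  have "covolume \<alpha> \<beta> = real n * (real m * covolume \<alpha> \<beta>)" using n unfolding m .
  hence "real (n * m) * covolume \<alpha> \<beta> = 1 * covolume \<alpha> \<beta>" by simp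
  hence "real (n * m) = 1" using assms(2) by (subst (asm) mult_cancel_right) simp
  hence "n * m = 1" by (simp only: of_nat_eq_1_iff)
  thus ?thesis using m by simp
qed

lemma covolume_scale: "covolume (\<gamma> * \<alpha>) (\<gamma> * \<beta>) = (cmod \<gamma>)\<^sup>2 * covolume \<alpha> \<beta>"
proof -
  have "cnj (\<gamma> * \<alpha>) * (\<gamma> * \<beta>) = (\<gamma> * cnj \<gamma>) * (cnj \<alpha> * \<beta>)" by (simp add: algebra_simps)
  also have "\<gamma> * cnj \<gamma> = of_real ((cmod \<gamma>)\<^sup>2)" by (rule complex_norm_square[symmetric])
  finally have "Im (cnj (\<gamma> * \<alpha>) * (\<gamma> * \<beta>)) = (cmod \<gamma>)\<^sup>2 * Im (cnj \<alpha> * \<beta>)"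
    by (simp only: times_complex.sel Re_complex_of_real Im_complex_of_real)
  thus ?thesis unfolding covolume_def by (simp only: abs_mult abs_power2)
qed

lemma lattice_scale: "(*) \<gamma> ` lattice \<alpha> \<beta> = lattice (\<gamma> * \<alpha>) (\<gamma> * \<beta>)"
proof -
  have eq: "\<gamma> * (of_int x * \<alpha> + of_int y * \<beta>) = of_int x * (\<gamma> * \<alpha>) + of_int y * (\<gamma> * \<beta>)" for x y
    by (simp add: algebra_simps)
  show ?thesis
  proof (intro equalityI subsetI)
    fix z assume "z \<in> (*) \<gamma> ` lattice \<alpha> \<beta>"
    then obtain x y where "z = \<gamma> * (of_int x * \<alpha> + of_int y * \<beta>)" by (auto simp: lattice_def)
    thus "z \<in> lattice (\<gamma> * \<alpha>) (\<gamma> * \<beta>)" unfolding eq lattice_def by blast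
  next
    fix z assume "z \<in> lattice (\<gamma> * \<alpha>) (\<gamma> * \<beta>)"
    then obtain x y where "z = \<gamma> * (of_int x * \<alpha> + of_int y * \<beta>)" unfolding lattice_def eq by blast
    moreover have "of_int x * \<alpha> + of_int y * \<beta> \<in> lattice \<alpha> \<beta>" unfolding lattice_def by blast
    ultimately show "z \<in> (*) \<gamma> ` lattice \<alpha> \<beta>" by (rule image_eqI)
  qed
qed

definition basis1 :: "nat \<times> int \<times> nat \<Rightarrow> complex" where
  "basis1 = (\<lambda>(a, b, c). elt (int c * int a) 0)"
definition basis2 :: "nat \<times> int \<times> nat \<Rightarrow> complex" where
  "basis2 = (\<lambda>(a, b, c). elt (int c * b) (int c))"

lemma ideal_of_lattice: "ideal_of t = lattice (basis1 t) (basis2 t)"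
proof -
  obtain a b c where t: "t = (a, b, c)" by (cases t)
  have "of_int (int c) * elt (int a * x + b * y) y = of_int x * basis1 t + of_int y * basis2 t" for x y
    by (simp add: t basis1_def basis2_def elt_scale elt_add algebra_simps del: of_int_of_nat_eq)
  thus ?thesis unfolding lattice_def by (simp add: ideal_of_def t)
qed

lemma covolume_basis: "covolume (basis1 (a, b, c)) (basis2 (a, b, c)) = real (c\<^sup>2 * a) * (sqrt (real k) / 2)"
  by (simp add: covolume_def basis1_def basis2_def elt_def power2_eq_square abs_mult)

text \<open>Multiplication by \<open>\<gamma>\<close> scales areas by its squared modulus, and the
  scaled basis spans the same lattice as the normal-form basis of the image.\<close>

lemma ideal_norm_scale:
  assumes I: "I \<in> ideals" and J: "(*) \<gamma> ` I \<in> ideals"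
  shows "real (ideal_norm ((*) \<gamma> ` I)) = (cmod \<gamma>)\<^sup>2 * real (ideal_norm I)"
proof -
  obtain a b c where I': "(a, b, c) \<in> params" "I = ideal_of (a, b, c)"
    using I unfolding ideals_eq_image by auto
  obtain a' b' c' where J': "(a', b', c') \<in> params" "(*) \<gamma> ` I = ideal_of (a', b', c')"
    using J unfolding ideals_eq_image by auto
  have "lattice (\<gamma> * basis1 (a, b, c)) (\<gamma> * basis2 (a, b, c)) = lattice (basis1 (a', b', c')) (basis2 (a', b', c'))"
    using J'(2) unfolding I'(2) ideal_of_lattice lattice_scale .
  moreover have "covolume (basis1 (a', b', c')) (basis2 (a', b', c')) > 0"
    using J'(1) sqrt_k_pos unfolding covolume_basis by (auto simp: params_def intro!: mult_pos_pos)
  ultimately have "covolume (\<gamma> * basis1 (a, b, c)) (\<gamma> * basis2 (a, b, c)) = covolume (basis1 (a', b', c')) (basis2 (a', b', c'))"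
    by (rule covolume_unique)
  hence "(cmod \<gamma>)\<^sup>2 * real (c\<^sup>2 * a) = real (c'\<^sup>2 * a')"
    unfolding covolume_scale covolume_basis using sqrt_k_pos by simp
  thus ?thesis using I' J' ideal_norm_ideal_of by metis
qed

lemma ideal_norm_pos: "I \<in> ideals \<Longrightarrow> ideal_norm I > 0"
  unfolding ideals_eq_image by (auto simp: ideal_norm_ideal_of params_def)

definition class_rel :: "(complex set \<times> complex set) set" where
  "class_rel = ideal_class_rel R"

lemma class_rel_iff:
  "(I, J) \<in> class_rel \<longleftrightarrow> I \<in> ideals \<and> J \<in> ideals \<and>
     (\<exists>\<alpha>\<in>Ok - {0}. \<exists>\<beta>\<in>Ok - {0}. (*) \<alpha> ` I = (*) \<beta> ` J)"
  unfolding class_rel_def ideal_class_rel_def ideals_def by (simp add: carrier_R)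

lemma equiv_class_rel: "equiv ideals class_rel"
proof (rule equivI)
  show "class_rel \<subseteq> ideals \<times> ideals" by (auto simp: class_rel_iff)
  show "refl_on ideals class_rel"
  proof (rule refl_onI)
    fix I assume "I \<in> ideals"
    moreover have "1 \<in> Ok - {0}" using Ok_1 by simp
    ultimately show "(I, I) \<in> class_rel" unfolding class_rel_iff by blast
  qed
  show "sym class_rel"
  proof (rule symI)
    fix I J assume "(I, J) \<in> class_rel"
    then obtain \<alpha> \<beta> where h: "I \<in> ideals" "J \<in> ideals" "\<alpha> \<in> Ok - {0}" "\<beta> \<in> Ok - {0}"
      "(*) \<alpha> ` I = (*) \<beta> ` J" unfolding class_rel_iff by blast
    show "(J, I) \<in> class_rel" unfolding class_rel_iff using h(1-4) h(5)[symmetric] by blast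
  qed
  show "trans class_rel"
  proof (rule transI)
    fix I J L assume IJ: "(I, J) \<in> class_rel" and JL: "(J, L) \<in> class_rel"
    from IJ obtain \<alpha> \<beta> where h1: "I \<in> ideals" "\<alpha> \<in> Ok - {0}" "\<beta> \<in> Ok - {0}"
      "(*) \<alpha> ` I = (*) \<beta> ` J" unfolding class_rel_iff by blast
    from JL obtain \<alpha>' \<beta>' where h2: "L \<in> ideals" "\<alpha>' \<in> Ok - {0}" "\<beta>' \<in> Ok - {0}"
      "(*) \<alpha>' ` J = (*) \<beta>' ` L" unfolding class_rel_iff by blast
    have comp: "(*) (x * y) ` S = (*) x ` (*) y ` S" for x y :: complex and S
      by (simp add: image_image mult.assoc)
    have "(*) (\<alpha>' * \<alpha>) ` I = (*) (\<alpha>' * \<beta>) ` J" unfolding comp h1(4) ..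
    also have "\<dots> = (*) (\<beta> * \<alpha>') ` J" by (simp only: mult.commute)
    also have "\<dots> = (*) (\<beta> * \<beta>') ` L" unfolding comp h2(4) ..
    finally have "(*) (\<alpha>' * \<alpha>) ` I = (*) (\<beta> * \<beta>') ` L" .
    moreover have "\<alpha>' * \<alpha> \<in> Ok - {0}" "\<beta> * \<beta>' \<in> Ok - {0}" using h1 h2 by (simp_all add: Ok_mult)
    ultimately show "(I, L) \<in> class_rel" unfolding class_rel_iff using h1(1) h2(1) by blast
  qed
qed

text \<open>Because \<open>1 - w\<close> is the conjugate of \<open>w\<close>, this is \<open>(x + y (b + cnj w) / a) / c\<close>. These numbers form
  the inverse ideal of \<open>c (a \<int> + (b + w) \<int>)\<close>, so they parametrize the ideals in its class.\<close>

definition multiplier :: "nat \<times> int \<times> nat \<Rightarrow> int \<times> int \<Rightarrow> complex" where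
  "multiplier = (\<lambda>(a, b, c) (x, y). elt (int a * x + y * (b + 1)) (- y) / of_nat (c * a))"

lemma multiplier_ideal:
  assumes t: "t \<in> params" and z: "z \<noteq> (0, 0)"
  shows "(*) (multiplier t z) ` ideal_of t \<in> ideals" "(ideal_of t, (*) (multiplier t z) ` ideal_of t) \<in> class_rel"
proof -
  obtain a b c where t': "t = (a, b, c)" by (cases t)
  obtain x y where z': "z = (x, y)" by (cases z)
  have pos: "a > 0" "c > 0" and dv: "int a dvd b * b + b + N0"
    using t by (auto simp: params_def t')
  obtain s where s: "b * b + b + N0 = int a * s" using dv by blast
  define \<gamma> where "\<gamma> = multiplier t z"
  define \<delta> where "\<delta> = elt (int a * x + y * (b + 1)) (- y)"
  have \<gamma>: "\<gamma> * of_nat (c * a) = \<delta>" using pos by (simp add: \<gamma>_def \<delta>_def multiplier_def t' z')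
  have \<delta>0: "\<delta> \<noteq> 0" using z pos by (auto simp: \<delta>_def z')
  hence \<gamma>0: "\<gamma> \<noteq> 0" using \<gamma> by auto
  have b1: "\<gamma> * basis1 t = \<delta>" using \<gamma> by (simp add: t' basis1_def elt_def)
  \<comment> \<open>The norm of b + w is a s, so multiplying \<open>\<delta>\<close> by b + w
    produces a factor a that cancels the denominator: both basis vectors are carried into
    \<open>Ok\<close>.\<close>
  have b2: "\<gamma> * basis2 t = elt (b * x + s * y) x"
  proof -
    have "\<delta> * elt b 1 = of_int (int a) * elt (b * x + s * y) x"
    proof -
      have "(int a * x + y * (b + 1)) * b - N0 * (- y) * 1 = int a * (b * x) + y * (b * b + b + N0)"
        by (simp add: algebra_simps)
      also have "\<dots> = int a * (b * x + s * y)" unfolding s by (simp add: algebra_simps)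
      finally have 1: "(int a * x + y * (b + 1)) * b - N0 * (- y) * 1 = int a * (b * x + s * y)" .
      have 2: "(int a * x + y * (b + 1)) * 1 + - y * b + - y * 1 = int a * x" by (simp add: algebra_simps)
      show ?thesis unfolding \<delta>_def elt_mult elt_scale elt_eq_iff using 1 2 by blast
    qed
    moreover have "basis2 t = of_int (int c) * elt b 1" by (simp add: t' basis2_def elt_scale del: of_int_of_nat_eq)
    ultimately have "of_nat a * (\<gamma> * basis2 t) = of_nat a * elt (b * x + s * y) x"
      unfolding \<gamma>[symmetric] by (simp add: mult_ac)
    thus ?thesis using pos by simp
  qed
  have sub: "(*) \<gamma> ` ideal_of t \<subseteq> Ok"
  proof -
    have "of_int u * (\<gamma> * basis1 t) + of_int v * (\<gamma> * basis2 t) \<in> Ok" for u v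
      unfolding b1 b2 \<delta>_def by (intro Ok_add Ok_mult Ok_of_int OkI)
    thus ?thesis unfolding ideal_of_lattice lattice_scale unfolding lattice_def
      by (intro subsetI) (elim CollectE exE conjE, simp only:)
  qed
  have I: "ideal_of t \<in> ideals" using t ideal_of_in_ideals by blast
  show J: "(*) (multiplier t z) ` ideal_of t \<in> ideals"
    unfolding \<gamma>_def[symmetric] ideals_iff
  proof (intro conjI ballI)
    show "(*) \<gamma> ` ideal_of t \<subseteq> Ok" by (rule sub)
    show "0 \<in> (*) \<gamma> ` ideal_of t" using I unfolding ideals_iff by (metis image_eqI mult_zero_right)
    obtain v where "v \<in> ideal_of t" "v \<noteq> 0" using I unfolding ideals_iff by blast
    hence "\<gamma> * v \<in> (*) \<gamma> ` ideal_of t" "\<gamma> * v \<noteq> 0" using \<gamma>0 by simp_all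
    thus "(*) \<gamma> ` ideal_of t \<noteq> {0}" by blast
    fix u assume "u \<in> (*) \<gamma> ` ideal_of t"
    then obtain u' where u': "u = \<gamma> * u'" "u' \<in> ideal_of t" by blast
    {
      fix v assume "v \<in> (*) \<gamma> ` ideal_of t"
      then obtain v' where v': "v = \<gamma> * v'" "v' \<in> ideal_of t" by blast
      have "u' + v' \<in> ideal_of t" using I u' v' unfolding ideals_iff by blast
      thus "u + v \<in> (*) \<gamma> ` ideal_of t" using u' v' by (metis distrib_left image_eqI)
    }
    fix r assume "r \<in> Ok"
    hence "r * u' \<in> ideal_of t" using I u' unfolding ideals_iff by blast
    thus "r * u \<in> (*) \<gamma> ` ideal_of t" using u' by (metis image_eqI mult.left_commute)
  qed
  have "(*) \<delta> ` ideal_of t = (*) (of_nat (c * a)) ` (*) \<gamma> ` ideal_of t"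
    unfolding \<gamma>[symmetric] by (simp add: image_image mult_ac)
  moreover have "of_nat (c * a) \<in> Ok - {0}" using Ok_of_int[of "int (c * a)"] pos by simp
  moreover have "\<delta> \<in> Ok - {0}" using \<delta>0 by (auto simp: \<delta>_def)
  ultimately have "\<exists>\<alpha>\<in>Ok - {0}. \<exists>\<beta>\<in>Ok - {0}. (*) \<alpha> ` ideal_of t = (*) \<beta> ` (*) \<gamma> ` ideal_of t"
    by (intro bexI)
  thus "(ideal_of t, (*) (multiplier t z) ` ideal_of t) \<in> class_rel"
    unfolding class_rel_iff \<gamma>_def[symmetric] using I J[folded \<gamma>_def] by (intro conjI)
qed

text \<open>J is \<open>\<gamma>\<close> times the ideal for a quotient \<open>\<gamma>\<close>.
  Integrality on the first basis vector gives c a \<open>\<gamma>\<close> = p + q w, and integrality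
  on the second forces p = -q (b + 1) modulo a, which is the shape of a multiplier.\<close>

lemma multiplier_surj:
  assumes t: "t \<in> params" and J: "(ideal_of t, J) \<in> class_rel"
  obtains z where "z \<noteq> (0, 0)" "J = (*) (multiplier t z) ` ideal_of t"
proof -
  obtain a b c where t': "t = (a, b, c)" by (cases t)
  have pos: "a > 0" "c > 0" and dv: "int a dvd b * b + b + N0"
    using t by (auto simp: params_def t')
  obtain \<alpha> \<beta> where \<alpha>\<beta>: "\<alpha> \<in> Ok - {0}" "\<beta> \<in> Ok - {0}" "(*) \<alpha> ` ideal_of t = (*) \<beta> ` J"
    and JI: "J \<in> ideals" using J unfolding class_rel_iff by blast
  define \<gamma> where "\<gamma> = \<alpha> / \<beta>"
  have \<gamma>0: "\<gamma> \<noteq> 0" using \<alpha>\<beta> by (simp add: \<gamma>_def)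
  have "(*) \<gamma> ` ideal_of t = (*) (inverse \<beta>) ` (*) \<alpha> ` ideal_of t"
    by (simp add: image_image \<gamma>_def divide_inverse mult_ac)
  also have "\<dots> = J" unfolding \<alpha>\<beta>(3) using \<alpha>\<beta>(2) by (simp add: image_image flip: mult.assoc)
  finally have J': "J = (*) \<gamma> ` ideal_of t" ..
  have sub: "J \<subseteq> Ok" using JI by (simp add: ideals_iff)
  have "\<gamma> * basis1 t \<in> Ok" "\<gamma> * basis2 t \<in> Ok"
    using sub lattice_mem unfolding J' ideal_of_lattice by blast+
  then obtain p q p' q' where pq: "\<gamma> * basis1 t = elt p q" "\<gamma> * basis2 t = elt p' q'" by (auto simp: Ok_def)
  have "of_nat a * basis2 t = elt b 1 * basis1 t"
    by (simp add: t' basis1_def basis2_def elt_def algebra_simps)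
  hence "of_int (int a) * (\<gamma> * basis2 t) = elt b 1 * (\<gamma> * basis1 t)" by (simp add: mult_ac)
  hence "elt (int a * p') (int a * q') = elt (b * p - N0 * q) (b * q + p + q)"
    unfolding pq elt_scale elt_mult by simp
  hence "b * q + p + q = int a * q'" by simp
  hence p: "p = int a * q' + (- q) * (b + 1)" by (simp add: algebra_simps)
  have "\<gamma> * of_nat (c * a) = elt p q" using pq(1) by (simp add: t' basis1_def elt_def)
  hence "\<gamma> = multiplier t (q', - q)" using pos p by (simp add: multiplier_def t' field_simps)
  moreover have "(q', - q) \<noteq> (0, 0)"
  proof
    assume "(q', - q) = (0, 0)"
    hence "\<gamma> * of_nat (c * a) = 0" using \<open>\<gamma> * of_nat (c * a) = elt p q\<close> p by simp
    thus False using \<gamma>0 pos by simp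
  qed
  ultimately show ?thesis using that J' by blast
qed

lemma multiplier_minus: "multiplier t (- x, - y) = - multiplier t (x, y)"
proof -
  obtain a b c where t': "t = (a, b, c)" by (cases t)
  have "elt (int a * - x + - y * (b + 1)) (- (- y)) = - elt (int a * x + y * (b + 1)) (- y)"
    by (simp add: elt_def algebra_simps)
  thus ?thesis by (simp only: multiplier_def t' prod.case minus_divide_left)
qed

lemma multiplier_inj:
  assumes t: "t \<in> params" and eq: "multiplier t z = multiplier t z'"
  shows "z = z'"
proof -
  obtain a b c where t': "t = (a, b, c)" by (cases t)
  have pos: "a > 0" "c > 0" using t by (auto simp: params_def t')
  show ?thesis using eq pos by (cases z, cases z') (auto simp: multiplier_def t')
qed

text \<open>Comparing norms gives modulus 1, and stability of the lattice gives integrality. For u =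
  p + q w this means (2 p + q)^2 + k q^2 = 4, so q = 0 because k > 4.\<close>

lemma ideal_unit:
  assumes t: "t \<in> params" and eq: "(*) u ` ideal_of t = ideal_of t"
  shows "u = 1 \<or> u = -1"
proof -
  obtain a b c where t': "t = (a, b, c)" by (cases t)
  have pos: "a > 0" "c > 0" using t by (auto simp: params_def t')
  have I: "ideal_of t \<in> ideals" using t ideal_of_in_ideals by blast
  have "real (ideal_norm (ideal_of t)) = (cmod u)\<^sup>2 * real (ideal_norm (ideal_of t))"
    using ideal_norm_scale[OF I, of u] I unfolding eq by blast
  hence u1: "(cmod u)\<^sup>2 = 1" using ideal_norm_pos[OF I] by simp
  have ne: "basis1 t \<noteq> basis2 t" using pos by (simp add: t' basis1_def basis2_def)
  have b10: "basis1 t \<noteq> 0" using pos by (simp add: t' basis1_def)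
  have au: "algebraic_int u"
  proof (rule algebraic_int_if_stable_span[of "{basis1 t, basis2 t}"])
    fix s assume "s \<in> {basis1 t, basis2 t}"
    hence "u * s \<in> ideal_of t" using eq lattice_mem unfolding ideal_of_lattice by blast
    then obtain x y where xy: "u * s = of_int x * basis1 t + of_int y * basis2 t"
      unfolding ideal_of_lattice lattice_def by blast
    show "\<exists>c :: complex \<Rightarrow> int. u * s = (\<Sum>r\<in>{basis1 t, basis2 t}. of_int (c r) * r)"
      by (rule exI[of _ "\<lambda>r. if r = basis1 t then x else y"]) (use xy ne in auto)
  qed (use b10 in auto)
  have "u * basis1 t \<in> Ok"
    using eq lattice_mem I unfolding ideals_iff ideal_of_lattice by blast
  then obtain x y where "u * basis1 t = elt x y" by (auto simp: Ok_def)
  hence "u * of_nat (c * a) = elt x y" by (simp add: t' basis1_def elt_def)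
  hence u: "u = elt x y / of_nat (c * a)" using pos by (simp add: field_simps)
  have "u = of_rat ((of_int x + of_int y / 2) / of_nat (c * a)) + of_rat (of_int y / 2 / of_nat (c * a)) * (\<i> * of_real (sqrt (real k)))"
    unfolding u by (simp add: complex_eq_iff elt_def of_rat_add of_rat_divide of_rat_mult complex_of_rat)
  hence "u \<in> Ok" using algebraic_int_imp_Ok au by metis
  then obtain p q where pq: "u = elt p q" by (auto simp: Ok_def)
  have "(cmod u)\<^sup>2 = (of_int p + of_int q / 2)\<^sup>2 + (of_int q * sqrt (real k) / 2)\<^sup>2"
    unfolding pq cmod_power2 Re_elt Im_elt ..
  also have "\<dots> = ((2 * of_int p + of_int q)\<^sup>2 + real k * (of_int q)\<^sup>2) / 4"
    by (simp add: power_mult_distrib power_divide field_simps power2_eq_square)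
  also have "\<dots> = of_int ((2 * p + q)\<^sup>2 + int k * q\<^sup>2) / 4" by simp
  finally have "of_int ((2 * p + q)\<^sup>2 + int k * q\<^sup>2) = (of_int 4 :: real)" using u1 by simp
  hence e4: "(2 * p + q)\<^sup>2 + int k * q\<^sup>2 = 4" by (simp only: of_int_eq_iff)
  have q0: "q = 0"
  proof (rule ccontr)
    assume "q \<noteq> 0"
    hence "q\<^sup>2 \<ge> 1" by (simp add: power2_eq_square int_one_le_iff_zero_less zero_less_mult_iff) linarith
    hence "int k * q\<^sup>2 \<ge> int k * 1" by (intro mult_left_mono) auto
    moreover have "(2 * p + q)\<^sup>2 \<ge> 0" by simp
    ultimately show False using e4 k_ge_7 by linarith
  qed
  hence "p\<^sup>2 = 1" using e4 by (simp add: power_mult_distrib)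
  hence "p = 1 \<or> p = -1" by (simp add: power2_eq_1_iff)
  thus ?thesis using pq q0 by (auto simp: elt_def)
qed

text \<open>One representative of each pair z, -z of nonzero integer vectors, since opposite
  multipliers give the same ideal.\<close>

definition half_plane :: "(int \<times> int) set" where
  "half_plane = {(x, y). y > 0 \<or> y = 0 \<and> x > 0}"

text \<open>The ideals of a class are the multiples of a fixed member by multipliers up to sign.
  Their norms are values of a positive definite form of discriminant -k, whose middle coefficient is
  2 b + 1 in terms of the normal form.\<close>

lemma class_parametrization:
  assumes C: "C \<in> ideals // class_rel"
  obtains a b c :: int and \<phi> where "a > 0" "4 * a * c = b\<^sup>2 + int k" "bij_betw \<phi> half_plane C"
    "\<And>x y. (x, y) \<in> half_plane \<Longrightarrow> int (ideal_norm (\<phi> (x, y))) = a * x\<^sup>2 + b * x * y + c * y\<^sup>2"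
proof -
  obtain I where I: "I \<in> ideals" "C = class_rel `` {I}" using C by (rule quotientE)
  obtain t where t: "t \<in> params" "I = ideal_of t" using I unfolding ideals_eq_image by blast
  obtain a b c where t': "t = (a, b, c)" by (cases t)
  have pos: "a > 0" "c > 0" and dv: "int a dvd b * b + b + N0" and t'': "(a, b, c) \<in> params"
    using t by (auto simp: params_def t')
  obtain s where s: "b * b + b + N0 = int a * s" using dv by blast
  define \<phi> where "\<phi> = (\<lambda>z. (*) (multiplier t z) ` ideal_of t)"
  have nz: "z \<noteq> (0, 0)" if "z \<in> half_plane" for z using that by (auto simp: half_plane_def)
  have "bij_betw \<phi> half_plane C"
  proof (rule bij_betw_imageI)
    show "inj_on \<phi> half_plane"
    proof (rule inj_onI)
      fix z z' assume z: "z \<in> half_plane" "z' \<in> half_plane" "\<phi> z = \<phi> z'"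
      define g where "g = multiplier t z"
      define g' where "g' = multiplier t z'"
      have "multiplier t (0, 0) = 0" by (simp add: multiplier_def t')
      hence g0: "g' \<noteq> 0" using multiplier_inj[OF t(1), of z' "(0, 0)"] nz[OF z(2)] by (auto simp: g'_def)
      \<comment> \<open>The quotient of two multipliers with the same image stabilizes the ideal,
        hence is a sign, and the half plane rules out -1.\<close>
      have "(*) (g / g') ` ideal_of t = (*) (inverse g') ` (*) g ` ideal_of t"
        by (simp add: image_image divide_inverse mult_ac)
      also have "(*) g ` ideal_of t = (*) g' ` ideal_of t" using z(3) by (simp add: \<phi>_def g_def g'_def)
      also have "(*) (inverse g') ` (*) g' ` ideal_of t = ideal_of t"
        using g0 by (simp add: image_image flip: mult.assoc)
      finally have "g / g' = 1 \<or> g / g' = -1" by (rule ideal_unit[OF t(1)])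
      hence "g = g' \<or> g = - g'" using g0 by (auto simp: field_simps)
      thus "z = z'"
      proof
        assume "g = g'" thus ?thesis using multiplier_inj[OF t(1)] by (simp add: g_def g'_def)
      next
        assume "g = - g'"
        obtain x' y' where z': "z' = (x', y')" by (cases z')
        have "multiplier t z = multiplier t (- x', - y')"
          using \<open>g = - g'\<close> unfolding g_def g'_def z' multiplier_minus .
        hence "z = (- x', - y')" by (rule multiplier_inj[OF t(1)])
        thus ?thesis using z(1,2) z' by (auto simp: half_plane_def)
      qed
    qed
    show "\<phi> ` half_plane = C"
    proof (intro equalityI subsetI)
      fix J assume "J \<in> \<phi> ` half_plane"
      thus "J \<in> C" using multiplier_ideal(2)[OF t(1)] nz unfolding I(2) t(2) \<phi>_def by blast
    next
      fix J assume "J \<in> C"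
      hence "(ideal_of t, J) \<in> class_rel" unfolding I(2) t(2) by simp
      then obtain z where z: "z \<noteq> (0, 0)" "J = (*) (multiplier t z) ` ideal_of t"
        by (rule multiplier_surj[OF t(1)])
      obtain x y where xy: "z = (x, y)" by (cases z)
      show "J \<in> \<phi> ` half_plane"
      proof (cases "(x, y) \<in> half_plane")
        case True thus ?thesis using z xy unfolding \<phi>_def by blast
      next
        case False
        hence m: "(- x, - y) \<in> half_plane" using z xy by (auto simp: half_plane_def)
        have neg: "uminus ` ideal_of t = ideal_of t"
        proof -
          have cl: "- v \<in> ideal_of t" if "v \<in> ideal_of t" for v
          proof -
            have "of_int (-1) * v \<in> ideal_of t"
              using ideal_of_in_ideals[OF t(1)] that Ok_of_int unfolding ideals_iff by blast
            thus ?thesis by simp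
          qed
          show ?thesis
          proof (intro equalityI subsetI)
            fix v assume "v \<in> ideal_of t"
            thus "v \<in> uminus ` ideal_of t" using cl by (intro image_eqI[of v uminus "- v"]) auto
          qed (use cl in auto)
        qed
        have "\<phi> (- x, - y) = (*) (multiplier t (x, y)) ` uminus ` ideal_of t"
          unfolding \<phi>_def multiplier_minus by (simp add: image_image)
        hence "\<phi> (- x, - y) = J" unfolding neg z(2) xy .
        thus ?thesis using m by blast
      qed
    qed
  qed
  moreover have "int (ideal_norm (\<phi> (x, y))) = int a * x\<^sup>2 + (2 * b + 1) * x * y + s * y\<^sup>2"
    if xy: "(x, y) \<in> half_plane" for x y
  proof -
    have nrm: "ideal_norm (ideal_of t) = c\<^sup>2 * a" unfolding t' by (rule ideal_norm_ideal_of[OF t''])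
    have "real (ideal_norm (\<phi> (x, y))) = (cmod (multiplier t (x, y)))\<^sup>2 * real (c\<^sup>2 * a)"
      unfolding nrm[symmetric] \<phi>_def
      by (rule ideal_norm_scale[OF _ multiplier_ideal(1)[OF t(1) nz[OF xy]]]) (use I t in simp)
    also have "(cmod (multiplier t (x, y)))\<^sup>2 = (cmod (elt (int a * x + y * (b + 1)) (- y)))\<^sup>2 / (real (c * a))\<^sup>2"
      unfolding multiplier_def t' by (simp add: norm_divide power_divide del: of_nat_mult)
    also have "(cmod (elt (int a * x + y * (b + 1)) (- y)))\<^sup>2 =
        (of_int (int a * x + y * (b + 1)) - of_int y / 2)\<^sup>2 + (of_int y * sqrt (real k) / 2)\<^sup>2"
      unfolding cmod_power2 Re_elt Im_elt by simp
    also have "\<dots> = ((real a * of_int x + of_int y * of_int b + of_int y / 2)\<^sup>2 + real k * (of_int y)\<^sup>2 / 4)"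
      by (simp add: power_mult_distrib power_divide algebra_simps)
    also have "\<dots> = real a * of_int (int a * x\<^sup>2 + (2 * b + 1) * x * y + s * y\<^sup>2)"
    proof -
      have "real k = of_int (4 * N0 - 1)" using N0 by simp
      hence k: "real k / 4 = of_int N0 - 1 / 4" by simp
      have "real a * of_int s = of_int (b * b + b + N0)" unfolding s by simp
      hence "of_int N0 = real a * of_int s - of_int b * of_int b - of_int b" by simp
      hence k': "real k / 4 = real a * of_int s - of_int b * of_int b - of_int b - 1 / 4" using k by simp
      have "real k * (of_int y)\<^sup>2 / 4 = (real k / 4) * (of_int y)\<^sup>2" by simp
      thus ?thesis unfolding k' by (simp add: power2_eq_square algebra_simps)
    qed
    also have "real a * of_int (int a * x\<^sup>2 + (2 * b + 1) * x * y + s * y\<^sup>2) / (real (c * a))\<^sup>2 * real (c\<^sup>2 * a) =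
        of_int (int a * x\<^sup>2 + (2 * b + 1) * x * y + s * y\<^sup>2)"
      using pos by (simp add: power2_eq_square field_simps del: of_int_add of_int_mult)
    finally have "(of_int (int (ideal_norm (\<phi> (x, y)))) :: real) = of_int (int a * x\<^sup>2 + (2 * b + 1) * x * y + s * y\<^sup>2)"
      by simp
    thus ?thesis by (simp only: of_int_eq_iff)
  qed
  moreover have "4 * int a * s = (2 * b + 1)\<^sup>2 + int k"
  proof -
    have "4 * int a * s = 4 * (b * b + b + N0)" unfolding s by simp
    also have "\<dots> = 4 * (b * b + b) + 4 * N0" by simp
    finally show ?thesis unfolding N0 by (simp add: power2_eq_square algebra_simps)
  qed
  ultimately show ?thesis using that[of "int a" s "2 * b + 1" \<phi>] pos by simp
qed

end

section \<open>Euler--Maclaurin summation and theta series\<close>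

lemma taylor_order_2:
  fixes F f g :: "real \<Rightarrow> real"
  assumes "\<And>x. (F has_real_derivative f x) (at x)" "\<And>x. (f has_real_derivative g x) (at x)"
    and h: "h > 0"
  obtains \<xi> where "a < \<xi>" "\<xi> < a + h" "F (a + h) = F a + f a * h + g \<xi> * h\<^sup>2 / 2"
proof -
  define d where "d = (\<lambda>m::nat. if m = 0 then F else if m = 1 then f else g)"
  have "\<exists>t>a. t < a + h \<and> F (a + h) = (\<Sum>m<2. d m a / fact m * (a + h - a) ^ m) + d 2 t / fact 2 * (a + h - a)\<^sup>2"
  proof (rule Taylor_up)
    show "\<forall>m t. m < 2 \<and> a \<le> t \<and> t \<le> a + h \<longrightarrow> (d m has_real_derivative d (Suc m) t) (at t)"
      using assms by (auto simp: d_def less_2_cases_iff)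
  qed (use h in \<open>auto simp: d_def\<close>)
  thus ?thesis using that by (auto simp: d_def numeral_2_eq_2 lessThan_Suc)
qed

lemma taylor_order_3:
  fixes F f g k :: "real \<Rightarrow> real"
  assumes "\<And>x. (F has_real_derivative f x) (at x)" "\<And>x. (f has_real_derivative g x) (at x)"
    "\<And>x. (g has_real_derivative k x) (at x)"
    and h: "h > 0"
  obtains \<xi> where "a < \<xi>" "\<xi> < a + h" "F (a + h) = F a + f a * h + g a * h\<^sup>2 / 2 + k \<xi> * h ^ 3 / 6"
proof -
  define d where "d = (\<lambda>m::nat. if m = 0 then F else if m = 1 then f else if m = 2 then g else k)"
  have "\<exists>t>a. t < a + h \<and> F (a + h) = (\<Sum>m<3. d m a / fact m * (a + h - a) ^ m) + d 3 t / fact 3 * (a + h - a) ^ 3"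
  proof (rule Taylor_up)
    show "\<forall>m t. m < 3 \<and> a \<le> t \<and> t \<le> a + h \<longrightarrow> (d m has_real_derivative d (Suc m) t) (at t)"
    proof (intro allI impI)
      fix m :: nat and t assume "m < 3 \<and> a \<le> t \<and> t \<le> a + h"
      hence "m = 0 \<or> m = 1 \<or> m = 2" by linarith
      thus "(d m has_real_derivative d (Suc m) t) (at t)" using assms by (auto simp: d_def)
    qed
  qed (use h in \<open>auto simp: d_def\<close>)
  thus ?thesis using that by (auto simp: d_def numeral_3_eq_3 numeral_2_eq_2 lessThan_Suc fact_numeral)
qed

lemma taylor_order_4:
  fixes F f g k l :: "real \<Rightarrow> real"
  assumes "\<And>x. (F has_real_derivative f x) (at x)" "\<And>x. (f has_real_derivative g x) (at x)"
    "\<And>x. (g has_real_derivative k x) (at x)" "\<And>x. (k has_real_derivative l x) (at x)"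
    and h: "h > 0"
  obtains \<xi> where "a < \<xi>" "\<xi> < a + h"
    "F (a + h) = F a + f a * h + g a * h\<^sup>2 / 2 + k a * h ^ 3 / 6 + l \<xi> * h ^ 4 / 24"
proof -
  define d where "d = (\<lambda>m::nat. if m = 0 then F else if m = 1 then f else if m = 2 then g else if m = 3 then k else l)"
  have "\<exists>t>a. t < a + h \<and> F (a + h) = (\<Sum>m<4. d m a / fact m * (a + h - a) ^ m) + d 4 t / fact 4 * (a + h - a) ^ 4"
  proof (rule Taylor_up)
    show "\<forall>m t. m < 4 \<and> a \<le> t \<and> t \<le> a + h \<longrightarrow> (d m has_real_derivative d (Suc m) t) (at t)"
    proof (intro allI impI)
      fix m :: nat and t assume "m < 4 \<and> a \<le> t \<and> t \<le> a + h"
      hence "m = 0 \<or> m = 1 \<or> m = 2 \<or> m = 3" by linarith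
      thus "(d m has_real_derivative d (Suc m) t) (at t)" using assms by (auto simp: d_def)
    qed
  qed (use h in \<open>auto simp: d_def\<close>)
  thus ?thesis using that by (auto simp: d_def eval_nat_numeral lessThan_Suc fact_numeral)
qed

text \<open>Within distance 1 the values of 1 + x^2 differ at most by a factor 3. Local errors of
  size C / (1 + x^2) thus become increments of arctan, whose sum telescopes and stays bounded on the
  whole line.\<close>

lemma arctan_increment:
  fixes x \<xi> h :: real
  assumes h: "0 < h" "h \<le> 1" and \<xi>: "x < \<xi>" "\<xi> < x + h"
  shows "h / (1 + \<xi>\<^sup>2) \<le> 3 * (arctan (x + h) - arctan x)"
proof -
  have "\<exists>z. x < z \<and> z < x + h \<and> arctan (x + h) - arctan x = (x + h - x) * (inverse (1 + z\<^sup>2))"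
    by (rule MVT2) (use h in \<open>auto intro!: derivative_eq_intros\<close>)
  then obtain z where z: "x < z" "z < x + h" "arctan (x + h) - arctan x = h / (1 + z\<^sup>2)"
    by (auto simp: divide_inverse)
  have "\<bar>z - \<xi>\<bar> \<le> 1" using z \<xi> h by linarith
  hence "(z - \<xi>)\<^sup>2 \<le> 1" by (simp add: abs_square_le_1)
  moreover have "z\<^sup>2 = \<xi>\<^sup>2 + 2 * \<xi> * (z - \<xi>) + (z - \<xi>)\<^sup>2" by (simp add: power2_eq_square algebra_simps)
  moreover have "2 * \<xi> * (z - \<xi>) \<le> \<xi>\<^sup>2 + (z - \<xi>)\<^sup>2"
    using sum_squares_bound[of \<xi> "z - \<xi>"] by simp
  ultimately have "1 + z\<^sup>2 \<le> 3 * (1 + \<xi>\<^sup>2)" by (smt (verit) zero_le_power2)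
  moreover have "1 + z\<^sup>2 > 0" "1 + \<xi>\<^sup>2 > 0" by (simp_all add: add_pos_nonneg)
  ultimately have le: "h / (3 * (1 + \<xi>\<^sup>2)) \<le> h / (1 + z\<^sup>2)" using h by (intro divide_left_mono) auto
  have "h / q = 3 * (h / (3 * q))" for q :: real by simp
  hence "h / (1 + \<xi>\<^sup>2) = 3 * (h / (3 * (1 + \<xi>\<^sup>2)))" .
  also have "\<dots> \<le> 3 * (h / (1 + z\<^sup>2))" using le by (rule mult_left_mono) simp
  finally show ?thesis unfolding z(3) .
qed

text \<open>The coefficients 1/2 and 1/12 cancel all Taylor terms at \<open>a\<close> up to h^3.
  What remains are third derivatives with weights 1/24, 1/12, 1/24; with the factor 3 of
  \<open>arctan_increment\<close> they add up to 1/2, below the stated 1.\<close>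

lemma euler_maclaurin_step:
  fixes F f f1 f2 f3 :: "real \<Rightarrow> real"
  assumes F: "\<And>x. (F has_real_derivative f x) (at x)" and f: "\<And>x. (f has_real_derivative f1 x) (at x)"
    and f1: "\<And>x. (f1 has_real_derivative f2 x) (at x)" and f2: "\<And>x. (f2 has_real_derivative f3 x) (at x)"
    and bound: "\<And>x. \<bar>f3 x\<bar> \<le> C / (1 + x\<^sup>2)" and h: "0 < h" "h \<le> 1"
  shows "\<bar>F (a + h) - F a - h / 2 * (f a + f (a + h)) + h\<^sup>2 / 12 * (f1 (a + h) - f1 a)\<bar>
      \<le> C * h ^ 3 * (arctan (a + h) - arctan a)"
proof -
  obtain x where x: "a < x" "x < a + h"
    "F (a + h) = F a + f a * h + f1 a * h\<^sup>2 / 2 + f2 a * h ^ 3 / 6 + f3 x * h ^ 4 / 24"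
    using taylor_order_4[OF F f f1 f2 h(1)] by blast
  obtain y where y: "a < y" "y < a + h" "f (a + h) = f a + f1 a * h + f2 a * h\<^sup>2 / 2 + f3 y * h ^ 3 / 6"
    using taylor_order_3[OF f f1 f2 h(1)] by blast
  obtain z where z: "a < z" "z < a + h" "f1 (a + h) = f1 a + f2 a * h + f3 z * h\<^sup>2 / 2"
    using taylor_order_2[OF f1 f2 h(1)] by blast
  define D where "D = arctan (a + h) - arctan a"
  have C0: "C \<ge> 0" using bound[of 0] by simp
  have b: "\<bar>h * f3 u\<bar> \<le> 3 * C * D" if "a < u" "u < a + h" for u
  proof -
    have "\<bar>h * f3 u\<bar> \<le> h * (C / (1 + u\<^sup>2))" using mult_left_mono[OF bound[of u], of h] h by (simp add: abs_mult)
    also have "\<dots> = C * (h / (1 + u\<^sup>2))" by simp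
    also have "\<dots> \<le> C * (3 * D)" using arctan_increment[OF h that] C0 unfolding D_def by (intro mult_left_mono)
    finally show ?thesis by simp
  qed
  have "F (a + h) - F a - h / 2 * (f a + f (a + h)) + h\<^sup>2 / 12 * (f1 (a + h) - f1 a) =
     h ^ 3 * ((h * f3 x) / 24 - (h * f3 y) / 12 + (h * f3 z) / 24)"
    unfolding x(3) y(3) z(3) by (simp add: field_simps power2_eq_square power3_eq_cube power4_eq_xxxx)
  also have "\<bar>\<dots>\<bar> = h ^ 3 * \<bar>(h * f3 x) / 24 - (h * f3 y) / 12 + (h * f3 z) / 24\<bar>"
    using h by (simp add: abs_mult)
  also have "\<dots> \<le> h ^ 3 * (C * D)"
  proof (rule mult_left_mono)
    have "C * D \<ge> 0" using C0 h unfolding D_def by (intro mult_nonneg_nonneg) (auto simp: arctan_le_iff)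
    thus "\<bar>(h * f3 x) / 24 - (h * f3 y) / 12 + (h * f3 z) / 24\<bar> \<le> C * D"
      using b[OF x(1,2)] b[OF y(1,2)] b[OF z(1,2)] by (simp add: abs_le_iff)
  qed (use h in auto)
  finally show ?thesis by (simp add: D_def mult_ac)
qed

lemma euler_maclaurin_sum:
  fixes F f f1 f2 f3 :: "real \<Rightarrow> real"
  assumes F: "\<And>x. (F has_real_derivative f x) (at x)" and f: "\<And>x. (f has_real_derivative f1 x) (at x)"
    and f1: "\<And>x. (f1 has_real_derivative f2 x) (at x)" and f2: "\<And>x. (f2 has_real_derivative f3 x) (at x)"
    and bound: "\<And>x. \<bar>f3 x\<bar> \<le> C / (1 + x\<^sup>2)" and h: "0 < h" "h \<le> 1"
  shows "\<bar>F (a + real n * h) - F a - h * (\<Sum>m<n. f (a + real m * h)) - h / 2 * (f (a + real n * h) - f a)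
      + h\<^sup>2 / 12 * (f1 (a + real n * h) - f1 a)\<bar> \<le> C * h ^ 3 * (arctan (a + real n * h) - arctan a)"
    (is "\<bar>?E n\<bar> \<le> ?B n")
proof (induction n)
  case (Suc n)
  define b where "b = a + real n * h"
  have b: "a + real (Suc n) * h = b + h" by (simp add: b_def algebra_simps)
  have "?E (Suc n) = ?E n + (F (b + h) - F b - h / 2 * (f b + f (b + h)) + h\<^sup>2 / 12 * (f1 (b + h) - f1 b))"
    unfolding b sum.lessThan_Suc b_def[symmetric] by (simp add: field_simps)
  also have "\<bar>\<dots>\<bar> \<le> ?B n + C * h ^ 3 * (arctan (b + h) - arctan b)"
    using Suc.IH euler_maclaurin_step[OF F f f1 f2 bound h, of b] by linarith
  also have "\<dots> = ?B (Suc n)" unfolding b by (simp add: b_def algebra_simps)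
  finally show ?case .
qed simp

text \<open>One order less and on the half-line only, as fits the series of the character: there a
  single sum with error of order h^2 is divided by h. The weights 1/6 and 1/4 times 3 stay below
  2.\<close>

lemma trapezoid_step:
  fixes F f f1 f2 :: "real \<Rightarrow> real"
  assumes F: "\<And>x. (F has_real_derivative f x) (at x)" and f: "\<And>x. (f has_real_derivative f1 x) (at x)"
    and f1: "\<And>x. (f1 has_real_derivative f2 x) (at x)"
    and bound: "\<And>x. x \<ge> 0 \<Longrightarrow> \<bar>f2 x\<bar> \<le> C / (1 + x\<^sup>2)" and h: "0 < h" "h \<le> 1" and a: "a \<ge> 0"
  shows "\<bar>F (a + h) - F a - h / 2 * (f a + f (a + h))\<bar> \<le> 2 * C * h\<^sup>2 * (arctan (a + h) - arctan a)"
proof -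
  obtain x where x: "a < x" "x < a + h"
    "F (a + h) = F a + f a * h + f1 a * h\<^sup>2 / 2 + f2 x * h ^ 3 / 6"
    using taylor_order_3[OF F f f1 h(1)] by blast
  obtain y where y: "a < y" "y < a + h" "f (a + h) = f a + f1 a * h + f2 y * h\<^sup>2 / 2"
    using taylor_order_2[OF f f1 h(1)] by blast
  define D where "D = arctan (a + h) - arctan a"
  have C0: "C \<ge> 0" using bound[of 0] by simp
  have b: "\<bar>h * f2 u\<bar> \<le> 3 * C * D" if "a < u" "u < a + h" for u
  proof -
    have "\<bar>h * f2 u\<bar> \<le> h * (C / (1 + u\<^sup>2))" using mult_left_mono[OF bound[of u], of h] h a that by (simp add: abs_mult)
    also have "\<dots> = C * (h / (1 + u\<^sup>2))" by simp
    also have "\<dots> \<le> C * (3 * D)" using arctan_increment[OF h that] C0 unfolding D_def by (intro mult_left_mono)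
    finally show ?thesis by simp
  qed
  have "F (a + h) - F a - h / 2 * (f a + f (a + h)) = h\<^sup>2 * ((h * f2 x) / 6 - (h * f2 y) / 4)"
    unfolding x(3) y(3) by (simp add: field_simps power2_eq_square power3_eq_cube)
  also have "\<bar>\<dots>\<bar> = h\<^sup>2 * \<bar>(h * f2 x) / 6 - (h * f2 y) / 4\<bar>"
    by (simp add: abs_mult)
  also have "\<dots> \<le> h\<^sup>2 * (2 * (C * D))"
  proof (rule mult_left_mono)
    have "C * D \<ge> 0" using C0 h unfolding D_def by (intro mult_nonneg_nonneg) (auto simp: arctan_le_iff)
    thus "\<bar>(h * f2 x) / 6 - (h * f2 y) / 4\<bar> \<le> 2 * (C * D)"
      using b[OF x(1,2)] b[OF y(1,2)] by (simp add: abs_le_iff)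
  qed simp
  also have "h\<^sup>2 * (2 * (C * D)) = 2 * C * h\<^sup>2 * (arctan (a + h) - arctan a)"
    by (simp only: D_def mult_ac)
  finally show ?thesis .
qed

lemma trapezoid_sum:
  fixes F f f1 f2 :: "real \<Rightarrow> real"
  assumes F: "\<And>x. (F has_real_derivative f x) (at x)" and f: "\<And>x. (f has_real_derivative f1 x) (at x)"
    and f1: "\<And>x. (f1 has_real_derivative f2 x) (at x)"
    and bound: "\<And>x. x \<ge> 0 \<Longrightarrow> \<bar>f2 x\<bar> \<le> C / (1 + x\<^sup>2)" and h: "0 < h" "h \<le> 1"
  shows "\<bar>F (real n * h) - F 0 - h * (\<Sum>m<n. f (real m * h)) - h / 2 * (f (real n * h) - f 0)\<bar>
      \<le> 2 * C * h\<^sup>2 * arctan (real n * h)"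
    (is "\<bar>?E n\<bar> \<le> ?B n")
proof (induction n)
  case (Suc n)
  define b where "b = real n * h"
  have b: "real (Suc n) * h = b + h" by (simp add: b_def algebra_simps)
  have b0: "b \<ge> 0" using h by (simp add: b_def)
  have "?E (Suc n) = ?E n + (F (b + h) - F b - h / 2 * (f b + f (b + h)))"
    unfolding b sum.lessThan_Suc b_def[symmetric] by (simp add: field_simps)
  also have "\<bar>\<dots>\<bar> \<le> ?B n + 2 * C * h\<^sup>2 * (arctan (b + h) - arctan b)"
    using Suc.IH trapezoid_step[OF F f f1 bound h b0] by linarith
  also have "\<dots> = ?B (Suc n)" unfolding b by (simp add: b_def algebra_simps)
  finally show ?case .
qed simp

section \<open>Gaussian sums and binary theta series\<close>

lemma mono_bounded_tendsto_at_top: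
  fixes F :: "real \<Rightarrow> real"
  assumes mono: "mono F" and bdd: "\<And>x. F x \<le> B"
  obtains l where "(F \<longlongrightarrow> l) at_top" "\<And>x. F x \<le> l"
proof -
  define l where "l = (SUP x. F x)"
  have bd: "bdd_above (range F)" using bdd by (auto intro!: bdd_aboveI2)
  have le: "F x \<le> l" for x unfolding l_def by (rule cSUP_upper[OF UNIV_I bd])
  have "(F \<longlongrightarrow> l) at_top"
  proof (rule order_tendstoI)
    fix c assume "c < l"
    then obtain x where x: "c < F x" unfolding l_def by (subst (asm) less_cSUP_iff[OF _ bd]) auto
    have "c < F y" if "y \<ge> x" for y using x monoD[OF mono that] by linarith
    thus "\<forall>\<^sub>F y in at_top. c < F y" by (auto simp: eventually_at_top_linorder)
  next
    fix c assume "l < c"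
    thus "\<forall>\<^sub>F y in at_top. F y < c" using le le_less_trans by (intro always_eventually allI) blast
  qed
  with le show ?thesis using that by blast
qed

text \<open>With z = x^2, the bound exp z >= (1 + z/3)^3 dominates the cubic (1 + z)^2 (6 + 4 z).
  The constant 108 = 4 * 27 is what matches the coefficient of z^3.\<close>

lemma gauss_third_derivative_bound:
  "\<bar>(12 * x - 8 * x ^ 3) * exp (- x\<^sup>2)\<bar> \<le> 108 / (1 + x\<^sup>2)" for x :: real
proof -
  define y where "y = \<bar>x\<bar>"
  have y: "y \<ge> 0" "x\<^sup>2 = y\<^sup>2" by (simp_all add: y_def)
  define z where "z = y\<^sup>2"
  have z: "z \<ge> 0" by (simp add: z_def)
  have "1 + z / 3 \<le> exp (z / 3)" by (rule exp_ge_add_one_self)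
  hence "(1 + z / 3) ^ 3 \<le> exp (z / 3) ^ 3" using z by (intro power_mono) auto
  also have "exp (z / 3) ^ 3 = exp z" by (simp flip: exp_of_nat_mult)
  also have "(1 + z / 3) ^ 3 = 1 + z + z\<^sup>2 / 3 + z ^ 3 / 27"
    by (simp add: power3_eq_cube power2_eq_square field_simps)
  finally have e: "1 + z + z\<^sup>2 / 3 + z ^ 3 / 27 \<le> exp z" .
  have "2 * y \<le> 1 + y\<^sup>2" using sum_squares_bound[of 1 y] by simp
  hence y1: "2 * y \<le> 1 + z" by (simp add: z_def)
  have "\<bar>12 * x - 8 * x ^ 3\<bar> \<le> 12 * y + 8 * y ^ 3"
    using abs_triangle_ineq4[of "12 * x" "8 * x ^ 3"] by (simp add: y_def abs_mult power_abs)
  also have "\<dots> = 2 * y * (6 + 4 * z)" by (simp add: z_def power2_eq_square power3_eq_cube algebra_simps)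
  also have "\<dots> \<le> (1 + z) * (6 + 4 * z)" using y1 z by (intro mult_right_mono) auto
  finally have "\<bar>12 * x - 8 * x ^ 3\<bar> * (1 + z) \<le> (1 + z) * (6 + 4 * z) * (1 + z)"
    using z by (intro mult_right_mono) auto
  also have "\<dots> \<le> 108 * (1 + z + z\<^sup>2 / 3 + z ^ 3 / 27)"
  proof -
    have "(1 + z) * (6 + 4 * z) * (1 + z) = 6 + 16 * z + 14 * z\<^sup>2 + 4 * z ^ 3"
      by (simp add: power2_eq_square power3_eq_cube algebra_simps)
    moreover have "z\<^sup>2 \<ge> 0" "z ^ 3 \<ge> 0" using z by simp_all
    ultimately show ?thesis using z by (simp add: algebra_simps)
  qed
  also have "\<dots> \<le> 108 * exp z" using e by simp
  finally have main: "\<bar>12 * x - 8 * x ^ 3\<bar> * (1 + z) \<le> 108 * exp z" .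
  have zx: "x\<^sup>2 = z" by (simp add: z_def y)
  have "\<bar>12 * x - 8 * x ^ 3\<bar> \<le> 108 * exp z / (1 + z)"
    using main z by (simp add: pos_le_divide_eq)
  hence "\<bar>12 * x - 8 * x ^ 3\<bar> * exp (- z) \<le> 108 * exp z / (1 + z) * exp (- z)"
    by (intro mult_right_mono) auto
  also have "\<dots> = 108 / (1 + z)" by (simp add: exp_minus)
  finally show ?thesis unfolding zx by (simp add: abs_mult)
qed

lemma int_interval_filterlim: "filterlim (\<lambda>N. {- int N..<int N}) (finite_subsets_at_top UNIV) sequentially"
  unfolding filterlim_finite_subsets_at_top
proof (intro allI impI)
  fix X :: "int set" assume X: "finite X \<and> X \<subseteq> UNIV"
  define M where "M = (\<Sum>y\<in>X. \<bar>y\<bar>)"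
  have M: "\<bar>x\<bar> \<le> M" if "x \<in> X" for x
    unfolding M_def by (rule member_le_sum) (use that X in auto)
  have "X \<subseteq> {- int N..<int N}" if "N \<ge> nat (\<bar>M\<bar> + 1)" for N
    using M that by force
  thus "\<forall>\<^sub>F N in sequentially. finite {- int N..<int N} \<and> X \<subseteq> {- int N..<int N} \<and> {- int N..<int N} \<subseteq> UNIV"
    unfolding eventually_sequentially by (intro exI[of _ "nat (\<bar>M\<bar> + 1)"]) auto
qed

text \<open>The theta series is within \<open>O(h\<^sup>2)\<close> of \<open>c / h\<close>, uniformly in the shift: the third order
  Euler--Maclaurin formula has boundary terms only, which vanish at infinity.\<close>

lemma gaussian_sum_asymptotics:
  obtains c C :: real where "c > 0" "C \<ge> 0"
    "\<And>h \<alpha> :: real. 0 < h \<Longrightarrow> h \<le> 1 \<Longrightarrow> (\<lambda>n::int. exp (- ((of_int n + \<alpha>) * h)\<^sup>2)) summable_on UNIV"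
    "\<And>h \<alpha> :: real. 0 < h \<Longrightarrow> h \<le> 1 \<Longrightarrow> \<bar>h * (\<Sum>\<^sub>\<infinity>n::int. exp (- ((of_int n + \<alpha>) * h)\<^sup>2)) - c\<bar> \<le> C * h ^ 3"
proof -
  define f where "f = (\<lambda>x::real. exp (- x\<^sup>2))"
  define f1 where "f1 = (\<lambda>x::real. - 2 * x * exp (- x\<^sup>2))"
  define f2 where "f2 = (\<lambda>x::real. (4 * x\<^sup>2 - 2) * exp (- x\<^sup>2))"
  define f3 where "f3 = (\<lambda>x::real. (12 * x - 8 * x ^ 3) * exp (- x\<^sup>2))"
  have f: "(f has_real_derivative f1 x) (at x)" for x
    unfolding f_def f1_def by (auto intro!: derivative_eq_intros)
  have f1: "(f1 has_real_derivative f2 x) (at x)" for x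
    unfolding f1_def f2_def by (auto intro!: derivative_eq_intros simp: power2_eq_square algebra_simps)
  have f2: "(f2 has_real_derivative f3 x) (at x)" for x
    unfolding f2_def f3_def by (auto intro!: derivative_eq_intros simp: power2_eq_square power3_eq_cube algebra_simps)
  have f3: "\<bar>f3 x\<bar> \<le> 108 / (1 + x\<^sup>2)" for x
    unfolding f3_def by (rule gauss_third_derivative_bound)
  \<comment> \<open>An antiderivative of the Gaussian on the real line, as the real part of a
    primitive of an entire function.\<close>
  obtain P :: "complex \<Rightarrow> complex" where P: "\<And>z. (P has_field_derivative exp (- z\<^sup>2)) (at z)"
  proof -
    have hol: "(\<lambda>z::complex. exp (- z\<^sup>2)) holomorphic_on UNIV" by (intro holomorphic_intros)
    show ?thesis
    proof (rule holomorphic_convex_primitive'[OF _ _ hol])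
      fix g :: "complex \<Rightarrow> complex"
      assume g: "\<And>x. x \<in> UNIV \<Longrightarrow> (g has_field_derivative exp (- x\<^sup>2)) (at x within UNIV)"
      show ?thesis by (rule that[of g]) (use g in simp)
    qed auto
  qed
  define F where "F = (\<lambda>x::real. Re (P (of_real x)))"
  have F: "(F has_real_derivative f x) (at x)" for x
  proof -
    have "(P \<circ> of_real has_vector_derivative 1 * exp (- (of_real x)\<^sup>2)) (at x)"
      by (rule field_vector_diff_chain_at[OF _ P]) (auto intro: derivative_eq_intros)
    from bounded_linear.has_vector_derivative[OF bounded_linear_Re this]
    have "((\<lambda>x. Re ((P \<circ> of_real) x)) has_vector_derivative Re (exp (- (of_real x)\<^sup>2))) (at x)" by simp
    moreover have "Re (exp (- (of_real x)\<^sup>2)) = f x"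
      by (simp add: f_def Re_exp Re_power2)
    ultimately show ?thesis by (simp add: F_def has_real_derivative_iff_has_vector_derivative)
  qed
  have fpos: "f x > 0" for x by (simp add: f_def)
  have smono: "F x < F y" if "x < y" for x y
    by (rule DERIV_pos_imp_increasing[OF that]) (use F fpos in blast)
  hence monoF: "mono F" by (metis less_eq_real_def monoI)
  have fle: "f x \<le> inverse (1 + x\<^sup>2)" for x
  proof -
    have "1 + x\<^sup>2 \<le> exp (x\<^sup>2)" by (rule exp_ge_add_one_self)
    hence "inverse (exp (x\<^sup>2)) \<le> inverse (1 + x\<^sup>2)" by (intro le_imp_inverse_le) (auto simp: add_pos_nonneg)
    thus ?thesis by (simp add: f_def exp_minus)
  qed
  \<comment> \<open>The Gaussian lies below the derivative of arctan, so F stays within pi of F 0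
    and has limits at both ends.\<close>
  have amono: "arctan x - F x \<le> arctan y - F y" if "x \<le> y" for x y
  proof (rule DERIV_nonneg_imp_nondecreasing[OF that])
    fix z
    have "((\<lambda>x. arctan x - F x) has_real_derivative inverse (1 + z\<^sup>2) - f z) (at z)"
      by (intro DERIV_diff DERIV_arctan F)
    thus "\<exists>d. ((\<lambda>x. arctan x - F x) has_real_derivative d) (at z) \<and> 0 \<le> d" using fle[of z] by auto
  qed
  have up: "F x \<le> F 0 + pi" for x
  proof (cases "x \<ge> 0")
    case True
    thus ?thesis using amono[of 0 x] arctan_ubound[of x] pi_gt_zero unfolding arctan_zero_zero by linarith
  next
    case False
    thus ?thesis using monoD[OF monoF, of x 0] pi_gt_zero by linarith
  qed
  have low: "F x \<ge> F 0 - pi" for x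
  proof (cases "x \<le> 0")
    case True
    thus ?thesis using amono[of x 0] arctan_lbound[of x] pi_gt_zero unfolding arctan_zero_zero by linarith
  next
    case False
    thus ?thesis using monoD[OF monoF, of 0 x] pi_gt_zero by linarith
  qed
  obtain cp where cp: "(F \<longlongrightarrow> cp) at_top" "\<And>x. F x \<le> cp"
    using mono_bounded_tendsto_at_top[OF monoF up] by blast
  have "mono (\<lambda>x. - F (- x))" using monoF by (auto simp: mono_def)
  then obtain cm where cm: "((\<lambda>x. - F (- x)) \<longlongrightarrow> cm) at_top" "\<And>x. - F (- x) \<le> cm"
    using mono_bounded_tendsto_at_top[of "\<lambda>x. - F (- x)" "pi - F 0"] low by (smt (verit))
  \<comment> \<open>The integral of the Gaussian over the line: \<open>cp\<close> is the limit of F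
    at infinity and \<open>- cm\<close> that at minus infinity.\<close>
  define c where "c = cp + cm"
  have "c > 0" using smono[of 0 1] cp(2)[of 1] cm(2)[of 0] by (simp add: c_def)
  \<comment> \<open>108 bounds the third derivative, and the arctan increments add up to at most
    pi.\<close>
  define C where "C = 108 * pi"
  have key: "(\<lambda>n::int. exp (- ((of_int n + \<alpha>) * h)\<^sup>2)) summable_on UNIV \<and>
     \<bar>h * (\<Sum>\<^sub>\<infinity>n::int. exp (- ((of_int n + \<alpha>) * h)\<^sup>2)) - c\<bar> \<le> C * h ^ 3" if h: "0 < h" "h \<le> 1" for h \<alpha>
  proof -
    define u where "u = (\<lambda>n::int. f ((of_int n + \<alpha>) * h))"
    define A where "A = (\<lambda>N::nat. (\<alpha> - real N) * h)"
    define B where "B = (\<lambda>N::nat. (\<alpha> + real N) * h)"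
    define S where "S = (\<lambda>N::nat. \<Sum>n\<in>{- int N..<int N}. u n)"
    have S: "S N = (\<Sum>m<2 * N. f (A N + real m * h))" for N
      unfolding S_def
      by (rule sum.reindex_bij_witness[of _ "\<lambda>m. int m - int N" "\<lambda>n. nat (n + int N)"])
         (auto simp: u_def A_def algebra_simps)
    have AB: "A N + real (2 * N) * h = B N" for N by (simp add: A_def B_def algebra_simps)
    have em: "\<bar>F (B N) - F (A N) - h * S N - h / 2 * (f (B N) - f (A N)) + h\<^sup>2 / 12 * (f1 (B N) - f1 (A N))\<bar>
       \<le> C * h ^ 3" for N
    proof -
      have "\<bar>F (B N) - F (A N) - h * S N - h / 2 * (f (B N) - f (A N)) + h\<^sup>2 / 12 * (f1 (B N) - f1 (A N))\<bar>
         \<le> 108 * h ^ 3 * (arctan (B N) - arctan (A N))"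
        using euler_maclaurin_sum[OF F f f1 f2 f3 h, of "A N" "2 * N"] unfolding AB S[symmetric] .
      also have "\<dots> \<le> 108 * h ^ 3 * pi"
        using arctan_ubound[of "B N"] arctan_lbound[of "A N"] h by (intro mult_left_mono) auto
      finally show ?thesis by (simp add: C_def mult_ac)
    qed
    have Btop: "filterlim B at_top sequentially" and Abot: "filterlim (\<lambda>N. - A N) at_top sequentially"
      unfolding A_def B_def using h(1) by real_asymp+
    have FB: "(\<lambda>N. F (B N)) \<longlonglongrightarrow> cp" using filterlim_compose[OF cp(1) Btop] .
    have FA: "(\<lambda>N. F (A N)) \<longlonglongrightarrow> - cm" using tendsto_minus[OF filterlim_compose[OF cm(1) Abot]] by simp
    have fB: "(\<lambda>N. f (B N)) \<longlonglongrightarrow> 0" "(\<lambda>N. f (A N)) \<longlonglongrightarrow> 0" "(\<lambda>N. f1 (B N)) \<longlonglongrightarrow> 0" "(\<lambda>N. f1 (A N)) \<longlonglongrightarrow> 0"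
    proof -
      have t: "(f \<longlongrightarrow> 0) at_top" "(f \<longlongrightarrow> 0) at_bot" "(f1 \<longlongrightarrow> 0) at_top" "(f1 \<longlongrightarrow> 0) at_bot"
        unfolding f_def f1_def by real_asymp+
      have Ab: "filterlim A at_bot sequentially" using Abot by (simp add: filterlim_uminus_at_bot)
      show "(\<lambda>N. f (B N)) \<longlonglongrightarrow> 0" "(\<lambda>N. f1 (B N)) \<longlonglongrightarrow> 0"
        using filterlim_compose[OF t(1) Btop] filterlim_compose[OF t(3) Btop] by simp_all
      show "(\<lambda>N. f (A N)) \<longlonglongrightarrow> 0" "(\<lambda>N. f1 (A N)) \<longlonglongrightarrow> 0"
        using filterlim_compose[OF t(2) Ab] filterlim_compose[OF t(4) Ab] by simp_all
    qed
    have u0: "u n \<ge> 0" for n using fpos by (simp add: u_def less_imp_le)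
    have incS: "incseq S" unfolding S_def by (intro incseq_SucI sum_mono2) (auto simp: u0)
    have "(\<lambda>N. F (B N) - F (A N) - h / 2 * (f (B N) - f (A N)) + h\<^sup>2 / 12 * (f1 (B N) - f1 (A N)))
       \<longlonglongrightarrow> cp - (- cm) - h / 2 * (0 - 0) + h\<^sup>2 / 12 * (0 - 0)"
      by (intro tendsto_intros FB FA fB)
    hence "convergent (\<lambda>N. F (B N) - F (A N) - h / 2 * (f (B N) - f (A N)) + h\<^sup>2 / 12 * (f1 (B N) - f1 (A N)))"
      by (rule convergentI)
    from convergent_imp_Bseq[OF this] obtain K where K: "\<And>N. \<bar>F (B N) - F (A N) - h / 2 * (f (B N) - f (A N)) + h\<^sup>2 / 12 * (f1 (B N) - f1 (A N))\<bar> \<le> K"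
      unfolding Bseq_def real_norm_def by blast
    have Sb: "S N \<le> (K + C * h ^ 3) / h" for N
      using em[of N] K[of N] h by (simp add: pos_le_divide_eq mult.commute)
    have sumb: "sum u X \<le> (K + C * h ^ 3) / h" if X: "finite X" for X
    proof -
      have "\<forall>\<^sub>F N in sequentially. X \<subseteq> {- int N..<int N}"
        using int_interval_filterlim[unfolded filterlim_finite_subsets_at_top] X by (auto elim: eventually_mono)
      then obtain N where "X \<subseteq> {- int N..<int N}" by (auto simp: eventually_sequentially)
      hence "sum u X \<le> S N" unfolding S_def by (intro sum_mono2) (auto simp: u0)
      thus ?thesis using Sb[of N] by linarith
    qed
    have summ: "u summable_on UNIV"
      by (rule nonneg_bdd_above_summable_on) (use u0 sumb in \<open>auto intro!: bdd_aboveI2\<close>)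
    have "(sum u \<longlongrightarrow> infsum u UNIV) (finite_subsets_at_top UNIV)"
      using has_sum_infsum[OF summ] by (simp add: has_sum_def)
    hence Slim: "S \<longlonglongrightarrow> infsum u UNIV"
      unfolding S_def by (rule filterlim_compose[OF _ int_interval_filterlim])
    have "(\<lambda>N. \<bar>F (B N) - F (A N) - h * S N - h / 2 * (f (B N) - f (A N)) + h\<^sup>2 / 12 * (f1 (B N) - f1 (A N))\<bar>)
       \<longlonglongrightarrow> \<bar>cp - (- cm) - h * infsum u UNIV - h / 2 * (0 - 0) + h\<^sup>2 / 12 * (0 - 0)\<bar>"
      by (intro tendsto_intros FB FA fB Slim)
    hence "\<bar>cp - (- cm) - h * infsum u UNIV - h / 2 * (0 - 0) + h\<^sup>2 / 12 * (0 - 0)\<bar> \<le> C * h ^ 3"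
      by (rule LIMSEQ_le_const2) (use em in blast)
    hence "\<bar>h * infsum u UNIV - c\<bar> \<le> C * h ^ 3" by (simp add: c_def abs_minus_commute algebra_simps)
    thus ?thesis using summ by (simp add: u_def f_def)
  qed
  have "C \<ge> 0" by (simp add: C_def)
  show ?thesis by (rule that[OF \<open>c > 0\<close> \<open>C \<ge> 0\<close>]; use key in blast)
qed

text \<open>Completing the square turns the sum over x, for fixed y, into a shifted Gaussian sum;
  because the asymptotics are uniform in the shift, the double sum behaves like a product of two
  such sums with steps of order sqrt t. An error h^3 is of order t^(3/2) and survives the division
  by t as o(1), whereas h^2 would not. The constant depends on the form only through D.\<close>

lemma theta_asymptotics:
  obtains \<kappa> :: real where "\<kappa> > 0"
    "\<And>a b c D :: real. a > 0 \<Longrightarrow> D > 0 \<Longrightarrow> 4 * a * c = b\<^sup>2 + D \<Longrightarrow>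
      (\<forall>\<^sub>F t in at_right 0. (\<lambda>(x, y). exp (- t * (a * (of_int x)\<^sup>2 + b * of_int x * of_int y + c * (of_int y)\<^sup>2)))
          summable_on (UNIV :: (int \<times> int) set)) \<and>
      ((\<lambda>t. (\<Sum>\<^sub>\<infinity>(x, y)\<in>(UNIV :: (int \<times> int) set).
          exp (- t * (a * (of_int x)\<^sup>2 + b * of_int x * of_int y + c * (of_int y)\<^sup>2))) - \<kappa> / sqrt D / t) \<longlongrightarrow> 0) (at_right 0)"
proof -
  obtain c0 C :: real where c0: "c0 > 0" and C: "C \<ge> 0"
    and summ: "\<And>h \<alpha> :: real. 0 < h \<Longrightarrow> h \<le> 1 \<Longrightarrow> (\<lambda>n::int. exp (- ((of_int n + \<alpha>) * h)\<^sup>2)) summable_on UNIV"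
    and asym: "\<And>h \<alpha> :: real. 0 < h \<Longrightarrow> h \<le> 1 \<Longrightarrow> \<bar>h * (\<Sum>\<^sub>\<infinity>n::int. exp (- ((of_int n + \<alpha>) * h)\<^sup>2)) - c0\<bar> \<le> C * h ^ 3"
    using gaussian_sum_asymptotics by blast
  \<comment> \<open>The two steps multiply to t sqrt D / 2, so the leading term is c0^2 / (t sqrt D
    / 2).\<close>
  define \<kappa> where "\<kappa> = 2 * c0\<^sup>2"
  have "\<kappa> > 0" using c0 by (simp add: \<kappa>_def)
  moreover have "(\<forall>\<^sub>F t in at_right 0. (\<lambda>(x, y). exp (- t * (a * (of_int x)\<^sup>2 + b * of_int x * of_int y + c * (of_int y)\<^sup>2)))
          summable_on (UNIV :: (int \<times> int) set)) \<and>
      ((\<lambda>t. (\<Sum>\<^sub>\<infinity>(x, y)\<in>(UNIV :: (int \<times> int) set).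
          exp (- t * (a * (of_int x)\<^sup>2 + b * of_int x * of_int y + c * (of_int y)\<^sup>2))) - \<kappa> / sqrt D / t) \<longlongrightarrow> 0) (at_right 0)"
    if a: "a > 0" and D: "D > 0" and disc: "4 * a * c = b\<^sup>2 + D" for a b c D :: real
  proof -
    define q where "q = (\<lambda>t x y. exp (- t * (a * (of_int x)\<^sup>2 + b * of_int x * of_int y + c * (of_int y)\<^sup>2) :: real))"
    define E where "E = D / (4 * a)"
    have E: "E > 0" using a D by (simp add: E_def)
    define T where "T = (\<lambda>h \<alpha> :: real. \<Sum>\<^sub>\<infinity>n::int. exp (- ((of_int n + \<alpha>) * h)\<^sup>2))"
    have main: "(\<lambda>(x, y). q t x y) summable_on UNIV \<and>
        \<bar>t * (sqrt D / 2) * (\<Sum>\<^sub>\<infinity>(x, y)\<in>UNIV. q t x y) - c0\<^sup>2\<bar>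
           \<le> C * sqrt (t * a) ^ 3 * (c0 + C) + c0 * (C * sqrt (t * E) ^ 3)"
      if t: "t > 0" "t * a \<le> 1" "t * E \<le> 1" for t
    proof -
      define g where "g = sqrt (t * a)"
      define h where "h = sqrt (t * E)"
      have g: "0 < g" "g \<le> 1" "g\<^sup>2 = t * a" using t a by (simp_all add: g_def)
      have h: "0 < h" "h \<le> 1" "h\<^sup>2 = t * E" using t E by (simp_all add: h_def)
      have gh: "g * h = t * (sqrt D / 2)"
      proof -
        have "g * h = sqrt (t\<^sup>2 * (D / 4))" using a
          by (simp add: g_def h_def E_def power2_eq_square flip: real_sqrt_mult)
        thus ?thesis using t by (simp add: real_sqrt_mult real_sqrt_divide)
      qed
      define \<alpha> where "\<alpha> = (\<lambda>y::int. b * of_int y / (2 * a))"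
      define r where "r = (\<lambda>y::int. exp (- ((of_int y + 0) * h)\<^sup>2))"
      \<comment> \<open>The form equals a (x + b y / (2 a))^2 + (D / (4 a)) y^2.\<close>
      have split: "q t x y = r y * exp (- ((of_int x + \<alpha> y) * g)\<^sup>2)" for x y
      proof -
        have cc: "c = (b\<^sup>2 + D) / (4 * a)" using disc a by (simp add: field_simps)
        have "t * (a * (of_int x)\<^sup>2 + b * of_int x * of_int y + c * (of_int y)\<^sup>2) =
          t * a * (of_int x + \<alpha> y)\<^sup>2 + t * E * (of_int y)\<^sup>2"
          unfolding cc using a by (simp add: \<alpha>_def E_def power2_eq_square field_simps)
        also have "\<dots> = ((of_int x + \<alpha> y) * g)\<^sup>2 + ((of_int y + 0) * h)\<^sup>2"
          unfolding g(3)[symmetric] h(3)[symmetric] by (simp add: power_mult_distrib mult.commute)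
        finally show ?thesis by (simp add: q_def r_def flip: exp_add)
      qed
      have inner: "((\<lambda>x. q t x y) has_sum (r y * T g (\<alpha> y))) UNIV" for y
        unfolding split T_def by (intro has_sum_cmult_right has_sum_infsum summ g)
      have rs: "r summable_on UNIV" unfolding r_def by (rule summ[OF h(1,2)])
      have r0: "r y \<ge> 0" for y by (simp add: r_def)
      have T0: "T g \<beta> \<ge> 0" for \<beta> unfolding T_def by (intro infsum_nonneg) auto
      have Tg: "\<bar>g * T g \<beta> - c0\<bar> \<le> C * g ^ 3" for \<beta> unfolding T_def by (rule asym[OF g(1,2)])
      define B where "B = (c0 + C * g ^ 3) / g"
      have TB: "T g \<beta> \<le> B" for \<beta> using Tg[of \<beta>] g by (simp add: B_def pos_le_divide_eq mult.commute abs_le_iff)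
      have outer: "(\<lambda>y. r y * T g (\<alpha> y)) summable_on UNIV"
      proof (rule summable_on_comparison_test)
        show "(\<lambda>y. r y * B) summable_on UNIV" by (intro summable_on_cmult_left rs)
      qed (use r0 T0 TB in \<open>auto intro: mult_left_mono\<close>)
      have "((\<lambda>(y, x). q t x y) has_sum (\<Sum>\<^sub>\<infinity>y. r y * T g (\<alpha> y))) (Sigma UNIV (\<lambda>_. UNIV))"
      proof (rule has_sum_SigmaI)
        show "((\<lambda>x. case (y, x) of (y, x) \<Rightarrow> q t x y) has_sum r y * T g (\<alpha> y)) UNIV" for y
          using inner by simp
        show "((\<lambda>y. r y * T g (\<alpha> y)) has_sum (\<Sum>\<^sub>\<infinity>y. r y * T g (\<alpha> y))) UNIV"
          by (rule has_sum_infsum[OF outer])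
        show "(\<lambda>(y, x). q t x y) summable_on Sigma UNIV (\<lambda>_. UNIV)"
        proof (rule summable_on_SigmaI)
          show "((\<lambda>x. case (y, x) of (y, x) \<Rightarrow> q t x y) has_sum r y * T g (\<alpha> y)) UNIV" for y
            using inner by simp
        qed (use outer in \<open>auto simp: q_def\<close>)
      qed
      hence "((\<lambda>(x, y). q t x y) has_sum (\<Sum>\<^sub>\<infinity>y. r y * T g (\<alpha> y))) UNIV"
        by (subst has_sum_reindex_bij_witness[of _ prod.swap prod.swap "UNIV \<times> UNIV" "\<lambda>(y, x). q t x y"]) auto
      hence qs: "(\<lambda>(x, y). q t x y) summable_on UNIV"
        and qi: "(\<Sum>\<^sub>\<infinity>(x, y)\<in>UNIV. q t x y) = (\<Sum>\<^sub>\<infinity>y. r y * T g (\<alpha> y))"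
        by (auto simp: summable_on_def infsumI)
      define R where "R = (\<Sum>\<^sub>\<infinity>y. r y)"
      have R0: "R \<ge> 0" unfolding R_def by (intro infsum_nonneg r0)
      have hR: "\<bar>h * R - c0\<bar> \<le> C * h ^ 3" unfolding R_def r_def by (rule asym[OF h(1,2)])
      have h3: "h ^ 3 \<le> 1" using h by (simp add: power_le_one)
      have C3: "C * h ^ 3 \<le> C" using mult_left_mono[OF h3 C] by simp
      have hRb: "h * R \<le> c0 + C" using hR C3 by linarith
      define W where "W = (\<Sum>\<^sub>\<infinity>y. r y * T g (\<alpha> y))"
      have up: "g * W \<le> (c0 + C * g ^ 3) * R"
      proof -
        have "g * W = (\<Sum>\<^sub>\<infinity>y. g * (r y * T g (\<alpha> y)))" unfolding W_def by (rule infsum_cmult_right'[symmetric])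
        also have "\<dots> \<le> (\<Sum>\<^sub>\<infinity>y. (c0 + C * g ^ 3) * r y)"
        proof (rule infsum_mono)
          show "g * (r y * T g (\<alpha> y)) \<le> (c0 + C * g ^ 3) * r y" for y
          proof -
            have "g * T g (\<alpha> y) \<le> c0 + C * g ^ 3" using Tg[of "\<alpha> y"] by linarith
            from mult_right_mono[OF this r0[of y]] show ?thesis by (simp add: mult_ac)
          qed
        qed (intro summable_on_cmult_right outer rs)+
        also have "\<dots> = (c0 + C * g ^ 3) * R" unfolding R_def by (rule infsum_cmult_right')
        finally show ?thesis .
      qed
      have lo: "(c0 - C * g ^ 3) * R \<le> g * W"
      proof -
        have "(c0 - C * g ^ 3) * R = (\<Sum>\<^sub>\<infinity>y. (c0 - C * g ^ 3) * r y)" unfolding R_def by (rule infsum_cmult_right'[symmetric])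
        also have "\<dots> \<le> (\<Sum>\<^sub>\<infinity>y. g * (r y * T g (\<alpha> y)))"
        proof (rule infsum_mono)
          show "(c0 - C * g ^ 3) * r y \<le> g * (r y * T g (\<alpha> y))" for y
          proof -
            have "c0 - C * g ^ 3 \<le> g * T g (\<alpha> y)" using Tg[of "\<alpha> y"] by linarith
            from mult_right_mono[OF this r0[of y]] show ?thesis by (simp add: mult_ac)
          qed
        qed (intro summable_on_cmult_right outer rs)+
        also have "\<dots> = g * W" unfolding W_def by (rule infsum_cmult_right')
        finally show ?thesis .
      qed
      have "\<bar>g * W - c0 * R\<bar> \<le> C * g ^ 3 * R" using up lo by (simp add: algebra_simps abs_le_iff)
      hence "h * \<bar>g * W - c0 * R\<bar> \<le> h * (C * g ^ 3 * R)" using h by (intro mult_left_mono) auto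
      also have "h * (C * g ^ 3 * R) = C * g ^ 3 * (h * R)" by simp
      also have "h * \<bar>g * W - c0 * R\<bar> = \<bar>h * (g * W - c0 * R)\<bar>" using h by (simp add: abs_mult)
      also have "h * (g * W - c0 * R) = g * h * W - c0 * (h * R)" by (simp add: algebra_simps)
      finally have "\<bar>g * h * W - c0 * (h * R)\<bar> \<le> C * g ^ 3 * (h * R)" .
      moreover have "C * g ^ 3 * (h * R) \<le> C * g ^ 3 * (c0 + C)" using hRb C g by (intro mult_left_mono) auto
      ultimately have 1: "\<bar>g * h * W - c0 * (h * R)\<bar> \<le> C * g ^ 3 * (c0 + C)" by (rule order_trans)
      have "\<bar>c0 * (h * R) - c0 * c0\<bar> = c0 * \<bar>h * R - c0\<bar>" using c0 by (simp add: abs_mult flip: right_diff_distrib)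
      also have "\<dots> \<le> c0 * (C * h ^ 3)" using hR c0 by (intro mult_left_mono) auto
      finally have 2: "\<bar>c0 * (h * R) - c0 * c0\<bar> \<le> c0 * (C * h ^ 3)" .
      have "\<bar>g * h * W - c0\<^sup>2\<bar> \<le> C * g ^ 3 * (c0 + C) + c0 * (C * h ^ 3)"
        using 1 2 unfolding power2_eq_square by linarith
      thus ?thesis using qs unfolding gh qi W_def[symmetric] g_def[symmetric] h_def[symmetric] by blast
    qed
    have ev: "\<forall>\<^sub>F t in at_right 0. t > 0 \<and> t * a \<le> 1 \<and> t * E \<le> 1"
    proof -
      define d where "d = min (1 / a) (1 / E)"
      have "d > 0" using a E by (simp add: d_def)
      moreover have "t * a \<le> 1 \<and> t * E \<le> 1" if "0 < t" "t < d" for t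
        using that a E by (auto simp: d_def field_simps)
      ultimately show ?thesis unfolding eventually_at_right_field by blast
    qed
    have 1: "\<forall>\<^sub>F t in at_right 0. (\<lambda>(x, y). q t x y) summable_on UNIV"
      using ev by eventually_elim (use main in blast)
    define \<theta> where "\<theta> = (\<lambda>t. \<Sum>\<^sub>\<infinity>(x, y)\<in>UNIV. q t x y)"
    have 2: "((\<lambda>t. \<theta> t - \<kappa> / sqrt D / t) \<longlongrightarrow> 0) (at_right 0)"
    proof (rule Lim_null_comparison)
      show "\<forall>\<^sub>F t in at_right 0. norm (\<theta> t - \<kappa> / sqrt D / t)
         \<le> (C * sqrt (t * a) ^ 3 * (c0 + C) + c0 * (C * sqrt (t * E) ^ 3)) / (t * (sqrt D / 2))"
        using ev
      proof eventually_elim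
        case (elim t)
        have p: "t * (sqrt D / 2) > 0" using elim D by simp
        have "\<theta> t - \<kappa> / sqrt D / t = (t * (sqrt D / 2) * \<theta> t - c0\<^sup>2) / (t * (sqrt D / 2))"
          using p elim D by (simp add: \<kappa>_def field_simps)
        hence "norm (\<theta> t - \<kappa> / sqrt D / t) = \<bar>t * (sqrt D / 2) * \<theta> t - c0\<^sup>2\<bar> / (t * (sqrt D / 2))"
          using p by (simp only: real_norm_def abs_divide abs_of_pos)
        also have "\<dots> \<le> (C * sqrt (t * a) ^ 3 * (c0 + C) + c0 * (C * sqrt (t * E) ^ 3)) / (t * (sqrt D / 2))"
          using main[of t] elim p unfolding \<theta>_def by (intro divide_right_mono) auto
        finally show ?case .
      qed
      show "((\<lambda>t. (C * sqrt (t * a) ^ 3 * (c0 + C) + c0 * (C * sqrt (t * E) ^ 3)) / (t * (sqrt D / 2))) \<longlongrightarrow> 0) (at_right 0)"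
      proof -
        have "((\<lambda>t. (C * (c0 + C) * sqrt a ^ 3 + c0 * C * sqrt E ^ 3) / (sqrt D / 2) * sqrt t) \<longlongrightarrow>
           (C * (c0 + C) * sqrt a ^ 3 + c0 * C * sqrt E ^ 3) / (sqrt D / 2) * sqrt 0) (at_right 0)"
          by (intro tendsto_intros)
        moreover have "\<forall>\<^sub>F t in at_right 0. (C * (c0 + C) * sqrt a ^ 3 + c0 * C * sqrt E ^ 3) / (sqrt D / 2) * sqrt t =
            (C * sqrt (t * a) ^ 3 * (c0 + C) + c0 * (C * sqrt (t * E) ^ 3)) / (t * (sqrt D / 2))"
          using ev
        proof eventually_elim
          case (elim t)
          have "sqrt t ^ 3 = t * sqrt t" using elim by (simp add: power3_eq_cube)
          hence "C * sqrt (t * a) ^ 3 * (c0 + C) + c0 * (C * sqrt (t * E) ^ 3) =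
             t * ((C * (c0 + C) * sqrt a ^ 3 + c0 * C * sqrt E ^ 3) * sqrt t)"
            by (simp add: real_sqrt_mult power_mult_distrib algebra_simps)
          thus ?case using elim D by simp
        qed
        ultimately show ?thesis by (simp add: tendsto_cong)
      qed
    qed
    show ?thesis using 1 2 unfolding q_def \<theta>_def by blast
  qed
  ultimately show ?thesis using that by blast
qed

section \<open>The series of the character\<close>

lemma sum_residues_nat: "(\<Sum>j\<in>{0..<int k}. f j) = (\<Sum>n<k. f (int n))"
  by (rule sum.reindex_bij_witness[of _ int nat]) auto

lemma sum_of_nat_times_power:
  fixes z :: "'a :: comm_ring_1"
  shows "(z - 1) * (\<Sum>n<m. of_nat n * z ^ n) = of_nat m * z ^ m - z * (\<Sum>n<m. z ^ n)"
  by (induction m) (simp_all add: algebra_simps)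

lemma exp_minus_le: "u \<ge> 0 \<Longrightarrow> exp (- u) \<le> 2 / (1 + u\<^sup>2)" for u :: real
proof -
  assume u: "u \<ge> 0"
  have "1 + u + u\<^sup>2 / 2 \<le> exp u" using u by (rule exp_lower_Taylor_quadratic)
  hence "(1 + u\<^sup>2) / 2 \<le> exp u" using u by (simp add: field_simps)
  hence "inverse (exp u) \<le> inverse ((1 + u\<^sup>2) / 2)"
    by (intro le_imp_inverse_le) (auto simp: add_pos_nonneg)
  thus ?thesis by (simp add: exp_minus)
qed

context odd_real_primitive_char
begin

abbreviation units :: "int set" where "units \<equiv> {0<..<int k}"

lemma sum_chi_units: "(\<Sum>j\<in>units. \<chi> j * f j) = (\<Sum>j\<in>{0..<int k}. \<chi> j * f j)"
  by (rule sum.mono_neutral_left) auto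

text \<open>For odd k no k-th root of unity other than 1 is real. This keeps 1 - z off the branch
  cut of \<open>Ln\<close> and away from 0, uniformly in u.\<close>

lemma Im_e_nonzero: "j \<in> units \<Longrightarrow> Im (e j) \<noteq> 0"
proof
  assume j: "j \<in> units" and "Im (e j) = 0"
  hence "(Re (e j))\<^sup>2 = 1" using cmod_power2[of "e j"] by (simp add: e_def)
  hence "e j ^ 2 = 1" using \<open>Im (e j) = 0\<close> by (simp add: complex_eq_iff Re_power2 Im_power2)
  hence "int k dvd 2 * j" by (simp add: e_power e_eq_1_iff)
  moreover have "coprime (int k) 2" using odd_k by simp
  ultimately have "int k dvd j" by (simp add: coprime_dvd_mult_right_iff)
  thus False using j zdvd_imp_le by fastforce
qed

text \<open>For \<open>u > 0\<close>, \<open>g u\<close> is \<open>\<Sum>\<^sub>n \<chi>(n) exp (- n u)\<close>. Expanding \<open>\<chi>\<close> in additive characters shows that it continues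
  smoothly through \<open>u = 0\<close> together with its antiderivative \<open>F\<close>.\<close>

definition z :: "int \<Rightarrow> real \<Rightarrow> complex" where "z j u = e j * of_real (exp (- u))"

lemma norm_e [simp]: "norm (e j) = 1" by (simp add: e_def)

lemma norm_z: "norm (z j u) = exp (- u)" by (simp add: z_def norm_mult)

lemma norm_one_minus_z: "norm (1 - z j u) \<ge> \<bar>Im (e j)\<bar>"
proof -
  have "norm (1 - z j u) = norm (cnj (e j) * (1 - z j u))" by (simp add: norm_mult)
  also have "cnj (e j) * (1 - z j u) = cnj (e j) - of_real (exp (- u))"
  proof -
    have "cnj (e j) * e j = of_real ((norm (e j))\<^sup>2)" by (metis complex_norm_square mult.commute)
    hence "cnj (e j) * e j = 1" by simp
    thus ?thesis by (simp add: z_def algebra_simps flip: mult.assoc)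
  qed
  also have "norm \<dots> \<ge> \<bar>Im (cnj (e j) - of_real (exp (- u)))\<bar>" by (rule abs_Im_le_cmod)
  finally show ?thesis by simp
qed

lemma one_minus_z_nonzero: "j \<in> units \<Longrightarrow> 1 - z j u \<noteq> 0"
  using norm_one_minus_z[of j u] Im_e_nonzero[of j] by auto

lemma one_minus_z_nonpos: "j \<in> units \<Longrightarrow> 1 - z j u \<notin> \<real>\<^sub>\<le>\<^sub>0"
  using Im_e_nonzero[of j] by (auto simp: complex_nonpos_Reals_iff z_def)

lemma z_derivative: "(z j has_vector_derivative - z j u) (at u)"
proof -
  have "((\<lambda>u. e j * of_real (exp (- u))) has_vector_derivative e j * of_real (- exp (- u))) (at u)"
    by (intro has_vector_derivative_mult_right has_vector_derivative_of_real)
       (auto intro!: derivative_eq_intros simp: has_real_derivative_iff_has_vector_derivative[symmetric])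
  thus ?thesis by (simp add: z_def[abs_def])
qed

lemma z_chain: 
  assumes "(\<phi> has_field_derivative d) (at (z j u))" "d' = - z j u * d"
  shows "((\<lambda>u. \<phi> (z j u)) has_vector_derivative d') (at u)"
  using field_vector_diff_chain_at[OF z_derivative, of \<phi> d j u] assms by (simp add: o_def)

text \<open>For u > 0, expanding the logarithm gives F u = - \<Sum> \<open>\<chi> n\<close> exp (- n
  u) / n. This is the antiderivative of g that vanishes at infinity, so its value at 0 is minus
  L(1).\<close>

definition F where "F u = (\<Sum>j\<in>units. \<chi> j * Ln (1 - z j u)) / G"
definition g where "g u = (\<Sum>j\<in>units. \<chi> j * (z j u / (1 - z j u))) / G"
definition g1 where "g1 u = (\<Sum>j\<in>units. \<chi> j * (- z j u / (1 - z j u)\<^sup>2)) / G"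
definition g2 where "g2 u = (\<Sum>j\<in>units. \<chi> j * (z j u * (1 + z j u) / (1 - z j u) ^ 3)) / G"

lemma Re_derivative: "(f has_vector_derivative d) (at u) \<Longrightarrow> ((\<lambda>u. Re (f u)) has_real_derivative Re d) (at u)"
  using bounded_linear.has_vector_derivative[OF bounded_linear_Re]
  by (simp add: has_real_derivative_iff_has_vector_derivative)

lemma F_derivative: "((\<lambda>u. Re (F u)) has_real_derivative Re (g u)) (at u)"
proof (rule Re_derivative)
  have "((\<lambda>u. Ln (1 - z j u)) has_vector_derivative z j u / (1 - z j u)) (at u)" if j: "j \<in> units" for j
  proof (rule z_chain[where \<phi> = "\<lambda>z. Ln (1 - z)"])
    show "((\<lambda>z. Ln (1 - z)) has_field_derivative - 1 / (1 - z j u)) (at (z j u))"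
      using one_minus_z_nonpos[OF j] by (auto intro!: derivative_eq_intros simp: divide_inverse)
  qed simp
  thus "(F has_vector_derivative g u) (at u)"
    unfolding F_def[abs_def] g_def
    by (intro has_vector_derivative_divide has_vector_derivative_sum has_vector_derivative_mult_right) auto
qed

lemma g_derivative: "((\<lambda>u. Re (g u)) has_real_derivative Re (g1 u)) (at u)"
proof (rule Re_derivative)
  have "((\<lambda>u. z j u / (1 - z j u)) has_vector_derivative - z j u / (1 - z j u)\<^sup>2) (at u)" if j: "j \<in> units" for j
  proof (rule z_chain[where \<phi> = "\<lambda>z. z / (1 - z)"])
    show "((\<lambda>z. z / (1 - z)) has_field_derivative 1 / (1 - z j u)\<^sup>2) (at (z j u))"
      using one_minus_z_nonzero[OF j, of u] by (auto intro!: derivative_eq_intros simp: power2_eq_square)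
  qed simp
  thus "(g has_vector_derivative g1 u) (at u)"
    unfolding g_def[abs_def] g1_def
    by (intro has_vector_derivative_divide has_vector_derivative_sum has_vector_derivative_mult_right) auto
qed

lemma g1_derivative: "((\<lambda>u. Re (g1 u)) has_real_derivative Re (g2 u)) (at u)"
proof (rule Re_derivative)
  have "((\<lambda>u. - z j u / (1 - z j u)\<^sup>2) has_vector_derivative z j u * (1 + z j u) / (1 - z j u) ^ 3) (at u)"
    if j: "j \<in> units" for j
  proof (rule z_chain[where \<phi> = "\<lambda>z. - z / (1 - z)\<^sup>2"])
    show "((\<lambda>z. - z / (1 - z)\<^sup>2) has_field_derivative - (1 + z j u) / (1 - z j u) ^ 3) (at (z j u))"
    proof -
      define a where "a = z j u"
      define w where "w = 1 - a"
      have w: "w \<noteq> 0" using one_minus_z_nonzero[OF j, of u] by (simp add: w_def a_def)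
      have d1: "((\<lambda>z. - z) has_field_derivative - 1) (at a)" by (auto intro!: derivative_eq_intros)
      have d2: "((\<lambda>z. (1 - z)\<^sup>2) has_field_derivative - (2 * w)) (at a)"
        unfolding w_def by (auto intro!: derivative_eq_intros)
      have "((\<lambda>z. - z / (1 - z)\<^sup>2) has_field_derivative (- 1 * w\<^sup>2 - (- a) * (- (2 * w))) / (w\<^sup>2 * w\<^sup>2)) (at a)"
        using DERIV_divide[OF d1 d2] w by (simp add: w_def)
      also have "(- 1 * w\<^sup>2 - (- a) * (- (2 * w))) / (w\<^sup>2 * w\<^sup>2) = - (1 + a) / w ^ 3"
      proof -
        have aw: "a = 1 - w" by (simp add: w_def)
        have "(- 1 * v\<^sup>2 - (- (1 - v)) * (- (2 * v))) / (v\<^sup>2 * v\<^sup>2) = - (1 + (1 - v)) / v ^ 3" if "v \<noteq> 0" for v :: complex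
          using that by (simp add: power2_eq_square power3_eq_cube field_simps)
        thus ?thesis using w unfolding aw by blast
      qed
      finally show ?thesis by (simp only: w_def a_def)
    qed
    have "a * b / q = - a * (- b / q)" for a b q :: complex by simp
    thus "z j u * (1 + z j u) / (1 - z j u) ^ 3 = - z j u * (- (1 + z j u) / (1 - z j u) ^ 3)" .
  qed
  thus "(g1 has_vector_derivative g2 u) (at u)"
    unfolding g1_def[abs_def] g2_def
    by (intro has_vector_derivative_divide has_vector_derivative_sum has_vector_derivative_mult_right) auto
qed

lemma norm_chi_le: "norm (\<chi> j) \<le> 1"
  using chi_cases[of j] by auto

lemma norm_sum_chi_le:
  assumes "\<And>j. j \<in> units \<Longrightarrow> norm (f j) \<le> c j * x"
  shows "norm ((\<Sum>j\<in>units. \<chi> j * f j) / G) \<le> (\<Sum>j\<in>units. c j) / norm G * x"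
proof -
  have "norm (\<Sum>j\<in>units. \<chi> j * f j) \<le> (\<Sum>j\<in>units. c j * x)"
  proof (rule sum_norm_le)
    fix j assume "j \<in> units"
    have "norm (\<chi> j * f j) \<le> 1 * norm (f j)"
      unfolding norm_mult by (intro mult_right_mono norm_chi_le) auto
    thus "norm (\<chi> j * f j) \<le> c j * x" using assms[OF \<open>j \<in> units\<close>] by simp
  qed
  hence "norm (\<Sum>j\<in>units. \<chi> j * f j) / norm G \<le> (\<Sum>j\<in>units. c j * x) / norm G"
    by (intro divide_right_mono) auto
  thus ?thesis by (simp add: norm_divide flip: sum_distrib_right)
qed

lemma g_bound: obtains C where "\<And>u. norm (g u) \<le> C * exp (- u)"
proof -
  have b: "norm (z j u / (1 - z j u)) \<le> inverse \<bar>Im (e j)\<bar> * exp (- u)" if j: "j \<in> units" for j u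
  proof -
    have "norm (z j u / (1 - z j u)) = exp (- u) / norm (1 - z j u)" by (simp add: norm_divide norm_z)
    also have "\<dots> \<le> exp (- u) / \<bar>Im (e j)\<bar>"
      using norm_one_minus_z[of j u] Im_e_nonzero[OF j] one_minus_z_nonzero[OF j, of u]
      by (intro divide_left_mono mult_pos_pos) auto
    also have "\<dots> = inverse \<bar>Im (e j)\<bar> * exp (- u)" by (simp add: divide_inverse mult.commute)
    finally show ?thesis .
  qed
  have "norm (g u) \<le> (\<Sum>j\<in>units. inverse \<bar>Im (e j)\<bar>) / norm G * exp (- u)" for u
    unfolding g_def by (rule norm_sum_chi_le) (rule b)
  thus ?thesis by (rule that)
qed

lemma g2_bound: obtains C where "\<And>u. u \<ge> 0 \<Longrightarrow> \<bar>Re (g2 u)\<bar> \<le> C / (1 + u\<^sup>2)"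
proof -
  have nb: "norm (z j u * (1 + z j u) / (1 - z j u) ^ 3) \<le> (2 / \<bar>Im (e j)\<bar> ^ 3) * exp (- u)"
    if j: "j \<in> units" and u: "u \<ge> 0" for j u
  proof -
    have "norm (1 + z j u) \<le> 2" using norm_triangle_ineq[of 1 "z j u"] exp_le_one_iff[of "- u"] u unfolding norm_z norm_one by linarith
    hence "norm (z j u * (1 + z j u)) \<le> exp (- u) * 2" by (simp add: norm_mult norm_z)
    hence "norm (z j u * (1 + z j u)) / norm (1 - z j u) ^ 3 \<le> (exp (- u) * 2) / \<bar>Im (e j)\<bar> ^ 3"
      using norm_one_minus_z[of j u] Im_e_nonzero[OF j]
      by (intro frac_le power_mono) auto
    thus ?thesis by (simp add: norm_divide norm_power mult.commute)
  qed
  define C where "C = (\<Sum>j\<in>units. 2 / \<bar>Im (e j)\<bar> ^ 3) / norm G"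
  have C0: "C \<ge> 0" unfolding C_def by (intro divide_nonneg_nonneg sum_nonneg) auto
  have "\<bar>Re (g2 u)\<bar> \<le> 2 * C / (1 + u\<^sup>2)" if u: "u \<ge> 0" for u
  proof -
    have "\<bar>Re (g2 u)\<bar> \<le> norm (g2 u)" by (rule abs_Re_le_cmod)
    also have "\<dots> \<le> C * exp (- u)" unfolding g2_def C_def by (rule norm_sum_chi_le[OF nb[OF _ u]])
    also have "\<dots> \<le> C * (2 / (1 + u\<^sup>2))" using exp_minus_le[OF u] C0 by (rule mult_left_mono)
    finally show ?thesis by (simp add: mult_ac)
  qed
  thus ?thesis using that by blast
qed

lemma sum_chi: "(\<Sum>j\<in>units. \<chi> j) = 0"
  using gauss_sum_separable[of 0] sum_chi_units[of "\<lambda>_. 1"] by simp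

lemma g_alt: "g u = (\<Sum>j\<in>units. \<chi> j * (1 / (1 - z j u))) / G"
proof -
  have "(\<Sum>j\<in>units. \<chi> j * (1 / (1 - z j u))) = (\<Sum>j\<in>units. \<chi> j * (z j u / (1 - z j u)) + \<chi> j)"
  proof (rule sum.cong)
    fix j assume j: "j \<in> units"
    have "1 / (1 - z j u) = z j u / (1 - z j u) + 1" using one_minus_z_nonzero[OF j, of u] by (simp add: field_simps)
    thus "\<chi> j * (1 / (1 - z j u)) = \<chi> j * (z j u / (1 - z j u)) + \<chi> j" by (simp only: distrib_left mult_1_right)
  qed simp
  thus ?thesis by (simp add: g_def sum.distrib sum_chi)
qed

lemma g_series:
  assumes u: "u > 0"
  shows "(\<lambda>n. of_int (chi_int (int n)) * exp (- (real n * u))) sums Re (g u)"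
proof -
  have "(\<lambda>n. (\<Sum>j\<in>units. \<chi> j * z j u ^ n) / G) sums ((\<Sum>j\<in>units. \<chi> j * (1 / (1 - z j u))) / G)"
    by (intro sums_divide sums_sum sums_mult geometric_sums) (use u in \<open>simp add: norm_z\<close>)
  also have "(\<lambda>n. (\<Sum>j\<in>units. \<chi> j * z j u ^ n) / G) = (\<lambda>n. of_real (of_int (chi_int (int n)) * exp (- (real n * u))))"
  proof
    fix n
    have "(\<Sum>j\<in>units. \<chi> j * z j u ^ n) = (\<Sum>j\<in>units. \<chi> j * e (int n * j)) * of_real (exp (- (real n * u)))"
    proof -
      have "z j u ^ n = e (int n * j) * of_real (exp (- (real n * u)))" for j
        unfolding z_def power_mult_distrib e_power of_real_power[symmetric] exp_of_nat_mult[symmetric] by simp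
      thus ?thesis by (simp add: sum_distrib_right mult.assoc)
    qed
    also have "(\<Sum>j\<in>units. \<chi> j * e (int n * j)) = \<chi> (int n) * G"
      unfolding sum_chi_units by (rule gauss_sum_separable)
    finally show "(\<Sum>j\<in>units. \<chi> j * z j u ^ n) / G = of_real (of_int (chi_int (int n)) * exp (- (real n * u)))"
      using G_nonzero by (simp add: chi_int)
  qed
  finally have "(\<lambda>n. of_real (of_int (chi_int (int n)) * exp (- (real n * u)))) sums g u" unfolding g_alt .
  from sums_Re[OF this] show ?thesis by simp
qed

text \<open>The values of the Dirichlet series of \<open>\<chi>\<close> at \<open>0\<close> and \<open>1\<close>.\<close>

definition L0 :: real where "L0 = - (\<Sum>j\<in>{0..<int k}. of_int (j * chi_int j)) / real k"
definition L1 :: real where "L1 = - Re (F 0)"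

text \<open>For a k-th root of unity other than 1, 1 / (1 - e j) is -1/k times the sum of n e (n j)
  over n < k. Summing against \<open>\<chi> j\<close> is then a Gauss sum again, and G
  cancels.\<close>

lemma g_0: "Re (g 0) = L0"
proof -
  have inv: "1 / (1 - e j) = - (\<Sum>n\<in>{0..<int k}. of_int n * e (n * j)) / of_nat k" if j: "j \<in> units" for j
  proof -
    have nd: "\<not> int k dvd j" using j zdvd_imp_le by fastforce
    hence ne: "e j \<noteq> 1" by (simp add: e_eq_1_iff)
    have "(\<Sum>n<k. e j ^ n) = 0" using sum_e[of j] nd by (simp add: sum_residues_nat e_power mult.commute)
    moreover have "e j ^ k = 1" by (simp add: e_power e_eq_1_iff)
    ultimately have "(e j - 1) * (\<Sum>n<k. of_nat n * e j ^ n) = of_nat k"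
      using sum_of_nat_times_power[of "e j" k] by simp
    moreover have "(\<Sum>n<k. of_nat n * e j ^ n) = (\<Sum>n\<in>{0..<int k}. of_int n * e (n * j))"
      by (simp add: sum_residues_nat e_power)
    ultimately have "(e j - 1) * (\<Sum>n\<in>{0..<int k}. of_int n * e (n * j)) = of_nat k" by simp
    thus ?thesis using ne by (simp add: field_simps)
  qed
  have "(\<Sum>j\<in>units. \<chi> j * (1 / (1 - z j 0))) = (\<Sum>j\<in>units. \<chi> j * (- (\<Sum>n\<in>{0..<int k}. of_int n * e (n * j)) / of_nat k))"
    by (rule sum.cong) (simp_all add: z_def inv)
  also have "\<dots> = - (\<Sum>j\<in>{0..<int k}. \<chi> j * (\<Sum>n\<in>{0..<int k}. of_int n * e (n * j))) / of_nat k"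
    unfolding sum_chi_units
    by (simp only: mult_minus_right minus_divide_left[symmetric] times_divide_eq_right sum_negf sum_divide_distrib[symmetric])
  also have "(\<Sum>j\<in>{0..<int k}. \<chi> j * (\<Sum>n\<in>{0..<int k}. of_int n * e (n * j))) =
      (\<Sum>n\<in>{0..<int k}. of_int n * (\<Sum>j\<in>{0..<int k}. \<chi> j * e (n * j)))"
    unfolding sum_distrib_left by (subst sum.swap) (simp add: mult.left_commute)
  also have "\<dots> = (\<Sum>n\<in>{0..<int k}. of_int (n * chi_int n)) * G"
    unfolding gauss_sum_separable sum_distrib_right by (simp add: chi_int mult.assoc)
  finally have "g 0 = - (\<Sum>n\<in>{0..<int k}. of_int (n * chi_int n)) / of_nat k"
    unfolding g_alt using G_nonzero by simp
  also have "\<dots> = of_real L0" by (simp add: L0_def)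
  finally show ?thesis by simp
qed

text \<open>With \<theta> = pi j / k in (0, pi), 1 - e j has modulus 2 sin \<theta> and argument
  \<theta> - pi/2, which is in the principal range.\<close>

lemma Im_Ln_one_minus_e:
  assumes j: "j \<in> units"
  shows "Im (Ln (1 - e j)) = pi * of_int j / real k - pi / 2"
proof -
  define \<theta> where "\<theta> = pi * of_int j / real k"
  have \<theta>: "0 < \<theta>" "\<theta> < pi" using j by (auto simp: \<theta>_def field_simps)
  have s: "sin \<theta> > 0" using sin_gt_zero[OF \<theta>] .
  have "e j = cis (2 * \<theta>)" by (simp add: e_def \<theta>_def mult_ac)
  have "1 - e j = of_real (2 * sin \<theta>) * cis (\<theta> - pi / 2)"
    unfolding \<open>e j = cis (2 * \<theta>)\<close>
    by (simp add: complex_eq_iff cos_diff sin_diff cos_double_sin sin_double power2_eq_square)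
  also have "\<dots> = exp (Complex (ln (2 * sin \<theta>)) (\<theta> - pi / 2))"
    using s by (simp add: complex_eq_iff Re_exp Im_exp)
  finally have "Ln (1 - e j) = Complex (ln (2 * sin \<theta>)) (\<theta> - pi / 2)"
    using \<theta> by simp
  thus ?thesis by (simp add: \<theta>_def)
qed

text \<open>Since G is purely imaginary, only the arguments of the logarithms enter. They are linear
  in j, and their constant part drops out because the values of \<open>\<chi>\<close> sum to
  0.\<close>

lemma L1_eq: "L1 = \<epsilon> * pi / sqrt (real k) * L0"
proof -
  have kk: "sqrt (real k) > 0" by simp
  define w where "w = (\<Sum>j\<in>units. \<chi> j * Ln (1 - e j))"
  have "F 0 = w / G" by (simp add: F_def w_def z_def)
  also have "\<dots> = - \<i> * of_real (\<epsilon> / sqrt (real k)) * w"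
    using epsilon_cases kk by (subst G_eq) (auto simp: field_simps)
  finally have "Re (F 0) = \<epsilon> / sqrt (real k) * Im w" by simp
  moreover have "Im w = (\<Sum>j\<in>units. of_int (chi_int j) * (pi * of_int j / real k - pi / 2))"
    unfolding w_def Im_sum by (rule sum.cong) (simp_all add: chi_int Im_Ln_one_minus_e)
  moreover have "\<dots> = (\<Sum>j\<in>units. pi / real k * of_int (j * chi_int j)) - pi / 2 * (\<Sum>j\<in>units. of_int (chi_int j))"
    by (simp add: sum_distrib_left sum_subtractf right_diff_distrib algebra_simps)
  moreover have "(\<Sum>j\<in>units. of_int (chi_int j) :: real) = 0"
  proof -
    have "of_int (\<Sum>j\<in>units. chi_int j) = (0 :: complex)" using sum_chi by (simp add: chi_int)
    hence "(\<Sum>j\<in>units. chi_int j) = 0" by (simp only: of_int_eq_0_iff)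
    thus ?thesis by (simp flip: of_int_sum)
  qed
  moreover have "(\<Sum>j\<in>units. pi / real k * of_int (j * chi_int j)) = - pi * L0"
  proof -
    have "(\<Sum>j\<in>units. of_int (j * chi_int j) :: real) = (\<Sum>j\<in>{0..<int k}. of_int (j * chi_int j))"
      by (rule sum.mono_neutral_left) auto
    moreover have "(\<Sum>j\<in>units. pi / real k * of_int (j * chi_int j)) = pi / real k * (\<Sum>j\<in>units. of_int (j * chi_int j))"
      by (rule sum_distrib_left[symmetric])
    ultimately show ?thesis by (simp add: L0_def)
  qed
  ultimately have "Re (F 0) = \<epsilon> / sqrt (real k) * (- pi * L0)" by simp
  thus ?thesis by (simp add: L1_def)
qed


lemma F_tendsto_0: "((\<lambda>u. Re (F u)) \<longlongrightarrow> 0) at_top"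
proof -
  have "((\<lambda>u. z j u) \<longlongrightarrow> e j * of_real 0) at_top" for j
  proof -
    have "((\<lambda>u::real. exp (- u)) \<longlongrightarrow> 0) at_top" by real_asymp
    thus ?thesis unfolding z_def by (intro tendsto_intros)
  qed
  hence z0: "((\<lambda>u. z j u) \<longlongrightarrow> 0) at_top" for j by simp
  have ln: "((\<lambda>u. Ln (1 - z j u)) \<longlongrightarrow> Ln (1 - 0)) at_top" for j
    by (intro tendsto_Ln tendsto_intros z0) (simp add: complex_nonpos_Reals_iff)
  have "((\<lambda>u. \<Sum>j\<in>units. \<chi> j * Ln (1 - z j u)) \<longlongrightarrow> (\<Sum>j\<in>units. \<chi> j * Ln (1 - 0))) at_top"
    by (intro tendsto_sum tendsto_mult_left ln)
  hence "((\<lambda>u. F u) \<longlongrightarrow> (\<Sum>j\<in>units. \<chi> j * Ln (1 - 0)) / G) at_top"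
    unfolding F_def by (intro tendsto_divide tendsto_const G_nonzero)
  hence "(F \<longlongrightarrow> 0) at_top" by simp
  from tendsto_Re[OF this] show ?thesis by simp
qed

lemma g_summable: 
  assumes t: "t > 0" 
  shows "summable (\<lambda>m. Re (g (real m * t)))"
proof -
  obtain C where C: "\<And>u. norm (g u) \<le> C * exp (- u)" using g_bound by blast
  show ?thesis
  proof (rule summable_comparison_test')
    show "summable (\<lambda>m. C * exp (- t) ^ m)" using t by (intro summable_mult summable_geometric) simp
    fix m :: nat
    have "norm (Re (g (real m * t))) \<le> norm (g (real m * t))" by (simp add: abs_Re_le_cmod)
    also have "\<dots> \<le> C * exp (- t) ^ m" using C[of "real m * t"] by (simp flip: exp_of_nat_mult)
    finally show "norm (Re (g (real m * t))) \<le> C * exp (- t) ^ m" .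
  qed
qed

text \<open>The Lambert series of \<open>\<chi>\<close>; \<open>ideals_has_sum\<close> identifies it
  with the sum of exp (- t N(I)) over the ideals. The shift to \<open>Suc m\<close> leaves out m =
  0, where g is finite but no longer given by its series.\<close>

definition Z :: "real \<Rightarrow> real" where "Z t = (\<Sum>m. Re (g (real (Suc m) * t)))"

text \<open>The integral of g over the half-line is - F 0 = L1. The trapezoidal rule counts the
  endpoint value g 0 = L0 with weight 1/2 while Z omits it, which is where - L0 / 2 comes
  from.\<close>

lemma Z_asymptotics: "((\<lambda>t. Z t - L1 / t) \<longlongrightarrow> - L0 / 2) (at_right 0)"
proof -
  obtain C where C: "\<And>u. u \<ge> 0 \<Longrightarrow> \<bar>Re (g2 u)\<bar> \<le> C / (1 + u\<^sup>2)" using g2_bound by blast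
  have C0: "C \<ge> 0" using C[of 0] by simp
  have bound: "\<bar>t * Z t + t / 2 * L0 - L1\<bar> \<le> pi * C * t\<^sup>2" if t: "0 < t" "t \<le> 1" for t
  proof -
    have top: "filterlim (\<lambda>n. real n * t) at_top sequentially" using t(1) by real_asymp
    have "(\<lambda>n. \<bar>Re (F (real n * t)) - Re (F 0) - t * (\<Sum>m<n. Re (g (real m * t))) - t / 2 * (Re (g (real n * t)) - Re (g 0))\<bar>)
       \<longlonglongrightarrow> \<bar>0 - Re (F 0) - t * (\<Sum>m. Re (g (real m * t))) - t / 2 * (0 - Re (g 0))\<bar>"
      by (intro tendsto_intros filterlim_compose[OF F_tendsto_0 top] summable_LIMSEQ g_summable summable_LIMSEQ_zero[OF g_summable] t)
    moreover have "\<bar>Re (F (real n * t)) - Re (F 0) - t * (\<Sum>m<n. Re (g (real m * t))) - t / 2 * (Re (g (real n * t)) - Re (g 0))\<bar>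
       \<le> pi * C * t\<^sup>2" for n
    proof -
      have "\<bar>Re (F (real n * t)) - Re (F 0) - t * (\<Sum>m<n. Re (g (real m * t))) - t / 2 * (Re (g (real n * t)) - Re (g 0))\<bar>
         \<le> 2 * C * t\<^sup>2 * arctan (real n * t)"
        by (rule trapezoid_sum[OF F_derivative g_derivative g1_derivative C t])
      also have "\<dots> \<le> 2 * C * t\<^sup>2 * (pi / 2)"
        using arctan_ubound[of "real n * t"] C0 by (intro mult_left_mono) auto
      finally show ?thesis by (simp add: mult_ac)
    qed
    ultimately have "\<bar>0 - Re (F 0) - t * (\<Sum>m. Re (g (real m * t))) - t / 2 * (0 - Re (g 0))\<bar> \<le> pi * C * t\<^sup>2"
      by (rule LIMSEQ_le_const2[OF _ exI, OF _ allI, OF _ impI])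
    moreover have "(\<Sum>m. Re (g (real m * t))) = Z t + L0"
      using suminf_split_head[OF g_summable[OF t(1)]] by (simp add: Z_def g_0)
    ultimately have "\<bar>- (t * Z t + t / 2 * L0 - L1)\<bar> \<le> pi * C * t\<^sup>2"
      by (simp add: L1_def g_0 algebra_simps)
    thus ?thesis by (simp only: abs_minus_cancel)
  qed
  have "((\<lambda>t. Z t - L1 / t - (- L0 / 2)) \<longlongrightarrow> 0) (at_right 0)"
  proof (rule Lim_null_comparison)
    have "\<forall>\<^sub>F t in at_right 0. 0 < t \<and> t < (1::real)"
      unfolding eventually_at_right_field by (intro exI[of _ 1]) auto
    thus "\<forall>\<^sub>F t in at_right 0. norm (Z t - L1 / t - (- L0 / 2)) \<le> pi * C * t"
    proof eventually_elim
      case (elim t)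
      have "Z t - L1 / t - (- L0 / 2) = (t * Z t + t / 2 * L0 - L1) / t" using elim by (simp add: field_simps)
      hence "norm (Z t - L1 / t - (- L0 / 2)) = \<bar>t * Z t + t / 2 * L0 - L1\<bar> / t" using elim by simp
      also have "\<dots> \<le> (pi * C * t\<^sup>2) / t" using bound[of t] elim by (intro divide_right_mono) auto
      also have "\<dots> = pi * C * t" using elim by (simp add: power2_eq_square)
      finally show ?case .
    qed
    have "((\<lambda>t. pi * C * t) \<longlongrightarrow> pi * C * 0) (at_right 0)" by (intro tendsto_intros)
    thus "((\<lambda>t. pi * C * t) \<longlongrightarrow> 0) (at_right 0)" by simp
  qed
  thus ?thesis by (rule LIM_zero_cancel)
qed

text \<open>Double series \<open>\<Sum>\<^sub>m \<Sum>\<^sub>d \<chi>(d) e\<^sup>-\<^sup>m\<^sup>d\<^sup>t\<close>, summed once over \<open>d\<close> first and once along \<open>m d = n\<close>.\<close>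

lemma Z_has_sum:
  assumes t: "t > 0"
  shows "((\<lambda>n. real (ideal_count K n) * exp (- (real n * t))) has_sum Z t) {0<..}"
proof -
  define f where "f = (\<lambda>(m, d). of_int (chi_int (int d)) * exp (- (real (m * d) * t)) :: real)"
  \<comment> \<open>The majorant without the character; its summability over pairs allows both
    orders of summation.\<close>
  define f' where "f' = (\<lambda>(m, d). exp (- (real (m * d) * t)) :: real)"
  define P where "P = {0::nat<..}"
  have geo: "((\<lambda>d. exp (- (real d * u))) has_sum exp (- u) / (1 - exp (- u))) P" if "u > 0" for u
  proof -
    have "(\<lambda>d. exp (- u) ^ d) sums (1 / (1 - exp (- u)))" using that by (intro geometric_sums) simp
    hence "((\<lambda>d. exp (- u) ^ d) has_sum (1 / (1 - exp (- u)))) UNIV"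
      by (rule sums_nonneg_imp_has_sum) simp
    hence "((\<lambda>d. exp (- u) * exp (- u) ^ d) has_sum exp (- u) * (1 / (1 - exp (- u)))) UNIV"
      by (rule has_sum_cmult_right)
    hence "((\<lambda>d. exp (- u) ^ d) has_sum exp (- u) * (1 / (1 - exp (- u)))) P"
      by (subst has_sum_reindex_bij_witness[of _ Suc "\<lambda>m. m - 1" UNIV "\<lambda>d. exp (- u) * exp (- u) ^ d"])
         (auto simp: P_def simp flip: power_Suc)
    also have "exp (- u) * (1 / (1 - exp (- u))) = exp (- u) / (1 - exp (- u))" by simp
    also have "(\<lambda>d. exp (- u) ^ d) = (\<lambda>d. exp (- (real d * u)))" by (simp flip: exp_of_nat_mult)
    finally show ?thesis .
  qed
  have inner: "((\<lambda>d. f' (m, d)) has_sum exp (- (real m * t)) / (1 - exp (- (real m * t)))) P" if "m \<in> P" for m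
    using geo[of "real m * t"] that t by (simp add: f'_def P_def mult_ac)
  have f's: "f' summable_on Sigma P (\<lambda>_. P)"
  proof (rule summable_on_SigmaI[OF inner])
    show "(\<lambda>m. exp (- (real m * t)) / (1 - exp (- (real m * t)))) summable_on P"
    proof (rule summable_on_comparison_test)
      have "(\<lambda>m. exp (- (real m * t))) summable_on P" using geo[OF t] by (rule has_sum_imp_summable)
      thus "(\<lambda>m. exp (- (real m * t)) * (1 / (1 - exp (- t)))) summable_on P" by (rule summable_on_cmult_left)
      fix m assume m: "m \<in> P"
      hence "t \<le> real m * t" using t by (simp add: P_def)
      hence 1: "exp (- (real m * t)) \<le> exp (- t)" by simp
      have 2: "exp (- t) < 1" using t by simp
      show "exp (- (real m * t)) / (1 - exp (- (real m * t))) \<le> exp (- (real m * t)) * (1 / (1 - exp (- t)))"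
        using 1 2 by (simp add: frac_le)
      show "0 \<le> exp (- (real m * t)) / (1 - exp (- (real m * t)))" using 1 2 by simp
    qed
  qed (auto simp: f'_def)
  have fs: "f summable_on P \<times> P"
  proof (rule Infinite_Sum.abs_summable_summable, rule Infinite_Sum.abs_summable_on_comparison_test')
    show "f' summable_on P \<times> P" using f's .
    fix p assume "p \<in> P \<times> P"
    obtain m d where p: "p = (m, d)" by (cases p)
    have "\<bar>chi_int (int d)\<bar> \<le> 1" by (simp add: chi_int_def)
    hence "\<bar>of_int (chi_int (int d))\<bar> \<le> (1 :: real)" by linarith
    from mult_right_mono[OF this, of "exp (- (real (m * d) * t))"]
    show "norm (f p) \<le> f' p" by (simp add: f_def f'_def p abs_mult)
  qed
  have gsum: "((\<lambda>d. f (m, d)) has_sum Re (g (real m * t))) P" if m: "m \<in> P" for m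
  proof -
    have mt: "real m * t > 0" using m t by (simp add: P_def)
    have "(\<lambda>d. f (m, d)) summable_on P" using summable_on_SigmaD1[of "\<lambda>m d. f (m, d)" P "\<lambda>_. P"] fs m by simp
    hence hs: "((\<lambda>d. f (m, d)) has_sum infsum (\<lambda>d. f (m, d)) P) P" by (rule has_sum_infsum)
    moreover have "((\<lambda>d. f (m, d)) has_sum infsum (\<lambda>d. f (m, d)) P) UNIV \<longleftrightarrow>
        ((\<lambda>d. f (m, d)) has_sum infsum (\<lambda>d. f (m, d)) P) P"
      by (rule has_sum_cong_neutral) (auto simp: P_def f_def chi_int_def)
    ultimately have "((\<lambda>d. f (m, d)) has_sum infsum (\<lambda>d. f (m, d)) P) UNIV" by blast
    hence "(\<lambda>d. f (m, d)) sums infsum (\<lambda>d. f (m, d)) P" by (rule has_sum_imp_sums)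
    moreover have "(\<lambda>d. f (m, d)) sums Re (g (real m * t))"
      using g_series[OF mt] by (simp add: f_def mult_ac)
    ultimately show ?thesis using hs sums_unique2 by metis
  qed
  have S: "(f has_sum infsum f (P \<times> P)) (P \<times> P)" using fs by (rule has_sum_infsum)
  have "((\<lambda>m. Re (g (real m * t))) has_sum infsum f (P \<times> P)) P"
    by (rule has_sum_SigmaD[OF S gsum])
  hence "((\<lambda>m. Re (g (real (Suc m) * t))) has_sum infsum f (P \<times> P)) UNIV"
    by (subst has_sum_reindex_bij_witness[of UNIV "\<lambda>m. m - 1" Suc P "\<lambda>m. Re (g (real m * t))"]) (auto simp: P_def)
  hence "(\<lambda>m. Re (g (real (Suc m) * t))) sums infsum f (P \<times> P)" by (rule has_sum_imp_sums)
  hence Zeq: "Z t = infsum f (P \<times> P)" unfolding Z_def by (rule sums_unique[symmetric])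
  define h where "h = (\<lambda>(n::nat, d). of_int (chi_int (int d)) * exp (- (real n * t)) :: real)"
  have "(f has_sum infsum f (P \<times> P)) (P \<times> P) \<longleftrightarrow> (h has_sum infsum f (P \<times> P)) (Sigma P (\<lambda>n. {d. d dvd n}))"
    by (rule has_sum_reindex_bij_witness[of _ "\<lambda>(n, d). (n div d, d)" "\<lambda>(m, d). (m * d, d)"])
       (auto simp: P_def f_def h_def elim!: dvdE)
  hence H: "(h has_sum infsum f (P \<times> P)) (Sigma P (\<lambda>n. {d. d dvd n}))" using S by blast
  have "((\<lambda>n. (\<Sum>d | d dvd n. of_int (chi_int (int d))) * exp (- (real n * t))) has_sum infsum f (P \<times> P)) P"
  proof (rule has_sum_SigmaD[OF H])
    fix n assume n: "n \<in> P"
    hence "finite {d. d dvd n}" by (auto simp: P_def)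
    thus "((\<lambda>d. h (n, d)) has_sum (\<Sum>d | d dvd n. of_int (chi_int (int d))) * exp (- (real n * t))) {d. d dvd n}"
      by (intro has_sum_finiteI) (simp_all add: h_def sum_distrib_right)
  qed
  moreover have "(\<Sum>d | d dvd n. of_int (chi_int (int d)) :: real) = real (ideal_count K n)" if "n \<in> P" for n
  proof -
    have "of_int (int (ideal_count K n)) = (of_int (\<Sum>d | d dvd n. chi_int (int d)) :: real)"
      using ideal_count_eq_divisor_sum[of n] that by (simp add: P_def)
    thus ?thesis by simp
  qed
  ultimately have "((\<lambda>n. real (ideal_count K n) * exp (- (real n * t))) has_sum infsum f (P \<times> P)) P"
    by (subst (asm) has_sum_cong[of P _ "\<lambda>n. real (ideal_count K n) * exp (- (real n * t))"]) auto
  thus ?thesis by (simp add: Zeq P_def)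
qed

end

section \<open>The class number formula\<close>

context odd_real_primitive_char
begin

sublocale iq: imaginary_quadratic k
  by unfold_locales (use k7 squarefree_k four_dvd in auto)

lemma N0_eq_K: "iq.N0 = K"
  by (simp add: iq.N0_def K_def)

definition param_norm :: "nat \<times> int \<times> nat \<Rightarrow> nat" where
  "param_norm = (\<lambda>(a, b, c). c\<^sup>2 * a)"

text \<open>In c^2 a = n the content c determines a, and the admissible b are those counted by
  \<open>root_count\<close>.\<close>

lemma card_params:
  assumes n: "n > 0"
  shows "finite {p \<in> iq.params. param_norm p = n}" "card {p \<in> iq.params. param_norm p = n} = ideal_count K n"
proof -
  define D where "D = {c. c\<^sup>2 dvd n}"
  define B where "B = (\<lambda>c::nat. {b \<in> {0..<int (n div c\<^sup>2)}. int (n div c\<^sup>2) dvd b * b + b + K})"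
  have Dd: "D \<subseteq> {c. c dvd n}" unfolding D_def power2_eq_square by (auto dest: dvd_mult_left)
  have finD: "finite D" by (rule finite_subset[OF Dd]) (use n in simp)
  have finB: "finite (B c)" for c
    unfolding B_def by (rule finite_subset[of _ "{0..<int (n div c\<^sup>2)}"]) auto
  have bij: "bij_betw (\<lambda>(c, b). (n div c\<^sup>2, b, c)) (Sigma D B) {p \<in> iq.params. param_norm p = n}"
  proof (rule bij_betw_imageI)
    show "inj_on (\<lambda>(c, b). (n div c\<^sup>2, b, c)) (Sigma D B)" by (auto intro!: inj_onI)
    show "(\<lambda>(c, b). (n div c\<^sup>2, b, c)) ` Sigma D B = {p \<in> iq.params. param_norm p = n}"
    proof (intro equalityI subsetI)
      fix p assume "p \<in> (\<lambda>(c, b). (n div c\<^sup>2, b, c)) ` Sigma D B"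
      then obtain c b where p: "p = (n div c\<^sup>2, b, c)" "c\<^sup>2 dvd n" "b \<in> B c" by (auto simp: D_def)
      have nc: "n = c\<^sup>2 * (n div c\<^sup>2)" using p(2) by simp
      hence "n div c\<^sup>2 > 0" "c > 0" using n by (auto intro: Nat.gr0I)
      thus "p \<in> {p \<in> iq.params. param_norm p = n}"
        using p(3) nc unfolding p(1) by (simp add: iq.params_def param_norm_def B_def N0_eq_K)
    next
      fix p assume "p \<in> {p \<in> iq.params. param_norm p = n}"
      then obtain a b c where p: "p = (a, b, c)" "a > 0" "c > 0" "b \<in> {0..<int a}" "int a dvd b * b + b + K" "c\<^sup>2 * a = n"
        by (auto simp: iq.params_def param_norm_def N0_eq_K)
      have "n div c\<^sup>2 = a" using p(3) by (simp flip: p(6))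
      moreover have "c\<^sup>2 dvd n" by (simp flip: p(6))
      ultimately have "(c, b) \<in> Sigma D B" "p = (\<lambda>(c, b). (n div c\<^sup>2, b, c)) (c, b)"
        using p by (simp_all add: D_def B_def)
      thus "p \<in> (\<lambda>(c, b). (n div c\<^sup>2, b, c)) ` Sigma D B" by (rule rev_image_eqI)
    qed
  qed
  have "finite (Sigma D B)" using finD finB by blast
  thus "finite {p \<in> iq.params. param_norm p = n}" using bij_betw_finite[OF bij] by blast
  have "card {p \<in> iq.params. param_norm p = n} = card (Sigma D B)" using bij_betw_same_card[OF bij] ..
  also have "\<dots> = (\<Sum>c\<in>D. card (B c))" using finD finB by (simp add: card_SigmaI)
  also have "\<dots> = (\<Sum>c\<in>D. root_count K (n div c\<^sup>2))" by (simp only: root_count_def B_def)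
  also have "\<dots> = ideal_count K n" unfolding ideal_count_def
    by (rule sum.mono_neutral_cong_left) (use n Dd in \<open>auto simp: D_def\<close>)
  finally show "card {p \<in> iq.params. param_norm p = n} = ideal_count K n" .
qed

definition weight :: "real \<Rightarrow> complex set \<Rightarrow> real" where
  "weight t I = exp (- (real (iq.ideal_norm I) * t))"

lemma ideals_has_sum:
  assumes t: "t > 0"
  shows "(weight t has_sum Z t) iq.ideals"
proof -
  define P where "P = {0::nat<..}"
  define A where "A = (\<lambda>n. {p \<in> iq.params. param_norm p = n})"
  define f where "f = (\<lambda>(n::nat, p :: nat \<times> int \<times> nat). exp (- (real n * t)))"
  have inner: "((\<lambda>p. f (n, p)) has_sum real (ideal_count K n) * exp (- (real n * t))) (A n)" if "n \<in> P" for n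
    by (rule has_sum_finiteI) (use card_params[of n] that in \<open>simp_all add: A_def P_def f_def\<close>)
  have outer: "((\<lambda>n. real (ideal_count K n) * exp (- (real n * t))) has_sum Z t) P"
    unfolding P_def by (rule Z_has_sum[OF t])
  have "(f has_sum Z t) (Sigma P A)"
  proof (rule has_sum_SigmaI[OF inner outer])
    show "f summable_on Sigma P A"
      by (rule summable_on_SigmaI[OF inner has_sum_imp_summable[OF outer]]) (auto simp: f_def)
  qed
  also have "(f has_sum Z t) (Sigma P A) \<longleftrightarrow> ((\<lambda>p. exp (- (real (param_norm p) * t))) has_sum Z t) iq.params"
    by (rule has_sum_reindex_bij_witness[of _ "\<lambda>p. (param_norm p, p)" snd])
       (auto simp: A_def P_def f_def iq.params_def param_norm_def)
  also have "\<dots> \<longleftrightarrow> ((\<lambda>p. weight t (iq.ideal_of p)) has_sum Z t) iq.params"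
    by (rule has_sum_cong) (auto simp: weight_def param_norm_def iq.ideal_norm_ideal_of)
  also have "\<dots> \<longleftrightarrow> (weight t has_sum Z t) iq.ideals"
    unfolding iq.ideals_eq_image by (subst has_sum_reindex[OF iq.inj_ideal_of]) (simp add: o_def)
  finally show ?thesis .
qed

definition ideal_classes :: "complex set set set" where "ideal_classes = iq.ideals // iq.class_rel"

lemma class_number_eq: "class_number (quadratic_field (- int k)) = card ideal_classes"
  by (simp add: class_number_def ideal_classes_def iq.ideals_def iq.class_rel_def iq.R_def)

lemma class_subset: "C \<in> ideal_classes \<Longrightarrow> C \<subseteq> iq.ideals"
  unfolding ideal_classes_def using iq.equiv_class_rel by (metis Union_quotient Union_upper)

lemma class_summable: "t > 0 \<Longrightarrow> C \<subseteq> iq.ideals \<Longrightarrow> weight t summable_on C"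
  using ideals_has_sum has_sum_imp_summable summable_on_subset_banach by blast

lemma ideal_classes_disjoint: "C \<in> ideal_classes \<Longrightarrow> C' \<in> ideal_classes \<Longrightarrow> C \<noteq> C' \<Longrightarrow> C \<inter> C' = {}"
  unfolding ideal_classes_def using quotient_disj[OF iq.equiv_class_rel] by blast

text \<open>The plane is the origin, the half plane and its negative; the term of the origin is the
  1 that ends up as the constant -1/2 of each class.\<close>

lemma sum_over_half_plane:
  fixes q :: "int \<times> int \<Rightarrow> real"
  assumes s: "q summable_on UNIV" and sym: "\<And>x y. q (- x, - y) = q (x, y)" and q0: "q (0, 0) = 1"
  shows "(\<Sum>\<^sub>\<infinity>p\<in>iq.half_plane. q p) = ((\<Sum>\<^sub>\<infinity>p. q p) - 1) / 2"
proof -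
  define m where "m = (\<lambda>(x, y). (- x, - y) :: int \<times> int)"
  define H where "H = iq.half_plane"
  have U: "UNIV = {(0, 0)} \<union> (H \<union> m ` H)"
  proof (intro equalityI subsetI)
    fix p :: "int \<times> int"
    obtain x y where p: "p = (x, y)" by (cases p)
    consider "p = (0, 0)" | "p \<in> H" | "m p \<in> H" unfolding H_def iq.half_plane_def m_def p by force
    thus "p \<in> {(0, 0)} \<union> (H \<union> m ` H)"
    proof cases
      case 3
      moreover have "p = m (m p)" by (simp add: m_def p)
      ultimately show ?thesis by blast
    qed auto
  qed auto
  have d1: "H \<inter> m ` H = {}" unfolding H_def iq.half_plane_def m_def by auto
  have d2: "{(0, 0)} \<inter> (H \<union> m ` H) = {}" unfolding H_def iq.half_plane_def m_def by auto
  have sub: "q summable_on X" for X using s by (rule summable_on_subset_banach) simp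
  have inj: "inj_on m H" by (auto simp: m_def intro!: inj_onI)
  have "infsum q UNIV = infsum q {(0, 0)} + infsum q (H \<union> m ` H)"
    unfolding U by (rule infsum_Un_disjoint[OF sub sub d2])
  also have "infsum q (H \<union> m ` H) = infsum q H + infsum q (m ` H)"
    by (rule infsum_Un_disjoint[OF sub sub d1])
  also have "infsum q (m ` H) = infsum (q \<circ> m) H" by (rule infsum_reindex[OF inj])
  also have "q \<circ> m = q" by (auto simp: m_def sym)
  finally show ?thesis by (simp add: q0 H_def)
qed

text \<open>The essential point is that A is common to all classes: it depends only on the
  discriminant -k of their forms.\<close>

lemma class_asymptotics:
  obtains A :: real where "A > 0"
    "\<And>C. C \<in> ideal_classes \<Longrightarrow> ((\<lambda>t. infsum (weight t) C - A / t) \<longlongrightarrow> - 1 / 2) (at_right 0)"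
proof -
  obtain \<kappa> :: real where \<kappa>: "\<kappa> > 0" and theta:
    "\<And>a b c D :: real. a > 0 \<Longrightarrow> D > 0 \<Longrightarrow> 4 * a * c = b\<^sup>2 + D \<Longrightarrow>
      (\<forall>\<^sub>F t in at_right 0. (\<lambda>(x, y). exp (- t * (a * (of_int x)\<^sup>2 + b * of_int x * of_int y + c * (of_int y)\<^sup>2)))
          summable_on (UNIV :: (int \<times> int) set)) \<and>
      ((\<lambda>t. (\<Sum>\<^sub>\<infinity>(x, y)\<in>(UNIV :: (int \<times> int) set).
          exp (- t * (a * (of_int x)\<^sup>2 + b * of_int x * of_int y + c * (of_int y)\<^sup>2))) - \<kappa> / sqrt D / t) \<longlongrightarrow> 0) (at_right 0)"
    using theta_asymptotics by blast
  define A where "A = \<kappa> / sqrt (real k) / 2"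
  have "A > 0" using \<kappa> by (simp add: A_def)
  moreover have "((\<lambda>t. infsum (weight t) C - A / t) \<longlongrightarrow> - 1 / 2) (at_right 0)" if C: "C \<in> ideal_classes" for C
  proof -
    obtain a b c :: int and \<phi> where form: "a > 0" "4 * a * c = b\<^sup>2 + int k" "bij_betw \<phi> iq.half_plane C"
      "\<And>x y. (x, y) \<in> iq.half_plane \<Longrightarrow> int (iq.ideal_norm (\<phi> (x, y))) = a * x\<^sup>2 + b * x * y + c * y\<^sup>2"
      by (rule iq.class_parametrization[OF C[unfolded ideal_classes_def]]) (rule that, assumption+)
    define q where "q = (\<lambda>t. (\<lambda>(x, y). exp (- t * (of_int a * (of_int x)\<^sup>2 + of_int b * of_int x * of_int y + of_int c * (of_int y)\<^sup>2)) :: real))"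
    have disc: "4 * of_int a * of_int c = (of_int b)\<^sup>2 + real k"
    proof -
      have "(of_int (4 * a * c) :: real) = of_int (b\<^sup>2 + int k)" unfolding form(2) ..
      thus ?thesis by simp
    qed
    have th: "\<forall>\<^sub>F t in at_right 0. q t summable_on UNIV"
      "((\<lambda>t. infsum (q t) UNIV - \<kappa> / sqrt (real k) / t) \<longlongrightarrow> 0) (at_right 0)"
      using theta[of "of_int a" "real k" "of_int c" "of_int b"] form(1) disc unfolding q_def by simp_all
    have eq: "infsum (weight t) C = (infsum (q t) UNIV - 1) / 2" if "q t summable_on UNIV" for t
    proof -
      have "infsum (weight t) C = (\<Sum>\<^sub>\<infinity>p\<in>iq.half_plane. weight t (\<phi> p))"
        by (rule infsum_reindex_bij_betw[OF form(3), symmetric])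
      also have "\<dots> = (\<Sum>\<^sub>\<infinity>p\<in>iq.half_plane. q t p)"
      proof (rule infsum_cong)
        fix p assume p: "p \<in> iq.half_plane"
        obtain x y where xy: "p = (x, y)" by (cases p)
        have "real (iq.ideal_norm (\<phi> (x, y))) = of_int (int (iq.ideal_norm (\<phi> (x, y))))" by simp
        also have "\<dots> = of_int a * (of_int x)\<^sup>2 + of_int b * of_int x * of_int y + of_int c * (of_int y)\<^sup>2"
          using p xy by (subst form(4)) simp_all
        finally show "weight t (\<phi> p) = q t p" by (simp add: weight_def q_def xy mult.commute)
      qed
      also have "\<dots> = (infsum (q t) UNIV - 1) / 2"
        by (rule sum_over_half_plane[OF that]) (simp_all add: q_def)
      finally show ?thesis .
    qed
    have "((\<lambda>t. (infsum (q t) UNIV - \<kappa> / sqrt (real k) / t) / 2 - 1 / 2) \<longlongrightarrow> 0 / 2 - 1 / 2) (at_right 0)"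
      by (intro tendsto_intros th) simp
    moreover have "\<forall>\<^sub>F t in at_right 0. (infsum (q t) UNIV - \<kappa> / sqrt (real k) / t) / 2 - 1 / 2 = infsum (weight t) C - A / t"
      using th(1) by eventually_elim (simp add: eq A_def field_simps)
    ultimately show ?thesis by (simp add: tendsto_cong)
  qed
  ultimately show ?thesis using that by blast
qed

lemma tendsto_times_t:
  fixes f :: "real \<Rightarrow> real"
  assumes "((\<lambda>t. f t - A / t) \<longlongrightarrow> l) (at_right 0)"
  shows "((\<lambda>t. t * f t) \<longlongrightarrow> A) (at_right 0)"
proof -
  have "((\<lambda>t. t * (f t - A / t) + A) \<longlongrightarrow> 0 * l + A) (at_right 0)"
    by (intro tendsto_intros assms)
  moreover have "\<forall>\<^sub>F t in at_right 0. t * (f t - A / t) + A = t * f t"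
    using eventually_at_right_less[of 0] by eventually_elim (simp add: field_simps)
  ultimately show ?thesis by (simp add: tendsto_cong)
qed

text \<open>Finiteness is settled before the classes are counted: any finite family of classes
  contributes at least its cardinality times A to the limit of t Z(t), so L1 / A bounds the
  cardinality. Only then may the constant terms be added up over all classes.\<close>

lemma class_number_formula: "real (card ideal_classes) = L0" and epsilon_eq_1: "\<epsilon> = 1"
proof -
  obtain A :: real where A: "A > 0" and cl: "\<And>C. C \<in> ideal_classes \<Longrightarrow> ((\<lambda>t. infsum (weight t) C - A / t) \<longlongrightarrow> - 1 / 2) (at_right 0)"
    using class_asymptotics by blast
  have disj_sum: "infsum (weight t) (\<Union>\<F>) = (\<Sum>C\<in>\<F>. infsum (weight t) C)" "weight t summable_on \<Union>\<F>"
    if t: "t > 0" and \<F>: "finite \<F>" "\<F> \<subseteq> ideal_classes" for t \<F>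
  proof -
    show s: "weight t summable_on \<Union>\<F>" using \<F>(2) class_subset by (intro class_summable[OF t]) blast
    have "infsum (weight t) (\<Union>C\<in>\<F>. C) = (\<Sum>C\<in>\<F>. infsum (weight t) C)"
    proof (rule sum_infsum[symmetric])
      show "weight t summable_on C" if "C \<in> \<F>" for C
        using that \<F>(2) class_summable[OF t class_subset] by blast
      show "C \<inter> C' = {}" if "C \<in> \<F>" "C' \<in> \<F>" "C \<noteq> C'" for C C'
        using that \<F>(2) ideal_classes_disjoint by blast
    qed (rule \<F>(1))
    thus "infsum (weight t) (\<Union>\<F>) = (\<Sum>C\<in>\<F>. infsum (weight t) C)" by simp
  qed
  have limZ: "((\<lambda>t. t * Z t) \<longlongrightarrow> L1) (at_right 0)" by (rule tendsto_times_t[OF Z_asymptotics])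
  have card_le: "real (card \<F>) * A \<le> L1" if \<F>: "finite \<F>" "\<F> \<subseteq> ideal_classes" for \<F>
  proof (rule tendsto_le[OF _ limZ])
    have "((\<lambda>t. \<Sum>C\<in>\<F>. t * infsum (weight t) C) \<longlongrightarrow> (\<Sum>C\<in>\<F>. A)) (at_right 0)"
      using \<F>(2) by (intro tendsto_sum tendsto_times_t[OF cl]) auto
    thus "((\<lambda>t. \<Sum>C\<in>\<F>. t * infsum (weight t) C) \<longlongrightarrow> real (card \<F>) * A) (at_right 0)" by simp
    show "\<forall>\<^sub>F t in at_right 0. (\<Sum>C\<in>\<F>. t * infsum (weight t) C) \<le> t * Z t"
      using eventually_at_right_less[of 0]
    proof eventually_elim
      case (elim t)
      have "infsum (weight t) (\<Union>\<F>) \<le> infsum (weight t) iq.ideals"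
      proof (rule infsum_mono2)
        show "weight t summable_on iq.ideals" using class_summable[OF elim] by blast
        show "\<Union>\<F> \<subseteq> iq.ideals" using \<F>(2) class_subset by blast
      qed (use disj_sum(2)[OF elim \<F>] in \<open>auto simp: weight_def\<close>)
      also have "\<dots> = Z t" using ideals_has_sum[OF elim] by (rule infsumI)
      finally have "(\<Sum>C\<in>\<F>. infsum (weight t) C) \<le> Z t" unfolding disj_sum(1)[OF elim \<F>] .
      thus ?case using elim by (simp flip: sum_distrib_left)
    qed
  qed simp
  have fin: "finite ideal_classes"
  proof -
    have "card \<F> \<le> nat \<lfloor>L1 / A\<rfloor>" if \<F>: "\<F> \<subseteq> ideal_classes" "finite \<F>" for \<F>
    proof -
      have "real (card \<F>) \<le> L1 / A" using card_le \<F> A by (simp add: pos_le_divide_eq)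
      thus ?thesis by (rule le_nat_floor)
    qed
    thus ?thesis using finite_if_finite_subsets_card_bdd[of ideal_classes "nat \<lfloor>L1 / A\<rfloor>"] by blast
  qed
  have Un: "\<Union>ideal_classes = iq.ideals" unfolding ideal_classes_def by (rule Union_quotient[OF iq.equiv_class_rel])
  have Zsum: "Z t = (\<Sum>C\<in>ideal_classes. infsum (weight t) C)" if "t > 0" for t
    using disj_sum(1)[OF that fin order_refl] infsumI[OF ideals_has_sum[OF that]] Un by simp
  define h where "h = real (card ideal_classes)"
  have "((\<lambda>t. \<Sum>C\<in>ideal_classes. (infsum (weight t) C - A / t)) \<longlongrightarrow> (\<Sum>C\<in>ideal_classes. - 1 / 2)) (at_right 0)"
    by (intro tendsto_sum cl)
  moreover have "\<forall>\<^sub>F t in at_right 0. (\<Sum>C\<in>ideal_classes. (infsum (weight t) C - A / t)) = Z t - h * A / t"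
    using eventually_at_right_less[of 0] by eventually_elim (simp add: Zsum sum_subtractf h_def)
  ultimately have Zh: "((\<lambda>t. Z t - h * A / t) \<longlongrightarrow> - h / 2) (at_right 0)"
    by (simp add: tendsto_cong h_def)
  have L1h: "L1 = h * A"
    by (rule tendsto_unique[OF _ limZ tendsto_times_t[OF Zh]]) simp
  have "- L0 / 2 = - h / 2"
    by (rule tendsto_unique[OF _ Z_asymptotics]) (use Zh L1h in simp_all)
  thus L0h: "real (card ideal_classes) = L0" by (simp add: h_def)
  \<comment> \<open>The unit ideal shows h > 0. Hence L1 > 0, and \<open>L1_eq\<close> with L0 = h
    excludes the negative sign.\<close>
  have "(1, 0, 1) \<in> iq.params" by (simp add: iq.params_def)
  hence "iq.ideals \<noteq> {}" using iq.ideal_of_in_ideals by blast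
  hence "ideal_classes \<noteq> {}" using Un by blast
  hence h0: "h > 0" using fin by (simp add: h_def card_gt_0_iff)
  hence "L1 > 0" using L1h A by simp
  moreover have "L1 = \<epsilon> * (pi / sqrt (real k) * h)" using L1_eq L0h by (simp add: h_def)
  moreover have "pi / sqrt (real k) * h > 0" using h0 by simp
  moreover have "L1 \<noteq> - (pi / sqrt (real k) * h)" using calculation by linarith
  ultimately have "\<epsilon> \<noteq> -1" by auto
  thus "\<epsilon> = 1" using epsilon_cases by blast
qed

end

section \<open>The cotangent sum\<close>

context odd_real_primitive_char
begin

definition X :: "nat \<Rightarrow> real" where "X n = of_int (chi_int (int n))"

lemma chi_X: "\<chi> (int n) = of_real (X n)"
  by (simp add: X_def chi_int)

lemma X_0 [simp]: "X 0 = 0" and X_k [simp]: "X k = 0"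
proof -
  show "X 0 = 0" by (simp add: X_def chi_int_def)
  have "\<chi> (int k) = 0" using chi_add_mult[of 0 1] by simp
  thus "X k = 0" by (simp add: X_def chi_int_def)
qed

text \<open>The imaginary part of the separability of the Gauss sum, with G = i sqrt k now that its
  sign is known.\<close>

lemma sine_sum: "(\<Sum>j = 1..k - 1. X j * sin (2 * pi * real a * real j / real k)) = sqrt (real k) * X a"
proof -
  have "(\<Sum>n<k. \<chi> (int n) * e (int a * int n)) = \<chi> (int a) * G"
    using gauss_sum_separable[of "int a"] by (simp add: sum_residues_nat)
  moreover have "Im (\<chi> (int n) * e (int a * int n)) = X n * sin (2 * pi * real a * real n / real k)" for n
    by (simp add: chi_X e_def mult_ac)
  ultimately have "(\<Sum>n<k. X n * sin (2 * pi * real a * real n / real k)) = Im (\<chi> (int a) * G)"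
    by (metis (no_types, lifting) Im_sum sum.cong)
  also have "\<dots> = sqrt (real k) * X a"
    by (subst G_eq) (simp add: chi_X epsilon_eq_1)
  also have "(\<Sum>n<k. X n * sin (2 * pi * real a * real n / real k)) = (\<Sum>j = 1..k - 1. X j * sin (2 * pi * real a * real j / real k))"
    by (rule sum.mono_neutral_right) (auto simp: Suc_le_eq)
  finally show ?thesis .
qed

definition \<Phi> :: "nat \<Rightarrow> real" where
  "\<Phi> a = (\<Sum>j = 1..k - 1. X j * ((cot (pi * real j / real k))\<^sup>2 * sin (2 * pi * real a * real j / real k)))"

definition \<Psi> :: "nat \<Rightarrow> real" where
  "\<Psi> a = sqrt (real k) * (4 * real a * real (card ideal_classes) - X a - 4 * (\<Sum>m<a. X m * (real a - real m)))"

text \<open>The second difference multiplies sin y by -4 sin^2 (\<theta>/2), the corresponding sum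
  by 4 cos^2 (\<theta>/2); the squared cotangent converts one into the other up to sign. What
  remains are plain sine sums.\<close>

lemma second_difference_sin:
  fixes \<theta> y :: real
  assumes "sin (\<theta> / 2) \<noteq> 0"
  shows "(cot (\<theta> / 2))\<^sup>2 * (sin (y + \<theta>) - 2 * sin y + sin (y - \<theta>)) = - (sin (y + \<theta>) + 2 * sin y + sin (y - \<theta>))"
proof -
  define s c where "s = sin (\<theta> / 2)" and "c = cos (\<theta> / 2)"
  have cos\<theta>: "cos \<theta> = 2 * c\<^sup>2 - 1" "cos \<theta> = 1 - 2 * s\<^sup>2"
    using cos_double_cos[of "\<theta> / 2"] cos_double_sin[of "\<theta> / 2"] by (simp_all add: s_def c_def)
  have "sin (y + \<theta>) + sin (y - \<theta>) = 2 * sin y * cos \<theta>" by (simp add: sin_add sin_diff)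
  hence 1: "sin (y + \<theta>) - 2 * sin y + sin (y - \<theta>) = 2 * sin y * (cos \<theta> - 1)"
    and 2: "sin (y + \<theta>) + 2 * sin y + sin (y - \<theta>) = 2 * sin y * (cos \<theta> + 1)" by (simp_all add: algebra_simps)
  have "(cot (\<theta> / 2))\<^sup>2 * (2 * sin y * (cos \<theta> - 1)) = (c\<^sup>2 / s\<^sup>2) * (2 * sin y * (- 2 * s\<^sup>2))"
    unfolding cos\<theta>(2) by (simp add: cot_def power_divide s_def c_def)
  also have "\<dots> = - (2 * sin y * (2 * c\<^sup>2))" using assms by (simp add: s_def)
  also have "2 * c\<^sup>2 = cos \<theta> + 1" unfolding cos\<theta>(1) by simp
  finally show ?thesis unfolding 1 2 .
qed

lemma \<Phi>_second_difference:
  "\<Phi> (a + 2) - 2 * \<Phi> (a + 1) + \<Phi> a = - sqrt (real k) * (X (a + 2) + 2 * X (a + 1) + X a)"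
proof -
  define S where "S = (\<lambda>a j. sin (2 * pi * real a * real j / real k))"
  have "\<Phi> (a + 2) - 2 * \<Phi> (a + 1) + \<Phi> a =
     (\<Sum>j = 1..k - 1. X j * ((cot (pi * real j / real k))\<^sup>2 * (S (a + 2) j - 2 * S (a + 1) j + S a j)))"
    unfolding \<Phi>_def S_def by (simp add: sum_distrib_left algebra_simps flip: sum_subtractf sum.distrib)
  also have "\<dots> = (\<Sum>j = 1..k - 1. X j * (- (S (a + 2) j + 2 * S (a + 1) j + S a j)))"
  proof (rule sum.cong)
    fix j assume j: "j \<in> {1..k - 1}"
    define \<theta> where "\<theta> = 2 * pi * real j / real k"
    define y where "y = 2 * pi * real (a + 1) * real j / real k"
    have "0 < \<theta> / 2" "\<theta> / 2 < pi" using j by (auto simp: \<theta>_def field_simps)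
    hence "sin (\<theta> / 2) \<noteq> 0" using sin_gt_zero by fastforce
    moreover have "\<theta> / 2 = pi * real j / real k" "S (a + 2) j = sin (y + \<theta>)" "S (a + 1) j = sin y" "S a j = sin (y - \<theta>)"
      by (simp_all add: \<theta>_def y_def S_def field_simps)
    ultimately show "X j * ((cot (pi * real j / real k))\<^sup>2 * (S (a + 2) j - 2 * S (a + 1) j + S a j)) =
        X j * (- (S (a + 2) j + 2 * S (a + 1) j + S a j))"
      using second_difference_sin[of \<theta> y] by simp
  qed simp
  also have "\<dots> = - ((\<Sum>j = 1..k - 1. X j * S (a + 2) j) + 2 * (\<Sum>j = 1..k - 1. X j * S (a + 1) j) + (\<Sum>j = 1..k - 1. X j * S a j))"
    by (simp add: sum_distrib_left algebra_simps flip: sum_negf sum_subtractf sum.distrib)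
  also have "\<dots> = - sqrt (real k) * (X (a + 2) + 2 * X (a + 1) + X a)"
    unfolding S_def sine_sum by (simp add: algebra_simps)
  finally show ?thesis .
qed

lemma \<Psi>_second_difference:
  "\<Psi> (a + 2) - 2 * \<Psi> (a + 1) + \<Psi> a = - sqrt (real k) * (X (a + 2) + 2 * X (a + 1) + X a)"
proof -
  define S where "S = (\<lambda>a. \<Sum>m<a. X m * (real a - real m))"
  have step: "S (Suc a) = S a + (\<Sum>m<Suc a. X m)" for a
  proof -
    have "S (Suc a) = (\<Sum>m<Suc a. X m * (real a - real m) + X m)"
      unfolding S_def by (rule sum.cong) (simp_all add: algebra_simps)
    also have "\<dots> = (\<Sum>m<Suc a. X m * (real a - real m)) + (\<Sum>m<Suc a. X m)" by (rule sum.distrib)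
    also have "(\<Sum>m<Suc a. X m * (real a - real m)) = S a" by (simp add: S_def)
    finally show ?thesis .
  qed
  \<comment> \<open>S is a twofold summation of X, which the second difference undoes; its -4 X (a +
    1) combines with 2 X (a + 1) from the term - X a of \<open>\<Psi>\<close>.\<close>
  have "S (a + 2) - 2 * S (a + 1) + S a = X (a + 1)"
    using step[of a] step[of "Suc a"] by simp
  moreover have \<Psi>: "\<Psi> a = sqrt (real k) * (4 * real a * real (card ideal_classes) - X a - 4 * S a)" for a
    by (simp add: \<Psi>_def S_def)
  have "\<Psi> (a + 2) - 2 * \<Psi> (a + 1) + \<Psi> a =
    sqrt (real k) * (- X (a + 2) + 2 * X (a + 1) - X a - 4 * (S (a + 2) - 2 * S (a + 1) + S a))"
    unfolding \<Psi> by (simp add: algebra_simps)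
  ultimately show ?thesis by (simp add: algebra_simps)
qed

text \<open>The class number formula in disguise: as the values of X sum to 0 over a period, the sum
  of X m (k - m) is minus that of m X m, which is k h.\<close>

lemma \<Psi>_k: "\<Psi> k = 0"
proof -
  have "(\<Sum>m<k. X m) = 0"
  proof -
    have "(\<Sum>j\<in>units. \<chi> j) = (\<Sum>j\<in>{0..<int k}. \<chi> j)" by (rule sum.mono_neutral_left) auto
    hence "(\<Sum>m<k. \<chi> (int m)) = 0" using sum_chi by (simp add: sum_residues_nat)
    hence "of_real (\<Sum>m<k. X m) = (0 :: complex)" by (simp add: chi_X)
    thus ?thesis by (simp only: of_real_eq_0_iff)
  qed
  moreover have "(\<Sum>m<k. X m * (real k - real m)) = real k * (\<Sum>m<k. X m) - (\<Sum>m<k. real m * X m)"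
    by (simp add: algebra_simps sum_subtractf sum_distrib_left)
  moreover have "(\<Sum>m<k. real m * X m) = - real k * real (card ideal_classes)"
    unfolding class_number_formula L0_def by (simp add: sum_residues_nat X_def)
  ultimately show ?thesis by (simp add: \<Psi>_def)
qed

lemma \<Phi>_eq_\<Psi>: "\<Phi> a = \<Psi> a"
proof -
  define \<Delta> where "\<Delta> = (\<lambda>a. \<Phi> a - \<Psi> a)"
  have \<Delta>0: "\<Delta> 0 = 0" by (simp add: \<Delta>_def \<Phi>_def \<Psi>_def)
  have second: "\<Delta> (Suc (Suc a)) = 2 * \<Delta> (Suc a) - \<Delta> a" for a
    using \<Phi>_second_difference[of a] \<Psi>_second_difference[of a] by (simp add: \<Delta>_def)
  have linear: "\<Delta> a = real a * \<Delta> 1 \<and> \<Delta> (Suc a) = real (Suc a) * \<Delta> 1" for a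
    by (induction a) (auto simp: \<Delta>0 second algebra_simps)
  have "\<Phi> k = 0"
    unfolding \<Phi>_def
  proof (rule sum.neutral, rule ballI)
    fix j
    have "2 * pi * real k * real j / real k = 2 * pi * real j" by simp
    moreover have "sin (2 * pi * real j) = 0" using sin_npi[of "2 * j"] by (simp add: mult_ac)
    ultimately show "X j * ((cot (pi * real j / real k))\<^sup>2 * sin (2 * pi * real k * real j / real k)) = 0"
      by (simp only: mult_zero_right)
  qed
  hence "real k * \<Delta> 1 = 0" using linear[of k] \<Psi>_k by (simp add: \<Delta>_def)
  hence "\<Delta> 1 = 0" by simp
  thus ?thesis using linear[of a] by (simp add: \<Delta>_def)
qed

end

theorem theorem4p10:
  fixes k a :: nat and \<chi> :: "int \<Rightarrow> complex"
  assumes "k \<ge> 7" and "odd k"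
    and "dirichlet_char k \<chi>"
    and "\<chi> \<noteq> principal_char k"
    and "real_char \<chi>"
    and "primitive_char k \<chi>"
    and "odd_char \<chi>"
    and "a > 0"
  shows "(\<Sum>j = 1..k - 1. \<chi> (int j) *
            complex_of_real ((cot (pi * real j / real k))\<^sup>2 * sin (2 * pi * real a * real j / real k)))
       = complex_of_real (sqrt (real k)) *
           (4 * of_nat a * of_nat (class_number (quadratic_field (- int k))) - \<chi> (int a)
            - 4 * (\<Sum>m = 0..a - 1. \<chi> (int m) * of_nat (a - m)))"
proof -
  interpret odd_real_primitive_char k \<chi>
    by unfold_locales (use assms in auto)
  have "(\<Sum>j = 1..k - 1. \<chi> (int j) *
            complex_of_real ((cot (pi * real j / real k))\<^sup>2 * sin (2 * pi * real a * real j / real k)))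
      = of_real (\<Phi> a)"
    by (simp add: \<Phi>_def chi_X)
  also have "\<dots> = of_real (sqrt (real k)) *
      (4 * of_nat a * of_nat (card ideal_classes) - \<chi> (int a) - 4 * (\<Sum>m<a. \<chi> (int m) * of_real (real a - real m)))"
    by (simp add: \<Phi>_eq_\<Psi> \<Psi>_def chi_X)
  \<comment> \<open>Positivity of \<open>a\<close> makes the two index ranges agree; for
    \<open>a = 0\<close> truncated subtraction would leave m = 0 on the right.\<close>
  also have "(\<Sum>m<a. \<chi> (int m) * of_real (real a - real m)) = (\<Sum>m = 0..a - 1. \<chi> (int m) * of_nat (a - m))"
    using \<open>a > 0\<close> by (intro sum.cong) (auto simp: of_nat_diff)
  finally show ?thesis unfolding class_number_eq .
qed

end
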